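(* There exist two non-separable, non-isomorphic $C^*$-algebras $\mathcal{C}$ and $\mathcal{D}$ such that $d_{cb}(\mathcal{C},\mathcal{D})=1$.
   Context: For operator spaces $\mathcal{X},\mathcal{Y}$, $d_{cb}(\mathcal{X},\mathcal{Y})=\inf\{\|T\|_{cb}\,\|T^{-1}\|_{cb}\}$, where the infimum runs over all linear completely bounded isomorphisms $T:\mathcal{X}\to\mathcal{Y}$ (with completely bounded inverse). $C^*$-algebras carry their canonical operator space structure; "isomorphic" means $*$-isomorphic. *)

theory Defs
  imports "HOL-Analysis.Analysis"
begin

section \<open>Complex Hilbert spaces\<close>

text \<open>
  The complex inner product is linear in its first argument. The underlying real inner product
  is its real part, so that the norm and the topology of a Hilbert space are those of the classes
  \<^class>\<open>real_inner\<close> and \<^class>\<open>banach\<close>.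
\<close>

class chilbert = real_inner + banach +
  fixes scaleC :: "complex \<Rightarrow> 'a \<Rightarrow> 'a" (infixr \<open>*\<^sub>C\<close> 75)
    and cinner :: "'a \<Rightarrow> 'a \<Rightarrow> complex"
  assumes scaleC_add_right: "c *\<^sub>C (x + y) = c *\<^sub>C x + c *\<^sub>C y"
    and scaleC_add_left: "(c + d) *\<^sub>C x = c *\<^sub>C x + d *\<^sub>C x"
    and scaleC_scaleC: "c *\<^sub>C d *\<^sub>C x = (c * d) *\<^sub>C x"
    and scaleR_scaleC: "r *\<^sub>R x = complex_of_real r *\<^sub>C x"
    and cinner_commute: "cinner x y = cnj (cinner y x)"
    and cinner_add_left: "cinner (x + y) z = cinner x z + cinner y z"
    and cinner_scaleC_left: "cinner (c *\<^sub>C x) y = c * cinner x y"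
    and inner_eq_Re_cinner: "inner x y = Re (cinner x y)"

lemma cinner_self: "cinner x x = complex_of_real ((norm (x :: 'a :: chilbert))\<^sup>2)"
proof -
  have "Im (cinner x x) = - Im (cinner x x)"
    using arg_cong[OF cinner_commute[of x x], of Im] by simp
  moreover have "Re (cinner x x) = (norm x)\<^sup>2"
    by (simp add: inner_eq_Re_cinner[symmetric] power2_norm_eq_inner)
  ultimately show ?thesis
    by (simp add: complex_eq_iff)
qed

lemma norm_scaleC: "norm (c *\<^sub>C (x :: 'a :: chilbert)) = cmod c * norm x"
proof -
  have "cinner (c *\<^sub>C x) (c *\<^sub>C x) = c * cnj c * cinner x x"
    by (metis cinner_commute cinner_scaleC_left complex_cnj_mult mult.assoc mult.commute)
  then have "complex_of_real ((norm (c *\<^sub>C x))\<^sup>2) = complex_of_real ((cmod c * norm x)\<^sup>2)"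
    by (simp only: cinner_self complex_norm_square[symmetric] of_real_mult power_mult_distrib)
  then have "(norm (c *\<^sub>C x))\<^sup>2 = (cmod c * norm x)\<^sup>2"
    using of_real_eq_iff by blast
  then show ?thesis
    by simp
qed

lemma bounded_linear_scaleC: "bounded_linear (\<lambda>x :: 'a :: chilbert. c *\<^sub>C x)"
proof (rule bounded_linear_intro)
  show "c *\<^sub>C (r *\<^sub>R x) = r *\<^sub>R (c *\<^sub>C x)" for r and x :: 'a
    by (simp add: scaleR_scaleC scaleC_scaleC mult.commute)
  show "norm (c *\<^sub>C x) \<le> norm x * cmod c" for x :: 'a
    by (simp add: norm_scaleC)
qed (rule scaleC_add_right)


section \<open>The Hilbert space of square-summable families\<close>

definition square_summable :: "('i \<Rightarrow> complex) \<Rightarrow> bool" where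
  "square_summable f \<longleftrightarrow> (\<lambda>i. (cmod (f i))\<^sup>2) summable_on UNIV"

lemma square_summable_0: "square_summable (\<lambda>_. 0)"
  by (simp add: square_summable_def)

lemma square_summable_add:
  assumes "square_summable f" "square_summable g"
  shows "square_summable (\<lambda>i. f i + g i)"
proof -
  have "(\<lambda>i. 2 * (cmod (f i))\<^sup>2 + 2 * (cmod (g i))\<^sup>2) summable_on UNIV"
    using assms unfolding square_summable_def
    by (intro summable_on_add summable_on_cmult_right)
  moreover have "(cmod (f i + g i))\<^sup>2 \<le> 2 * (cmod (f i))\<^sup>2 + 2 * (cmod (g i))\<^sup>2" for i
  proof -
    have "(cmod (f i + g i))\<^sup>2 \<le> (cmod (f i) + cmod (g i))\<^sup>2"
      by (simp add: norm_triangle_ineq power_mono)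
    also have "\<dots> \<le> 2 * (cmod (f i))\<^sup>2 + 2 * (cmod (g i))\<^sup>2"
      using sum_squares_bound[of "cmod (f i)" "cmod (g i)"] by (simp add: power2_sum)
    finally show ?thesis .
  qed
  ultimately show ?thesis
    unfolding square_summable_def by (rule summable_on_comparison_test) auto
qed

lemma square_summable_scale:
  assumes "square_summable f"
  shows "square_summable (\<lambda>i. c * f i)"
  using summable_on_cmult_right[OF assms[unfolded square_summable_def], of "(cmod c)\<^sup>2"]
  by (simp add: square_summable_def norm_mult power_mult_distrib)

lemma square_summable_mult:
  assumes "square_summable f" "square_summable g"
  shows "(\<lambda>i. f i * cnj (g i)) summable_on UNIV"
proof (rule abs_summable_summable, rule abs_summable_product)
  show "(\<lambda>i. norm (f i * f i)) summable_on UNIV"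
    using assms(1) by (simp add: square_summable_def norm_mult power2_eq_square)
  show "(\<lambda>i. norm (cnj (g i) * cnj (g i))) summable_on UNIV"
    using assms(2) by (simp add: square_summable_def norm_mult power2_eq_square)
qed

typedef 'i ell2 = "{f :: 'i \<Rightarrow> complex. square_summable f}"
  morphisms ell2_nth Abs_ell2
  using square_summable_0 by blast

setup_lifting type_definition_ell2

instantiation ell2 :: (type) real_vector
begin

lift_definition zero_ell2 :: "'a ell2" is "\<lambda>_. 0"
  by (rule square_summable_0)

lift_definition plus_ell2 :: "'a ell2 \<Rightarrow> 'a ell2 \<Rightarrow> 'a ell2" is "\<lambda>f g i. f i + g i"
  by (rule square_summable_add)

lift_definition uminus_ell2 :: "'a ell2 \<Rightarrow> 'a ell2" is "\<lambda>f i. - f i"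
  using square_summable_scale[of _ "-1"] by simp

lift_definition minus_ell2 :: "'a ell2 \<Rightarrow> 'a ell2 \<Rightarrow> 'a ell2" is "\<lambda>f g i. f i - g i"
  using square_summable_add[OF _ square_summable_scale[of _ "-1"]] by simp

lift_definition scaleR_ell2 :: "real \<Rightarrow> 'a ell2 \<Rightarrow> 'a ell2" is "\<lambda>r f i. complex_of_real r * f i"
  by (rule square_summable_scale)

instance
  by standard (transfer; auto simp: fun_eq_iff algebra_simps)+

end

lift_definition ell2_cinner :: "'i ell2 \<Rightarrow> 'i ell2 \<Rightarrow> complex"
  is "\<lambda>f g. \<Sum>\<^sub>\<infinity>i. f i * cnj (g i)" .

lemma ell2_cinner_add_left: "ell2_cinner (x + y) z = ell2_cinner x z + ell2_cinner y z"
  by transfer (simp add: ring_distribs infsum_add square_summable_mult)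

lemma ell2_cinner_commute: "ell2_cinner x y = cnj (ell2_cinner y x)"
  by transfer (simp add: mult.commute flip: infsum_cnj)

lemma ell2_summable: "(\<lambda>i. (cmod (ell2_nth x i))\<^sup>2) summable_on UNIV"
  using ell2_nth[of x] by (simp add: square_summable_def)

lemma ell2_cinner_self: "ell2_cinner x x = complex_of_real (\<Sum>\<^sub>\<infinity>i. (cmod (ell2_nth x i))\<^sup>2)"
proof -
  have "((\<lambda>i. complex_of_real ((cmod (ell2_nth x i))\<^sup>2)) has_sum
          complex_of_real (\<Sum>\<^sub>\<infinity>i. (cmod (ell2_nth x i))\<^sup>2)) UNIV"
    by (intro has_sum_of_real has_sum_infsum ell2_summable)
  then show ?thesis
    by (simp add: ell2_cinner.rep_eq complex_norm_square[symmetric] infsumI)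
qed

instantiation ell2 :: (type) real_inner
begin

definition inner_ell2 :: "'a ell2 \<Rightarrow> 'a ell2 \<Rightarrow> real" where
  "inner_ell2 x y = Re (ell2_cinner x y)"

definition norm_ell2 :: "'a ell2 \<Rightarrow> real" where
  "norm_ell2 x = sqrt (inner x x)"

definition sgn_ell2 :: "'a ell2 \<Rightarrow> 'a ell2" where
  "sgn_ell2 x = x /\<^sub>R norm x"

definition dist_ell2 :: "'a ell2 \<Rightarrow> 'a ell2 \<Rightarrow> real" where
  "dist_ell2 x y = norm (x - y)"

definition uniformity_ell2 :: "('a ell2 \<times> 'a ell2) filter" where
  "uniformity_ell2 = (INF e\<in>{0<..}. principal {(x, y). dist x y < e})"

definition open_ell2 :: "'a ell2 set \<Rightarrow> bool" where
  "open_ell2 U \<longleftrightarrow> (\<forall>x\<in>U. \<forall>\<^sub>F (x', y) in uniformity. x' = x \<longrightarrow> y \<in> U)"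

instance
proof
  fix x y z :: "'a ell2" and r :: real
  show "inner x y = inner y x"
    unfolding inner_ell2_def by (subst ell2_cinner_commute) simp
  show "inner (x + y) z = inner x z + inner y z"
    by (simp add: inner_ell2_def ell2_cinner_add_left)
  show "inner (r *\<^sub>R x) y = r * inner x y"
  proof -
    have "ell2_cinner (r *\<^sub>R x) y = complex_of_real r * ell2_cinner x y"
      by transfer (simp add: mult.assoc infsum_cmult_right')
    then show ?thesis
      by (simp add: inner_ell2_def)
  qed
  show "0 \<le> inner x x"
    by (simp add: inner_ell2_def ell2_cinner_self infsum_nonneg)
  show "inner x x = 0 \<longleftrightarrow> x = 0"
  proof
    assume "inner x x = 0"
    then have s: "(\<Sum>\<^sub>\<infinity>i. (cmod (ell2_nth x i))\<^sup>2) = 0"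
      by (simp add: inner_ell2_def ell2_cinner_self)
    have "ell2_nth x i = 0" for i
      using nonneg_infsum_le_0D[OF _ ell2_summable[of x], of i] s by simp
    then show "x = 0"
      by (simp add: ell2_nth_inject[symmetric] zero_ell2.rep_eq fun_eq_iff)
  next
    assume "x = 0"
    then show "inner x x = 0"
      by (simp add: inner_ell2_def ell2_cinner_self zero_ell2.rep_eq)
  qed
qed (simp_all add: norm_ell2_def sgn_ell2_def dist_ell2_def uniformity_ell2_def open_ell2_def)

end

lemma norm_ell2_power2: "(norm x)\<^sup>2 = (\<Sum>\<^sub>\<infinity>i. (cmod (ell2_nth x i))\<^sup>2)"
  by (simp add: norm_ell2_def inner_ell2_def ell2_cinner_self infsum_nonneg)

lemma sum_le_norm_ell2:
  "finite F \<Longrightarrow> (\<Sum>i\<in>F. (cmod (ell2_nth x i))\<^sup>2) \<le> (norm x)\<^sup>2"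
  unfolding norm_ell2_power2 by (rule finite_sum_le_infsum[OF ell2_summable]) auto

lemma norm_ell2_nth_le: "cmod (ell2_nth x i) \<le> norm x"
  using sum_le_norm_ell2[of "{i}" x] by (simp add: power2_le_iff_abs_le)

instance ell2 :: (type) banach
proof
  fix X :: "nat \<Rightarrow> 'a ell2"
  assume X: "Cauchy X"
  have "Cauchy (\<lambda>n. ell2_nth (X n) i)" for i
  proof (rule metric_CauchyI)
    fix e :: real assume "e > 0"
    then obtain M where M: "\<And>m n. m \<ge> M \<Longrightarrow> n \<ge> M \<Longrightarrow> dist (X m) (X n) < e"
      using metric_CauchyD[OF X] by blast
    have "dist (ell2_nth (X m) i) (ell2_nth (X n) i) < e" if "m \<ge> M" "n \<ge> M" for m n
      using norm_ell2_nth_le[of "X m - X n" i] M[OF that]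
      by (simp add: dist_norm minus_ell2.rep_eq)
    then show "\<exists>M. \<forall>m\<ge>M. \<forall>n\<ge>M. dist (ell2_nth (X m) i) (ell2_nth (X n) i) < e"
      by blast
  qed
  then have "\<exists>L. (\<lambda>n. ell2_nth (X n) i) \<longlonglongrightarrow> L" for i
    by (simp add: Cauchy_convergent_iff convergent_def)
  then obtain L where L: "\<And>i. (\<lambda>n. ell2_nth (X n) i) \<longlonglongrightarrow> L i"
    by metis
  have bound: "(\<Sum>i\<in>F. (cmod (L i - ell2_nth (X n) i))\<^sup>2) \<le> e\<^sup>2"
    if M: "\<And>m n. m \<ge> M \<Longrightarrow> n \<ge> M \<Longrightarrow> dist (X m) (X n) < e" and "n \<ge> M" "finite F" for M n F e
  proof (rule LIMSEQ_le_const2)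
    show "(\<lambda>m. \<Sum>i\<in>F. (cmod (ell2_nth (X m) i - ell2_nth (X n) i))\<^sup>2)
            \<longlonglongrightarrow> (\<Sum>i\<in>F. (cmod (L i - ell2_nth (X n) i))\<^sup>2)"
      by (intro tendsto_intros L)
    have "(\<Sum>i\<in>F. (cmod (ell2_nth (X m) i - ell2_nth (X n) i))\<^sup>2) \<le> e\<^sup>2" if "m \<ge> M" for m
    proof -
      have "(\<Sum>i\<in>F. (cmod (ell2_nth (X m) i - ell2_nth (X n) i))\<^sup>2) \<le> (norm (X m - X n))\<^sup>2"
        using sum_le_norm_ell2[OF \<open>finite F\<close>, of "X m - X n"] by (simp add: minus_ell2.rep_eq)
      also have "\<dots> \<le> e\<^sup>2"
        using M[OF that \<open>n \<ge> M\<close>] by (intro power_mono) (auto simp: dist_norm)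
      finally show ?thesis .
    qed
    then show "\<exists>N. \<forall>m\<ge>N. (\<Sum>i\<in>F. (cmod (ell2_nth (X m) i - ell2_nth (X n) i))\<^sup>2) \<le> e\<^sup>2"
      by blast
  qed
  have diff: "square_summable (\<lambda>i. L i - ell2_nth (X n) i)"
    if "\<And>m n. m \<ge> M \<Longrightarrow> n \<ge> M \<Longrightarrow> dist (X m) (X n) < e" "n \<ge> M" for M n e
    unfolding square_summable_def
    by (rule nonneg_bdd_above_summable_on)
      (auto intro!: bdd_aboveI2[where M = "e\<^sup>2"] bound[OF that])
  obtain M1 where M1: "\<And>m n. m \<ge> M1 \<Longrightarrow> n \<ge> M1 \<Longrightarrow> dist (X m) (X n) < 1"
    using metric_CauchyD[OF X, of 1] by auto
  have "square_summable (\<lambda>i. (L i - ell2_nth (X M1) i) + ell2_nth (X M1) i)"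
    using diff[OF M1, of M1] ell2_nth[of "X M1"] by (intro square_summable_add) auto
  then obtain l where l: "ell2_nth l = L"
    using Abs_ell2_inverse[of L] by auto
  have "X \<longlonglongrightarrow> l"
  proof (rule metric_LIMSEQ_I)
    fix r :: real assume "r > 0"
    then obtain M where M: "\<And>m n. m \<ge> M \<Longrightarrow> n \<ge> M \<Longrightarrow> dist (X m) (X n) < r / 2"
      using metric_CauchyD[OF X, of "r / 2"] by auto
    have "dist (X n) l < r" if "n \<ge> M" for n
    proof -
      have "(norm (l - X n))\<^sup>2 \<le> (r / 2)\<^sup>2"
        unfolding norm_ell2_power2
        using bound[OF M that]
        by (intro infsum_le_finite_sums ell2_summable) (auto simp: minus_ell2.rep_eq l)
      then have "norm (l - X n) \<le> r / 2"
        using \<open>r > 0\<close> by (simp add: power2_le_iff_abs_le)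
      then show ?thesis
        using \<open>r > 0\<close> by (simp add: dist_norm norm_minus_commute)
    qed
    then show "\<exists>no. \<forall>n\<ge>no. dist (X n) l < r"
      by blast
  qed
  then show "convergent X"
    by (rule convergentI)
qed

instantiation ell2 :: (type) chilbert
begin

lift_definition scaleC_ell2 :: "complex \<Rightarrow> 'a ell2 \<Rightarrow> 'a ell2" is "\<lambda>c f i. c * f i"
  by (rule square_summable_scale)

definition cinner_ell2 :: "'a ell2 \<Rightarrow> 'a ell2 \<Rightarrow> complex" where
  "cinner_ell2 = ell2_cinner"

instance
proof
  fix x y z :: "'a ell2" and c d :: complex and r :: real
  show "c *\<^sub>C (x + y) = c *\<^sub>C x + c *\<^sub>C y" "(c + d) *\<^sub>C x = c *\<^sub>C x + d *\<^sub>C x"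
    "c *\<^sub>C d *\<^sub>C x = (c * d) *\<^sub>C x" "r *\<^sub>R x = complex_of_real r *\<^sub>C x"
    by (transfer; simp add: fun_eq_iff algebra_simps)+
  show "cinner x y = cnj (cinner y x)"
    unfolding cinner_ell2_def by (rule ell2_cinner_commute)
  show "cinner (x + y) z = cinner x z + cinner y z"
    unfolding cinner_ell2_def by (rule ell2_cinner_add_left)
  show "cinner (c *\<^sub>C x) y = c * cinner x y"
    unfolding cinner_ell2_def by transfer (simp add: mult.assoc infsum_cmult_right')
  show "inner x y = Re (cinner x y)"
    by (simp add: cinner_ell2_def inner_ell2_def)
qed

end


section \<open>Operator spaces and C*-algebras\<close>

text \<open>
  \<^typ>\<open>'h \<Rightarrow>\<^sub>L 'h\<close> is the type of bounded real-linear operators; the complex-linear ones,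
  which make up \<open>B(H)\<close>, are singled out by a predicate.
\<close>

definition clinear_op :: "('h::chilbert \<Rightarrow>\<^sub>L 'h) \<Rightarrow> bool" where
  "clinear_op a \<longleftrightarrow> (\<forall>c x. blinfun_apply a (c *\<^sub>C x) = c *\<^sub>C blinfun_apply a x)"

lift_definition scale_op :: "complex \<Rightarrow> ('h::chilbert \<Rightarrow>\<^sub>L 'h) \<Rightarrow> ('h \<Rightarrow>\<^sub>L 'h)"
  is "\<lambda>c a x. c *\<^sub>C a x"
  by (rule bounded_linear_compose[OF bounded_linear_scaleC])

definition is_adjoint :: "('h::chilbert \<Rightarrow>\<^sub>L 'h) \<Rightarrow> ('h \<Rightarrow>\<^sub>L 'h) \<Rightarrow> bool" where
  "is_adjoint a b \<longleftrightarrow>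
     (\<forall>x y. cinner (blinfun_apply a x) y = cinner x (blinfun_apply b y))"

definition operator_space :: "('h::chilbert \<Rightarrow>\<^sub>L 'h) set \<Rightarrow> bool" where
  "operator_space X \<longleftrightarrow>
     (\<forall>a\<in>X. clinear_op a) \<and> 0 \<in> X \<and> (\<forall>a\<in>X. \<forall>b\<in>X. a + b \<in> X) \<and>
     (\<forall>c. \<forall>a\<in>X. scale_op c a \<in> X) \<and> closed X"

text \<open>
  C*-algebras are norm-closed self-adjoint subalgebras of \<open>B(H)\<close>, not necessarily unital;
  their canonical operator space structure is the one inherited from \<open>B(H)\<close>.
\<close>

definition cstar_algebra :: "('h::chilbert \<Rightarrow>\<^sub>L 'h) set \<Rightarrow> bool" where
  "cstar_algebra A \<longleftrightarrow>
     operator_space A \<and> (\<forall>a\<in>A. \<forall>b\<in>A. a o\<^sub>L b \<in> A) \<and> (\<forall>a\<in>A. \<exists>b\<in>A. is_adjoint a b)"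

definition clinear_on ::
  "('h::chilbert \<Rightarrow>\<^sub>L 'h) set \<Rightarrow> (('h \<Rightarrow>\<^sub>L 'h) \<Rightarrow> ('k::chilbert \<Rightarrow>\<^sub>L 'k)) \<Rightarrow> bool" where
  "clinear_on X T \<longleftrightarrow>
     (\<forall>a\<in>X. \<forall>b\<in>X. T (a + b) = T a + T b) \<and> (\<forall>c. \<forall>a\<in>X. T (scale_op c a) = scale_op c (T a))"

definition star_isomorphism ::
  "('h::chilbert \<Rightarrow>\<^sub>L 'h) set \<Rightarrow> ('k::chilbert \<Rightarrow>\<^sub>L 'k) set \<Rightarrow>
     (('h \<Rightarrow>\<^sub>L 'h) \<Rightarrow> ('k \<Rightarrow>\<^sub>L 'k)) \<Rightarrow> bool" where
  "star_isomorphism A B \<phi> \<longleftrightarrow>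
     bij_betw \<phi> A B \<and> clinear_on A \<phi> \<and>
     (\<forall>a\<in>A. \<forall>b\<in>A. \<phi> (a o\<^sub>L b) = \<phi> a o\<^sub>L \<phi> b) \<and>
     (\<forall>a\<in>A. \<forall>b\<in>A. is_adjoint a b \<longrightarrow> is_adjoint (\<phi> a) (\<phi> b))"

definition star_isomorphic ::
  "('h::chilbert \<Rightarrow>\<^sub>L 'h) set \<Rightarrow> ('k::chilbert \<Rightarrow>\<^sub>L 'k) set \<Rightarrow> bool" where
  "star_isomorphic A B \<longleftrightarrow> (\<exists>\<phi>. star_isomorphism A B \<phi>)"


section \<open>Completely bounded maps\<close>

text \<open>
  The norm of the operator matrix \<open>(a i j)\<close>, \<open>i, j < n\<close>, acting on the Hilbert space
  direct sum of \<open>n\<close> copies of \<open>H\<close>. Values of \<open>a\<close> and \<open>\<xi>\<close> at indices \<open>\<ge> n\<close> are irrelevant.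
\<close>

definition matrix_norm :: "nat \<Rightarrow> (nat \<Rightarrow> nat \<Rightarrow> ('h::chilbert \<Rightarrow>\<^sub>L 'h)) \<Rightarrow> real" where
  "matrix_norm n a =
     (SUP \<xi> \<in> {\<xi> :: nat \<Rightarrow> 'h. L2_set (\<lambda>j. norm (\<xi> j)) {..<n} \<le> 1}.
        L2_set (\<lambda>i. norm (\<Sum>j<n. blinfun_apply (a i j) (\<xi> j))) {..<n})"

definition amplification_norm ::
  "nat \<Rightarrow> ('h::chilbert \<Rightarrow>\<^sub>L 'h) set \<Rightarrow> (('h \<Rightarrow>\<^sub>L 'h) \<Rightarrow> ('k::chilbert \<Rightarrow>\<^sub>L 'k)) \<Rightarrow> ennreal" where
  "amplification_norm n X T =
     (SUP a \<in> {a. (\<forall>i<n. \<forall>j<n. a i j \<in> X) \<and> matrix_norm n a \<le> 1}.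
        ennreal (matrix_norm n (\<lambda>i j. T (a i j))))"

definition cb_norm ::
  "('h::chilbert \<Rightarrow>\<^sub>L 'h) set \<Rightarrow> (('h \<Rightarrow>\<^sub>L 'h) \<Rightarrow> ('k::chilbert \<Rightarrow>\<^sub>L 'k)) \<Rightarrow> ennreal" where
  "cb_norm X T = (SUP n. amplification_norm n X T)"

definition cb_isomorphism ::
  "('h::chilbert \<Rightarrow>\<^sub>L 'h) set \<Rightarrow> ('k::chilbert \<Rightarrow>\<^sub>L 'k) set \<Rightarrow>
     (('h \<Rightarrow>\<^sub>L 'h) \<Rightarrow> ('k \<Rightarrow>\<^sub>L 'k)) \<Rightarrow> bool" where
  "cb_isomorphism X Y T \<longleftrightarrow>
     bij_betw T X Y \<and> clinear_on X T \<and> cb_norm X T < \<infinity> \<and> cb_norm Y (inv_into X T) < \<infinity>"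

text \<open>The infimum is taken in \<^typ>\<open>ennreal\<close>, hence it is \<open>\<infinity>\<close> if there is no such \<open>T\<close>.\<close>

definition d_cb ::
  "('h::chilbert \<Rightarrow>\<^sub>L 'h) set \<Rightarrow> ('k::chilbert \<Rightarrow>\<^sub>L 'k) set \<Rightarrow> ennreal" where
  "d_cb X Y = (INF T \<in> {T. cb_isomorphism X Y T}. cb_norm X T * cb_norm Y (inv_into X T))"

end

theory Submission
  imports Defs "HOL-Library.Countable_Set_Type"
begin

text \<open>
  Let \<open>(A\<^sub>s)\<close> be an uncountable family of infinite subsets of \<open>\<nat>\<close> with finite pairwise intersections.
  The coordinate projections \<open>P\<^sub>s\<close> onto \<open>A\<^sub>s\<close> are orthogonal modulo finite-rank operators. Split the
  index set into uncountable parts \<open>J1\<close> and \<open>J2\<close>. For a sequence \<open>t\<close> of positive numbers let \<open>Alg t\<close>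
  be the closed span of the compact operators on \<open>\<ell>\<^sup>2(\<nat>) \<otimes> \<ell>\<^sup>2(\<nat>) \<otimes> \<complex>\<^sup>2\<close> and of the projections
  \<open>P\<^sub>s \<otimes> q\<^sub>m \<otimes> |u\<rangle>\<langle>u|\<close>, where \<open>q\<^sub>m\<close> projects onto the \<open>m\<close>-th basis vector and \<open>u\<close> is the unit vector in
  the direction of \<open>(1, 0)\<close> if \<open>s \<in> J1\<close>, and of \<open>(1, t\<^sub>m)\<close> if \<open>s \<in> J2\<close>. This is a non-separable
  C*-algebra, an extension of \<open>c\<^sub>0\<close> of an uncountable set by the compact operators.

  The algebras depend continuously on \<open>t\<close> as operator spaces. If \<open>L\<close> is the diagonal operator that
  multiplies the second coordinate of \<open>\<complex>\<^sup>2\<close> by \<open>t'\<^sub>m / t\<^sub>m\<close>, then \<open>x \<mapsto> L x L*\<close> takes the generators of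
  \<open>Alg t\<close> to multiples of those of \<open>Alg t'\<close>. Its completely bounded norm is at most \<open>\<parallel>L\<parallel>\<^sup>2\<close>, so it is
  almost completely isometric if the quotients are close to \<open>1\<close>. The coordinate \<open>m\<close> may also be
  permuted. Take for \<open>t'\<close> the sequence \<open>1 + 1 / (n + 1)\<close>, and for \<open>t\<close> the same sequence with its
  limit \<open>1\<close> put in front. Moving this \<open>1\<close> to a late place makes all quotients as close to \<open>1\<close> as
  desired, and so the completely bounded distance is \<open>1\<close> (\<open>d_cb_Alg_le\<close>, \<open>d_cb_seq\<close>).

  The algebras are not isomorphic because the set of the values \<open>t\<^sub>m\<close> is an invariant
  (\<open>star_isomorphic_params\<close>). A *-isomorphism is contractive, preserves the compact operators because
  it preserves minimal projections (\<open>star_isomorphism_Kop\<close>), and takes generators to generators modulo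
  the compact operators (\<open>star_isomorphism_gen\<close>). To see that it also preserves the angles between the
  vectors \<open>u\<close>, the family \<open>(A\<^sub>s)\<close> is chosen as a Luzin family: for uncountable sets \<open>X\<close> and \<open>Y\<close> of indices
  and every \<open>n\<close> some \<open>A\<^sub>x\<close> and \<open>A\<^sub>y\<close> with \<open>x \<in> X\<close>, \<open>y \<in> Y\<close> have a common element \<open>k \<ge> n\<close>. The
  compact perturbations take their values in a separable space. Therefore, on uncountable sets of
  generators, they are almost constant and can be neglected on basis vectors with large \<open>k\<close>. At a common
  element \<open>k\<close> of two sets, what is left of the product of two generators has the cosine of the angle
  as its norm (\<open>angle_le\<close>).
\<close>

section \<open>Inner products\<close>

lemma cinner_add_right: "cinner x (y + z) = cinner x y + cinner x (z :: 'a :: chilbert)"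
  by (metis cinner_add_left cinner_commute complex_cnj_add)

lemma cinner_scaleC_right: "cinner x (c *\<^sub>C y) = cnj c * cinner x (y :: 'a :: chilbert)"
  by (metis cinner_commute cinner_scaleC_left complex_cnj_mult)

lemma scaleC_one [simp]: "1 *\<^sub>C x = (x :: 'a :: chilbert)"
  by (metis of_real_1 scaleR_one scaleR_scaleC)

lemma scaleC_zero [simp]: "0 *\<^sub>C x = (0 :: 'a :: chilbert)" "c *\<^sub>C 0 = (0 :: 'a :: chilbert)"
  by (metis of_real_0 scaleR_zero_left scaleR_scaleC)
     (metis add_cancel_right_right scaleC_add_right)

lemma scaleC_minus_one: "(- 1) *\<^sub>C x = - (x :: 'a :: chilbert)"
  using scaleR_scaleC[of "-1" x] by simp

lemma cinner_zero [simp]: "cinner 0 x = 0" "cinner x (0 :: 'a :: chilbert) = 0"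
  by (metis add_cancel_right_right cinner_add_left) (metis add_cancel_right_right cinner_add_right)

lemma cinner_minus_left: "cinner (- x) y = - cinner x (y :: 'a :: chilbert)"
  using cinner_scaleC_left[of "-1" x y] by (simp add: scaleC_minus_one)

lemma cinner_diff_left: "cinner (x - z) y = cinner x y - cinner z (y :: 'a :: chilbert)"
  by (metis add_uminus_conv_diff cinner_add_left cinner_minus_left)

lemma cinner_diff_right: "cinner x (y - z) = cinner x y - cinner x (z :: 'a :: chilbert)"
  by (metis add_diff_cancel cinner_add_right diff_add_cancel)

lemma cinner_sum_left: "cinner (\<Sum>i\<in>F. f i) y = (\<Sum>i\<in>F. cinner (f i) (y :: 'a :: chilbert))"
  by (induction F rule: infinite_finite_induct) (auto simp: cinner_add_left)

lemma cinner_eq_0_imp: "cinner x x = 0 \<Longrightarrow> x = (0 :: 'a :: chilbert)"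
  by (simp add: cinner_self)

lemma cmod_cinner_le: "cmod (cinner x y) \<le> norm x * norm (y :: 'a :: chilbert)"
proof (cases "cinner x y = 0")
  case False
  define a where "a = cnj (cinner x y) / cmod (cinner x y)"
  have a: "cmod a = 1"
    using False by (simp add: a_def norm_divide)
  have "a * cinner x y = complex_of_real (cmod (cinner x y))"
  proof -
    have "cnj (cinner x y) * cinner x y = complex_of_real (cmod (cinner x y)) * complex_of_real (cmod (cinner x y))"
      using complex_norm_square[of "cinner x y"] by (simp add: power2_eq_square mult.commute)
    then show ?thesis
      using False by (simp add: a_def)
  qed
  then have "cmod (cinner x y) = inner (a *\<^sub>C x) y"
    by (simp add: inner_eq_Re_cinner cinner_scaleC_left)
  also have "\<dots> \<le> norm (a *\<^sub>C x) * norm y"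
    by (rule norm_cauchy_schwarz)
  finally show ?thesis
    by (simp add: norm_scaleC a)
qed simp

lemma bounded_linear_cinner_left: "bounded_linear (\<lambda>z. cinner z (v :: 'a :: chilbert))"
  by (rule bounded_linear_intro[where K = "norm v"])
     (simp_all add: cinner_add_left scaleR_scaleC cinner_scaleC_left scaleR_conv_of_real cmod_cinner_le)

lemma bounded_linear_cinner_right: "bounded_linear (\<lambda>z. cinner (v :: 'a :: chilbert) z)"
  by (rule bounded_linear_intro[where K = "norm v"])
     (simp_all add: cinner_add_right scaleR_scaleC cinner_scaleC_right scaleR_conv_of_real
        cmod_cinner_le mult.commute[of "norm _" "norm v"])

section \<open>Adjoints\<close>

lemma is_adjointI:
  "(\<And>x y. cinner (blinfun_apply a x) y = cinner x (blinfun_apply b y)) \<Longrightarrow> is_adjoint a b"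
  by (simp add: is_adjoint_def)

lemma is_adjointD: "is_adjoint a b \<Longrightarrow> cinner (blinfun_apply a x) y = cinner x (blinfun_apply b y)"
  by (simp add: is_adjoint_def)

lemma is_adjoint_sym: "is_adjoint a b \<Longrightarrow> is_adjoint b a"
  unfolding is_adjoint_def by (metis cinner_commute)

lemma is_adjoint_unique:
  assumes "is_adjoint a b" "is_adjoint a c"
  shows "b = c"
proof (rule blinfun_eqI)
  fix y
  have "cinner x (blinfun_apply b y - blinfun_apply c y) = 0" for x
    using assms by (simp add: cinner_diff_right is_adjoint_def) 
  then show "blinfun_apply b y = blinfun_apply c y"
    using cinner_eq_0_imp by (metis eq_iff_diff_eq_0)
qed

lemma scale_op_apply [simp]: "blinfun_apply (scale_op c a) x = c *\<^sub>C blinfun_apply a x"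
  by (simp add: scale_op.rep_eq)

lemma norm_scale_op: "norm (scale_op c a) = cmod c * norm (a :: 'h::chilbert \<Rightarrow>\<^sub>L 'h)"
proof -
  have le: "norm (scale_op c a) \<le> cmod c * norm a" for c and a :: "'h \<Rightarrow>\<^sub>L 'h"
    by (rule norm_blinfun_bound)
       (auto simp: norm_scaleC mult.assoc intro!: mult_left_mono norm_blinfun)
  show ?thesis
  proof (cases "c = 0")
    case True
    then show ?thesis using le[of c a] by simp
  next
    case False
    have "a = scale_op (inverse c) (scale_op c a)"
      using False by (intro blinfun_eqI) (simp add: scaleC_scaleC)
    then have "norm a \<le> cmod (inverse c) * norm (scale_op c a)"
      by (metis le)
    then have "cmod c * norm a \<le> norm (scale_op c a)"
      using False by (simp add: norm_inverse norm_divide field_simps)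
    then show ?thesis using le[of c a] by simp
  qed
qed

lemma scale_op_simps:
  "scale_op c (a + b) = scale_op c a + scale_op c b"
  "scale_op c (scale_op d a) = scale_op (c * d) a"
  "scale_op 1 a = a" "scale_op 0 a = 0" "scale_op c 0 = 0"
  "scale_op (-1) a = - a"
  "scale_op (c + d) a = scale_op c a + scale_op d a"
  by (auto intro!: blinfun_eqI simp: plus_blinfun.rep_eq zero_blinfun.rep_eq uminus_blinfun.rep_eq
        scaleC_add_right scaleC_scaleC scaleC_minus_one scaleC_add_left)

lemma blinfun_compose_scale_op_left: "scale_op c a o\<^sub>L b = scale_op c (a o\<^sub>L b)"
  by (auto intro!: blinfun_eqI)

lemma blinfun_compose_scale_op_right:
  "clinear_op a \<Longrightarrow> a o\<^sub>L scale_op c b = scale_op c (a o\<^sub>L b)"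
  by (auto intro!: blinfun_eqI simp: clinear_op_def)

lemma blinfun_compose_assoc: "(a o\<^sub>L b) o\<^sub>L c = a o\<^sub>L (b o\<^sub>L c)"
  by (auto intro!: blinfun_eqI)

lemmas blinfun_compose_distrib =
  bounded_bilinear.add_left[OF bounded_bilinear_blinfun_compose]
  bounded_bilinear.add_right[OF bounded_bilinear_blinfun_compose]
  bounded_bilinear.diff_left[OF bounded_bilinear_blinfun_compose]
  bounded_bilinear.diff_right[OF bounded_bilinear_blinfun_compose]
  bounded_bilinear.zero_left[OF bounded_bilinear_blinfun_compose]
  bounded_bilinear.zero_right[OF bounded_bilinear_blinfun_compose]

lemma bounded_linear_scale_op: "bounded_linear (scale_op c)"
proof (rule bounded_linear_intro[where K = "cmod c"])
  show "scale_op c (a + b) = scale_op c a + scale_op c b" for a b :: "'a \<Rightarrow>\<^sub>L 'a"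
    by (simp add: scale_op_simps)
  show "scale_op c (r *\<^sub>R a) = r *\<^sub>R scale_op c a" for r and a :: "'a \<Rightarrow>\<^sub>L 'a"
    by (auto intro!: blinfun_eqI simp: scaleR_blinfun.rep_eq scaleR_scaleC scaleC_scaleC mult.commute)
  show "norm (scale_op c a) \<le> norm a * cmod c" for a :: "'a \<Rightarrow>\<^sub>L 'a"
    by (simp add: norm_scale_op)
qed

lemma is_adjoint_add: "is_adjoint a b \<Longrightarrow> is_adjoint c d \<Longrightarrow> is_adjoint (a + c) (b + d)"
  by (simp add: is_adjoint_def plus_blinfun.rep_eq cinner_add_left cinner_add_right)

lemma is_adjoint_diff: "is_adjoint a b \<Longrightarrow> is_adjoint c d \<Longrightarrow> is_adjoint (a - c) (b - d)"
  by (simp add: is_adjoint_def minus_blinfun.rep_eq cinner_diff_left cinner_diff_right)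

lemma is_adjoint_scale_op: "is_adjoint a b \<Longrightarrow> is_adjoint (scale_op c a) (scale_op (cnj c) b)"
  by (simp add: is_adjoint_def cinner_scaleC_left cinner_scaleC_right)

lemma is_adjoint_compose: "is_adjoint a b \<Longrightarrow> is_adjoint c d \<Longrightarrow> is_adjoint (a o\<^sub>L c) (d o\<^sub>L b)"
  by (simp add: is_adjoint_def)

lemma is_adjoint_0: "is_adjoint 0 0"
  by (simp add: is_adjoint_def)

lemma is_adjoint_id: "is_adjoint id_blinfun id_blinfun"
  by (simp add: is_adjoint_def)

lemma norm_square_le_compose_adjoint:
  assumes "is_adjoint a b"
  shows "(norm a)\<^sup>2 \<le> norm (b o\<^sub>L a)"
proof -
  have "norm a \<le> sqrt (norm (b o\<^sub>L a))"
  proof (rule norm_blinfun_bound)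
    fix x
    have "complex_of_real ((norm (blinfun_apply a x))\<^sup>2) = cinner x (blinfun_apply (b o\<^sub>L a) x)"
      using assms unfolding cinner_self[symmetric] by (simp add: is_adjoint_def)
    then have "(norm (blinfun_apply a x))\<^sup>2 = cmod (cinner x (blinfun_apply (b o\<^sub>L a) x))"
      by (metis norm_of_real abs_of_nonneg zero_le_power2)
    also have "\<dots> \<le> norm x * norm (blinfun_apply (b o\<^sub>L a) x)"
      by (rule cmod_cinner_le)
    also have "\<dots> \<le> norm x * (norm (b o\<^sub>L a) * norm x)"
      by (intro mult_left_mono norm_blinfun) auto
    also have "\<dots> = (sqrt (norm (b o\<^sub>L a)) * norm x)\<^sup>2"
      by (simp add: power_mult_distrib power2_eq_square)
    finally show "norm (blinfun_apply a x) \<le> sqrt (norm (b o\<^sub>L a)) * norm x"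
      by (rule power2_le_imp_le) simp
  qed simp
  then show ?thesis
    by (metis norm_ge_zero real_sqrt_le_iff real_sqrt_unique sqrt_le_D)
qed

lemma norm_adjoint_le: "is_adjoint a b \<Longrightarrow> norm a \<le> norm b"
proof -
  assume ab: "is_adjoint a b"
  have "(norm a)\<^sup>2 \<le> norm b * norm a"
    using norm_square_le_compose_adjoint[OF ab] norm_blinfun_compose[of b a] by linarith
  then show ?thesis
    by (metis mult_right_le_imp_le norm_ge_zero norm_zero order_le_less power2_eq_square zero_less_norm_iff)
qed

lemma norm_adjoint: "is_adjoint a b \<Longrightarrow> norm b = norm a"
  using norm_adjoint_le is_adjoint_sym by (metis order_antisym)

lemma norm_compose_adjoint:
  assumes "is_adjoint a b"
  shows "norm (b o\<^sub>L a) = (norm a)\<^sup>2"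
proof -
  have "norm (b o\<^sub>L a) \<le> norm b * norm a"
    by (rule norm_blinfun_compose)
  then show ?thesis
    using norm_square_le_compose_adjoint[OF assms] norm_adjoint[OF assms]
    by (simp add: power2_eq_square)
qed

lemma norm_projection_le_1:
  assumes "is_adjoint p p" "p o\<^sub>L p = p"
  shows "norm p \<le> 1"
proof -
  have "(norm p)\<^sup>2 = norm p"
    using norm_compose_adjoint[OF assms(1)] assms(2) by simp
  then show ?thesis
    by (auto simp: power2_eq_square)
qed

text \<open>Adjoints are defined for real-linear operators here, and complex linearity comes for free: the
  adjoint is tested against a complex inner product.\<close>

lemma is_adjoint_clinear:
  assumes "is_adjoint a b"
  shows "clinear_op a"
  unfolding clinear_op_def
proof (intro allI)
  fix c x
  have "cinner (blinfun_apply a (c *\<^sub>C x) - c *\<^sub>C blinfun_apply a x) y = 0" for y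
    using assms by (simp add: cinner_diff_left is_adjoint_def cinner_scaleC_left)
  then show "blinfun_apply a (c *\<^sub>C x) = c *\<^sub>C blinfun_apply a x"
    using cinner_eq_0_imp by (metis eq_iff_diff_eq_0)
qed

section \<open>Closed linear spans and the C*-algebras they generate\<close>

text \<open>Spans are images of lists of scaled generators, so that a countable set of generators visibly
  has a countable dense set of combinations, those with coefficients in \<open>\<rat> + i\<rat>\<close>.\<close>

definition lincomb :: "(complex \<times> ('h::chilbert \<Rightarrow>\<^sub>L 'h)) list \<Rightarrow> ('h \<Rightarrow>\<^sub>L 'h)" where
  "lincomb xs = (\<Sum>(c, g)\<leftarrow>xs. scale_op c g)"

definition cspan :: "('h::chilbert \<Rightarrow>\<^sub>L 'h) set \<Rightarrow> ('h \<Rightarrow>\<^sub>L 'h) set" where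
  "cspan G = lincomb ` lists (UNIV \<times> G)"

lemma lincomb_simps [simp]:
  "lincomb [] = 0" "lincomb ((c, g) # xs) = scale_op c g + lincomb xs"
  "lincomb (xs @ ys) = lincomb xs + lincomb ys"
  by (auto simp: lincomb_def)

lemma cspan_induct [consumes 1, case_names zero add]:
  assumes "a \<in> cspan G" "P 0" "\<And>c g a. g \<in> G \<Longrightarrow> a \<in> cspan G \<Longrightarrow> P a \<Longrightarrow> P (scale_op c g + a)"
  shows "P a"
proof -
  have "xs \<in> lists (UNIV \<times> G) \<Longrightarrow> P (lincomb xs)" for xs
  proof (induction xs)
    case Nil
    then show ?case using assms(2) by simp
  next
    case (Cons x xs)
    then show ?case
      using assms(3)[of "snd x" "lincomb xs" "fst x"] by (cases x) (auto simp: cspan_def)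
  qed
  then show ?thesis
    using assms(1) by (auto simp: cspan_def)
qed

lemma cspan_step:
  assumes "g \<in> G" "a \<in> cspan G"
  shows "scale_op c g + a \<in> cspan G"
proof -
  obtain xs where "xs \<in> lists (UNIV \<times> G)" "a = lincomb xs"
    using assms by (auto simp: cspan_def)
  then show ?thesis
    unfolding cspan_def by (intro image_eqI[of _ _ "(c, g) # xs"]) (use assms in auto)
qed

lemma cspan_zero: "0 \<in> cspan G"
  unfolding cspan_def by (rule image_eqI[of _ _ "[]"]) auto

lemma cspan_add: "a \<in> cspan G \<Longrightarrow> b \<in> cspan G \<Longrightarrow> a + b \<in> cspan G"
  by (induction rule: cspan_induct) (auto simp: add.assoc cspan_step)

lemma cspan_base: "g \<in> G \<Longrightarrow> g \<in> cspan G"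
  unfolding cspan_def
  by (rule image_eqI[of _ _ "[(1, g)]"]) (auto simp: scale_op_simps)

lemma cspan_scale: "a \<in> cspan G \<Longrightarrow> scale_op c a \<in> cspan G"
proof (induction rule: cspan_induct)
  case (add d g a)
  then show ?case
    by (simp add: scale_op_simps cspan_step)
qed (simp add: scale_op_simps cspan_zero)

lemma cspan_minimal:
  assumes "a \<in> cspan G" "\<And>g. g \<in> G \<Longrightarrow> g \<in> S" "0 \<in> S"
    "\<And>x y. x \<in> S \<Longrightarrow> y \<in> S \<Longrightarrow> x + y \<in> S" "\<And>c x. x \<in> S \<Longrightarrow> scale_op c x \<in> S"
  shows "a \<in> S"
  using assms(1) by (induction rule: cspan_induct) (auto intro: assms)

definition closed_span :: "('h::chilbert \<Rightarrow>\<^sub>L 'h) set \<Rightarrow> ('h \<Rightarrow>\<^sub>L 'h) set" where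
  "closed_span G = closure (cspan G)"

lemma cspan_subset_closed_span: "cspan G \<subseteq> closed_span G"
  by (simp add: closed_span_def closure_subset)

lemma closed_span_base: "g \<in> G \<Longrightarrow> g \<in> closed_span G"
  using cspan_base cspan_subset_closed_span by blast

lemma closed_closed_span: "closed (closed_span G)"
  by (simp add: closed_span_def)

lemma closed_span_minimal:
  assumes "a \<in> closed_span G" "\<And>g. g \<in> G \<Longrightarrow> g \<in> S" "0 \<in> S"
    "\<And>x y. x \<in> S \<Longrightarrow> y \<in> S \<Longrightarrow> x + y \<in> S" "\<And>c x. x \<in> S \<Longrightarrow> scale_op c x \<in> S" "closed S"
  shows "a \<in> S"
proof -
  have "cspan G \<subseteq> S"
    using cspan_minimal[of _ G S] assms by blast
  then have "closure (cspan G) \<subseteq> S"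
    using \<open>closed S\<close> by (simp add: closure_minimal)
  then show ?thesis
    using assms(1) by (auto simp: closed_span_def)
qed

lemma closed_span_zero: "0 \<in> closed_span G"
  using cspan_zero cspan_subset_closed_span by blast

lemma closed_span_seq:
  "a \<in> closed_span G \<longleftrightarrow> (\<exists>f. (\<forall>n. f n \<in> cspan G) \<and> f \<longlonglongrightarrow> a)"
  by (simp add: closed_span_def closure_sequential)

lemma closed_span_add: "a \<in> closed_span G \<Longrightarrow> b \<in> closed_span G \<Longrightarrow> a + b \<in> closed_span G"
proof -
  assume "a \<in> closed_span G" "b \<in> closed_span G"
  then obtain f g where "\<And>n. f n \<in> cspan G" "f \<longlonglongrightarrow> a" "\<And>n. g n \<in> cspan G" "g \<longlonglongrightarrow> b"
    unfolding closed_span_seq by blast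
  then show ?thesis
    unfolding closed_span_seq
    by (intro exI[of _ "\<lambda>n. f n + g n"]) (auto intro: cspan_add tendsto_add)
qed

lemma closed_span_scale: "a \<in> closed_span G \<Longrightarrow> scale_op c a \<in> closed_span G"
proof -
  assume "a \<in> closed_span G"
  then obtain f where "\<And>n. f n \<in> cspan G" "f \<longlonglongrightarrow> a"
    unfolding closed_span_seq by blast
  then show ?thesis
    unfolding closed_span_seq
    by (intro exI[of _ "\<lambda>n. scale_op c (f n)"])
       (auto intro: cspan_scale bounded_linear.tendsto[OF bounded_linear_scale_op])
qed

lemma closed_span_diff: "a \<in> closed_span G \<Longrightarrow> b \<in> closed_span G \<Longrightarrow> a - b \<in> closed_span G"
  using closed_span_add[of a G "scale_op (-1) b"] closed_span_scale[of b G "-1"]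
  by (simp add: scale_op_simps)

lemma closed_span_map:
  assumes "a \<in> closed_span G" "bounded_linear T"
    "\<And>c x. x \<in> closed_span G \<Longrightarrow> T (scale_op c x) = scale_op c (T x)"
    "\<And>g. g \<in> G \<Longrightarrow> T g \<in> closed_span G'"
  shows "T a \<in> closed_span G'"
proof -
  interpret T: bounded_linear T by fact
  have "a \<in> {x \<in> closed_span G. T x \<in> closed_span G'}"
  proof (rule closed_span_minimal[OF assms(1)])
    show "closed {x \<in> closed_span G. T x \<in> closed_span G'}"
      using continuous_closed_vimage[OF closed_closed_span, of T G'] T.isCont[OF continuous_ident]
        closed_closed_span[of G]
      by (simp add: Collect_conj_eq closed_Int vimage_def)
  qed (auto simp: closed_span_base assms T.add closed_span_add closed_span_scale closed_span_zero T.zero)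
  then show ?thesis by simp
qed

text \<open>Adjoints of limits exist because taking adjoints is isometric: the adjoints of a convergent
  sequence form a Cauchy sequence.\<close>

lemma closed_span_adjoint:
  assumes adj: "\<And>g. g \<in> G \<Longrightarrow> \<exists>h\<in>closed_span G. is_adjoint g h" and a: "a \<in> closed_span G"
  shows "\<exists>b\<in>closed_span G. is_adjoint a b"
proof -
  let ?D = "{a. \<exists>b\<in>closed_span G. is_adjoint a b}"
  have "a \<in> ?D"
  proof (rule closed_span_minimal[OF a])
    show "closed ?D"
      unfolding closed_sequential_limits
    proof safe
      fix f l assume f: "\<forall>n. f n \<in> ?D" "f \<longlonglongrightarrow> l"
      then obtain g where g: "\<And>n. g n \<in> closed_span G" "\<And>n. is_adjoint (f n) (g n)"
        using bchoice[of UNIV "\<lambda>n b. b \<in> closed_span G \<and> is_adjoint (f n) b"] by blast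
      have "dist (g m) (g n) = dist (f m) (f n)" for m n
        using norm_adjoint[OF is_adjoint_diff[OF g(2)[of m] g(2)[of n]]] by (simp add: dist_norm)
      then have "Cauchy g"
        using LIMSEQ_imp_Cauchy[OF f(2)] by (simp add: Cauchy_def)
      then obtain h where h: "g \<longlonglongrightarrow> h"
        by (auto simp: Cauchy_convergent_iff convergent_def)
      then have "h \<in> closed_span G"
        using g(1) closed_closed_span closed_sequentially by blast
      moreover have "is_adjoint l h"
      proof (rule is_adjointI)
        fix x y
        have "(\<lambda>n. cinner (blinfun_apply (f n) x) y) \<longlonglongrightarrow> cinner (blinfun_apply l x) y"
          by (intro bounded_linear.tendsto[OF bounded_linear_cinner_left] blinfun.tendsto f(2) tendsto_const)
        moreover have "(\<lambda>n. cinner x (blinfun_apply (g n) y)) \<longlonglongrightarrow> cinner x (blinfun_apply h y)"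
          by (intro bounded_linear.tendsto[OF bounded_linear_cinner_right] blinfun.tendsto h tendsto_const)
        ultimately show "cinner (blinfun_apply l x) y = cinner x (blinfun_apply h y)"
          using g(2) by (simp add: is_adjoint_def LIMSEQ_unique)
      qed
      ultimately show "\<exists>b\<in>closed_span G. is_adjoint l b"
        by blast
    qed
  next
    show "g \<in> ?D" if "g \<in> G" for g
      using adj[OF that] by simp
    show "0 \<in> ?D"
      using is_adjoint_0 closed_span_zero by blast
    show "x + y \<in> ?D"
      if xy: "x \<in> ?D" "y \<in> ?D" for x y
    proof -
      obtain b b' where "b \<in> closed_span G" "is_adjoint x b" "b' \<in> closed_span G" "is_adjoint y b'"
        using xy by blast
      then show ?thesis
        by (auto intro!: bexI[of _ "b + b'"] is_adjoint_add closed_span_add)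
    qed
    show "scale_op c x \<in> ?D"
      if xy: "x \<in> ?D" for c x
    proof -
      obtain b where "b \<in> closed_span G" "is_adjoint x b"
        using xy by blast
      then show ?thesis
        by (auto intro!: bexI[of _ "scale_op (cnj c) b"] is_adjoint_scale_op closed_span_scale)
    qed
  qed
  then show ?thesis by blast
qed

lemma closed_span_compose:
  assumes G: "\<And>g h. g \<in> G \<Longrightarrow> h \<in> H \<Longrightarrow> g o\<^sub>L h \<in> closed_span M"
    and clin: "\<And>a. a \<in> closed_span G \<Longrightarrow> clinear_op a"
    and "a \<in> closed_span G" "b \<in> closed_span H"
  shows "a o\<^sub>L b \<in> closed_span M"
proof -
  have 1: "g o\<^sub>L b \<in> closed_span M" if "g \<in> G" for g
    by (rule closed_span_map[OF assms(4), where T = "\<lambda>b. g o\<^sub>L b"])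
       (use that G in \<open>auto intro: bounded_bilinear.bounded_linear_right[OF bounded_bilinear_blinfun_compose]
          blinfun_compose_scale_op_right clin closed_span_base\<close>)
  show ?thesis
    by (rule closed_span_map[OF assms(3), where T = "\<lambda>a. a o\<^sub>L b"])
       (use 1 in \<open>auto intro: bounded_bilinear.bounded_linear_left[OF bounded_bilinear_blinfun_compose]
          blinfun_compose_scale_op_left\<close>)
qed

lemma cstar_algebra_closed_span:
  assumes adj: "\<And>g. g \<in> G \<Longrightarrow> \<exists>h\<in>closed_span G. is_adjoint g h"
    and mult: "\<And>g h. g \<in> G \<Longrightarrow> h \<in> G \<Longrightarrow> g o\<^sub>L h \<in> closed_span G"
  shows "cstar_algebra (closed_span G)"
proof -
  have "clinear_op a" if "a \<in> closed_span G" for a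
    using closed_span_adjoint[OF adj that] is_adjoint_clinear by blast
  then show ?thesis
    unfolding cstar_algebra_def operator_space_def
    using closed_span_adjoint[OF adj] closed_span_compose[OF mult]
    by (auto simp: closed_span_zero closed_span_add closed_span_scale closed_closed_span)
qed

lemma closed_span_separable:
  assumes "countable G"
  obtains Q where "countable Q" "\<And>a e. a \<in> closed_span G \<Longrightarrow> e > 0 \<Longrightarrow> \<exists>q\<in>Q. norm (a - q) < e"
    "Q \<subseteq> cspan G"
proof
  define R where "R = (\<lambda>(x :: rat, y :: rat). Complex (of_rat x) (of_rat y)) ` UNIV"
  have R: "\<exists>r\<in>R. cmod (c - r) < e" if "e > 0" for c e
  proof -
    have "\<exists>q :: rat. \<bar>x - of_rat q\<bar> < e / 2" for x :: real
    proof -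
      obtain q where "x - e / 2 < of_rat q" "of_rat q < x + e / 2"
        using of_rat_dense[of "x - e / 2" "x + e / 2"] \<open>e > 0\<close> by auto
      then show ?thesis
        by (intro exI[of _ q]) linarith
    qed
    then obtain p q :: rat where "\<bar>Re c - of_rat p\<bar> < e / 2" "\<bar>Im c - of_rat q\<bar> < e / 2"
      by metis
    then have "cmod (c - Complex (of_rat p) (of_rat q)) < e"
      using cmod_le[of "c - Complex (of_rat p) (of_rat q)"] by simp
    then show ?thesis
      by (auto simp: R_def)
  qed
  define Q where "Q = lincomb ` lists (R \<times> G)"
  show "countable Q"
    using assms by (auto simp: Q_def R_def intro!: countable_image countable_lists)
  show "Q \<subseteq> cspan G"
    by (auto simp: Q_def cspan_def)
  have dense: "\<exists>q\<in>Q. norm (a - q) < e" if "a \<in> cspan G" "e > 0" for a e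
    using that
  proof (induction arbitrary: e rule: cspan_induct)
    case zero
    then show ?case
      by (intro bexI[of _ 0]) (auto simp: Q_def intro!: image_eqI[of _ _ "[]"])
  next
    case (add c g a)
    then obtain q where q: "q \<in> Q" "norm (a - q) < e / 2"
      using add.IH[of "e / 2"] by auto
    obtain r where r: "r \<in> R" "cmod (c - r) < e / 2 / (norm g + 1)"
      using R[of "e / 2 / (norm g + 1)"] add.prems
      by (metis add_nonneg_pos divide_pos_pos half_gt_zero norm_ge_zero zero_less_one)
    have "norm (scale_op (c - r) g) \<le> cmod (c - r) * (norm g + 1)"
      by (simp add: norm_scale_op mult_left_mono)
    also have "\<dots> < e / 2"
      using r(2) pos_less_divide_eq[of "norm g + 1" "cmod (c - r)" "e / 2"] by (simp add: add_nonneg_pos)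
    finally have "norm (scale_op (c - r) g + (a - q)) < e"
      using q(2) norm_triangle_ineq[of "scale_op (c - r) g" "a - q"] by linarith
    moreover have "scale_op (c - r) g + (a - q) = scale_op c g + a - (scale_op r g + q)"
      using scale_op_simps(7)[of "c - r" r g] by (simp add: algebra_simps)
    moreover have "scale_op r g + q \<in> Q"
    proof -
      obtain xs where "xs \<in> lists (R \<times> G)" "q = lincomb xs"
        using q by (auto simp: Q_def)
      then show ?thesis
        unfolding Q_def using r(1) add.hyps(1) by (intro image_eqI[of _ _ "(r, g) # xs"]) auto
    qed
    ultimately show ?case
      by metis
  qed
  show "\<exists>q\<in>Q. norm (a - q) < e" if a: "a \<in> closed_span G" and "e > 0" for a e
  proof -
    obtain b where "b \<in> cspan G" "dist b a < e / 2"
      using a \<open>e > 0\<close> unfolding closed_span_def closure_approachable by (meson half_gt_zero)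
    moreover obtain q where "q \<in> Q" "norm (b - q) < e / 2"
      using dense[OF \<open>b \<in> cspan G\<close>] \<open>e > 0\<close> half_gt_zero by blast
    ultimately have "norm (a - q) < e"
      using norm_triangle_ineq[of "a - b" "b - q"] by (simp add: dist_norm norm_minus_commute)
    then show ?thesis
      using \<open>q \<in> Q\<close> by blast
  qed
qed

section \<open>*-isomorphisms are isometric\<close>

lemma cstar_algebraD:
  assumes "cstar_algebra A"
  shows "a \<in> A \<Longrightarrow> clinear_op a" "0 \<in> A" "a \<in> A \<Longrightarrow> b \<in> A \<Longrightarrow> a + b \<in> A"
    "a \<in> A \<Longrightarrow> scale_op c a \<in> A" "closed A" "a \<in> A \<Longrightarrow> b \<in> A \<Longrightarrow> a o\<^sub>L b \<in> A"
    "a \<in> A \<Longrightarrow> \<exists>b\<in>A. is_adjoint a b"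
  using assms by (auto simp: cstar_algebra_def operator_space_def)

lemma cstar_algebra_diff:
  assumes "cstar_algebra A" "a \<in> A" "b \<in> A"
  shows "a - b \<in> A"
  using cstar_algebraD(3)[OF assms(1,2), of "scale_op (-1) b"] cstar_algebraD(4)[OF assms(1,3), of "-1"]
  by (simp add: scale_op_simps)

lemma star_isomorphismD:
  assumes "star_isomorphism A B \<phi>"
  shows "bij_betw \<phi> A B" "a \<in> A \<Longrightarrow> \<phi> a \<in> B" "a \<in> A \<Longrightarrow> b \<in> A \<Longrightarrow> \<phi> (a + b) = \<phi> a + \<phi> b"
    "a \<in> A \<Longrightarrow> \<phi> (scale_op c a) = scale_op c (\<phi> a)"
    "a \<in> A \<Longrightarrow> b \<in> A \<Longrightarrow> \<phi> (a o\<^sub>L b) = \<phi> a o\<^sub>L \<phi> b"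
    "a \<in> A \<Longrightarrow> b \<in> A \<Longrightarrow> is_adjoint a b \<Longrightarrow> is_adjoint (\<phi> a) (\<phi> b)"
  using assms by (auto simp: star_isomorphism_def clinear_on_def bij_betwE)

lemma star_isomorphism_diff:
  assumes "cstar_algebra A" "star_isomorphism A B \<phi>" "a \<in> A" "b \<in> A"
  shows "\<phi> (a - b) = \<phi> a - \<phi> b"
proof -
  have "scale_op (-1) b \<in> A"
    using assms by (intro cstar_algebraD)
  then have "\<phi> (a + scale_op (-1) b) = \<phi> a + scale_op (-1) (\<phi> b)"
    using star_isomorphismD(3,4)[OF assms(2)] assms by simp
  then show ?thesis
    by (simp add: scale_op_simps)
qed

lemma star_isomorphism_inv:
  assumes A: "cstar_algebra A" and iso: "star_isomorphism A B \<phi>"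
  shows "star_isomorphism B A (inv_into A \<phi>)"
proof -
  let ?\<psi> = "inv_into A \<phi>"
  note \<phi> = star_isomorphismD[OF iso]
  have bij: "bij_betw ?\<psi> B A"
    using \<phi>(1) by (rule bij_betw_inv_into)
  have B: "?\<psi> b \<in> A" "\<phi> (?\<psi> b) = b" if "b \<in> B" for b
    using that \<phi>(1) bij by (auto simp: bij_betwE bij_betw_inv_into_right)
  have eq: "?\<psi> b = a" if "a \<in> A" "\<phi> a = b" for a b
    using that \<phi>(1) bij_betw_inv_into_left by metis
  have "is_adjoint (?\<psi> a) (?\<psi> b)" if "a \<in> B" "b \<in> B" "is_adjoint a b" for a b
  proof -
    obtain c where c: "c \<in> A" "is_adjoint (?\<psi> a) c"
      using cstar_algebraD(7)[OF A B(1)[OF \<open>a \<in> B\<close>]] by blast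
    then have "is_adjoint a (\<phi> c)"
      using \<phi>(6)[OF B(1)[OF \<open>a \<in> B\<close>] c] B(2)[OF \<open>a \<in> B\<close>] by simp
    then have "\<phi> c = b"
      using is_adjoint_unique that(3) by blast
    then show ?thesis
      using eq[OF c(1) \<open>\<phi> c = b\<close>] c(2) by simp
  qed
  moreover have "?\<psi> (a + b) = ?\<psi> a + ?\<psi> b" "?\<psi> (a o\<^sub>L b) = ?\<psi> a o\<^sub>L ?\<psi> b" if "a \<in> B" "b \<in> B" for a b
    using that B \<phi>(3,5) cstar_algebraD(3,6)[OF A] by (intro eq; simp)+
  moreover have "?\<psi> (scale_op c a) = scale_op c (?\<psi> a)" if "a \<in> B" for c a
    using that B \<phi>(4) cstar_algebraD(4)[OF A] by (intro eq) simp_all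
  ultimately show ?thesis
    using bij by (auto simp: star_isomorphism_def clinear_on_def)
qed

text \<open>The sum \<open>b\<close> of the geometric series \<open>c + c\<^sup>2 + c\<^sup>3 + \<dots>\<close>, so that \<open>1 + b\<close> inverts \<open>1 - c\<close>
  although \<open>1\<close> need not be in the algebra. It is obtained as the fixed point of a contraction.\<close>

lemma quasi_inverse:
  assumes A: "cstar_algebra A" and c: "c \<in> A" "norm c < 1"
  obtains b where "b \<in> A" "b = c + (c o\<^sub>L b)"
proof -
  have "\<exists>!b\<in>A. c + (c o\<^sub>L b) = b"
  proof (rule Banach_fix)
    show "complete A"
      using cstar_algebraD(5)[OF A] by (simp add: complete_eq_closed)
    show "dist (c + (c o\<^sub>L x)) (c + (c o\<^sub>L y)) \<le> norm c * dist x y" for x y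
      using norm_blinfun_compose[of c "x - y"] by (simp add: dist_norm blinfun_compose_distrib)
    show "A \<noteq> {}"
      using c by blast
    show "(\<lambda>b. c + (c o\<^sub>L b)) ` A \<subseteq> A"
      using cstar_algebraD(3,6)[OF A] c(1) by (intro image_subsetI) simp
  qed (use c(2) in simp_all)
  then show ?thesis
    by (metis that)
qed

text \<open>If \<open>\<parallel>\<phi> x\<parallel> > \<parallel>x\<parallel>\<close> then, with \<open>\<mu> = \<parallel>\<phi> x\<parallel>\<^sup>2\<close>, the operator \<open>1 - x* x / \<mu>\<close> is invertible, with
  an inverse of the form \<open>1 + b\<close>, where \<open>b\<close> is in the algebra. Applying \<open>\<phi>\<close> to the equation for
  \<open>b\<close> shows that \<open>1 - \<phi> x* \<phi> x / \<mu>\<close> is bounded below. It is not, since vectors at which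
  \<open>\<phi> x\<close> almost attains its norm are almost eigenvectors of \<open>\<phi> x* \<phi> x\<close> for \<open>\<mu>\<close>.\<close>

lemma star_isomorphism_contractive:
  assumes A: "cstar_algebra A" and B: "cstar_algebra B" and iso: "star_isomorphism A B \<phi>" and x: "x \<in> A"
  shows "norm (\<phi> x) \<le> norm x"
proof (rule ccontr)
  assume "\<not> norm (\<phi> x) \<le> norm x"
  then have less: "norm x < norm (\<phi> x)"
    by simp
  note \<phi> = star_isomorphismD[OF iso]
  define y where "y = \<phi> x"
  define \<mu> where "\<mu> = (norm y)\<^sup>2"
  have "norm y > 0"
    using less norm_ge_zero[of x] unfolding y_def by linarith
  then have \<mu>: "\<mu> > 0"
    by (simp add: \<mu>_def)
  obtain x' where x': "x' \<in> A" "is_adjoint x x'"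
    using cstar_algebraD(7)[OF A x] by blast
  define y' where "y' = \<phi> x'"
  have y': "is_adjoint y y'"
    using \<phi>(6)[OF x x'] by (simp add: y_def y'_def)
  define c where "c = scale_op (of_real (1 / \<mu>)) (x' o\<^sub>L x)"
  have c: "c \<in> A"
    using x x' by (auto simp: c_def intro!: cstar_algebraD[OF A])
  have "norm c < 1"
  proof -
    have "norm c = (norm x)\<^sup>2 / \<mu>"
      using \<mu> by (simp add: c_def norm_scale_op norm_compose_adjoint[OF x'(2)] norm_divide)
    also have "\<dots> < 1"
      using \<mu> less by (simp add: \<mu>_def y_def power_strict_mono)
    finally show ?thesis .
  qed
  then obtain b where b: "b \<in> A" "b = c + (c o\<^sub>L b)"
    using quasi_inverse[OF A c] by blast
  define C where "C = \<phi> c"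
  have C: "C = scale_op (of_real (1 / \<mu>)) (y' o\<^sub>L y)"
    using x x' by (simp add: C_def c_def \<phi>(4,5) cstar_algebraD(6)[OF A] y_def y'_def)
  have fb: "\<phi> b = C + (C o\<^sub>L \<phi> b)"
    using arg_cong[OF b(2), of \<phi>] b(1) c by (simp add: \<phi>(3,5) cstar_algebraD(6)[OF A] C_def)
  obtain d where d: "is_adjoint (\<phi> b) d"
    using cstar_algebraD(7)[OF B \<phi>(2)[OF b(1)]] by blast
  have Cadj: "is_adjoint C C"
    using is_adjoint_scale_op[OF is_adjoint_compose[OF is_adjoint_sym[OF y'] y'], of "of_real (1 / \<mu>)"]
    by (simp add: C)
  have "is_adjoint (C + (C o\<^sub>L \<phi> b)) (C + (d o\<^sub>L C))"
    by (intro is_adjoint_add is_adjoint_compose Cadj d)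
  then have dC: "d = C + (d o\<^sub>L C)"
    using d fb is_adjoint_unique by metis
  define M where "M = 1 + norm d"
  have M: "M > 0"
    unfolding M_def by (simp add: add_pos_nonneg)
  have below: "norm \<xi> \<le> M * norm (\<xi> - blinfun_apply C \<xi>)" for \<xi>
  proof -
    have "blinfun_apply d \<xi> = blinfun_apply C \<xi> + blinfun_apply d (blinfun_apply C \<xi>)"
      using arg_cong[OF dC, of "\<lambda>a. blinfun_apply a \<xi>"] by (simp add: plus_blinfun.rep_eq)
    then have "\<xi> = (\<xi> - blinfun_apply C \<xi>) + blinfun_apply d (\<xi> - blinfun_apply C \<xi>)"
      by (simp add: blinfun.diff_right)
    then have "norm \<xi> \<le> norm (\<xi> - blinfun_apply C \<xi>) + norm (blinfun_apply d (\<xi> - blinfun_apply C \<xi>))"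
      by (metis norm_triangle_ineq)
    also have "\<dots> \<le> M * norm (\<xi> - blinfun_apply C \<xi>)"
      using norm_blinfun[of d "\<xi> - blinfun_apply C \<xi>"] by (simp add: M_def algebra_simps)
    finally show ?thesis .
  qed
  have normC: "norm C \<le> 1"
    using \<mu> by (simp add: C norm_scale_op norm_compose_adjoint[OF y'] \<mu>_def[symmetric] norm_divide)
  \<comment> \<open>For a vector \<open>\<xi>\<close> with \<open>\<parallel>y \<xi>\<parallel>\<^sup>2 > \<mu> (1 - \<delta>) \<parallel>\<xi>\<parallel>\<^sup>2\<close> one gets \<open>\<parallel>\<xi> - C \<xi>\<parallel>\<^sup>2 \<le> 2 \<delta> \<parallel>\<xi>\<parallel>\<^sup>2\<close>;
    the value of \<open>\<delta>\<close> makes this contradict the lower bound \<open>\<parallel>\<xi>\<parallel> / M\<close>.\<close>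
  define \<delta> where "\<delta> = 1 / (4 * M\<^sup>2)"
  have \<delta>: "\<delta> > 0"
    using M by (simp add: \<delta>_def)
  have "\<exists>\<xi>. (norm (blinfun_apply y \<xi>))\<^sup>2 > \<mu> * (1 - \<delta>) * (norm \<xi>)\<^sup>2"
  proof (rule ccontr)
    assume "\<nexists>\<xi>. (norm (blinfun_apply y \<xi>))\<^sup>2 > \<mu> * (1 - \<delta>) * (norm \<xi>)\<^sup>2"
    then have *: "(norm (blinfun_apply y \<xi>))\<^sup>2 \<le> (\<mu> * (1 - \<delta>)) * (norm \<xi>)\<^sup>2" for \<xi>
      by (meson not_less)
    have le: "norm (blinfun_apply y \<xi>) \<le> sqrt (max 0 (\<mu> * (1 - \<delta>))) * norm \<xi>" for \<xi>
    proof (rule power2_le_imp_le)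
      show "(norm (blinfun_apply y \<xi>))\<^sup>2 \<le> (sqrt (max 0 (\<mu> * (1 - \<delta>))) * norm \<xi>)\<^sup>2"
        using *[of \<xi>] mult_right_mono[of "\<mu> * (1 - \<delta>)" "max 0 (\<mu> * (1 - \<delta>))" "(norm \<xi>)\<^sup>2"]
        by (simp add: power_mult_distrib)
    qed simp
    have "norm y \<le> sqrt (max 0 (\<mu> * (1 - \<delta>)))"
      by (rule norm_blinfun_bound) (use le in auto)
    then have "(norm y)\<^sup>2 \<le> max 0 (\<mu> * (1 - \<delta>))"
      using sqrt_ge_absD[of "norm y" "max 0 (\<mu> * (1 - \<delta>))"] by simp
    then show False
      using \<mu> \<delta> by (auto simp: \<mu>_def[symmetric] max_def mult_less_cancel_left1 split: if_splits)
  qed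
  then obtain \<xi> where \<xi>: "(norm (blinfun_apply y \<xi>))\<^sup>2 > \<mu> * (1 - \<delta>) * (norm \<xi>)\<^sup>2"
    by blast
  then have "\<xi> \<noteq> 0"
    by auto
  have in1: "inner \<xi> (blinfun_apply C \<xi>) = (norm (blinfun_apply y \<xi>))\<^sup>2 / \<mu>"
  proof -
    have "cinner \<xi> (blinfun_apply (y' o\<^sub>L y) \<xi>) = of_real ((norm (blinfun_apply y \<xi>))\<^sup>2)"
      using is_adjointD[OF y', of \<xi> "blinfun_apply y \<xi>"] by (simp only: cinner_self blinfun_apply_blinfun_compose)
    then show ?thesis
      by (simp add: inner_eq_Re_cinner C cinner_scaleC_right)
  qed
  have "(norm (\<xi> - blinfun_apply C \<xi>))\<^sup>2
      = (norm \<xi>)\<^sup>2 - 2 * inner \<xi> (blinfun_apply C \<xi>) + (norm (blinfun_apply C \<xi>))\<^sup>2"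
    by (simp add: power2_norm_eq_inner inner_diff_left inner_diff_right inner_commute)
  also have "\<dots> \<le> (norm \<xi>)\<^sup>2 - 2 * ((1 - \<delta>) * (norm \<xi>)\<^sup>2) + (norm \<xi>)\<^sup>2"
  proof -
    have "(1 - \<delta>) * (norm \<xi>)\<^sup>2 \<le> inner \<xi> (blinfun_apply C \<xi>)"
      using \<xi> \<mu> by (simp add: in1 field_simps)
    moreover have "norm (blinfun_apply C \<xi>) \<le> norm \<xi>"
      using norm_blinfun[of C \<xi>] normC mult_right_mono[OF normC norm_ge_zero[of \<xi>]] by simp
    moreover have "(norm (blinfun_apply C \<xi>))\<^sup>2 \<le> (norm \<xi>)\<^sup>2"
      using calculation(2) by (rule power_mono) simp
    ultimately have "- (2 * inner \<xi> (blinfun_apply C \<xi>)) \<le> - (2 * ((1 - \<delta>) * (norm \<xi>)\<^sup>2))"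
      "(norm (blinfun_apply C \<xi>))\<^sup>2 \<le> (norm \<xi>)\<^sup>2"
      by simp_all
    then show ?thesis
      by linarith
  qed
  also have "\<dots> = 2 * \<delta> * (norm \<xi>)\<^sup>2"
    by (simp add: algebra_simps)
  finally have up: "(norm (\<xi> - blinfun_apply C \<xi>))\<^sup>2 \<le> 2 * \<delta> * (norm \<xi>)\<^sup>2" .
  have "(norm \<xi>)\<^sup>2 \<le> M\<^sup>2 * (norm (\<xi> - blinfun_apply C \<xi>))\<^sup>2"
    using power_mono[OF below[of \<xi>], of 2] by (simp add: power_mult_distrib)
  also have "\<dots> \<le> M\<^sup>2 * (2 * \<delta> * (norm \<xi>)\<^sup>2)"
    using up by (intro mult_left_mono) auto
  also have "\<dots> = (norm \<xi>)\<^sup>2 / 2"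
    using M by (simp add: \<delta>_def)
  finally show False
    using \<open>\<xi> \<noteq> 0\<close> by simp
qed

section \<open>Completely bounded maps\<close>

lemma matrix_norm_bdd:
  "bdd_above ((\<lambda>\<xi>. L2_set (\<lambda>i. norm (\<Sum>j<n. blinfun_apply (a i j) (\<xi> j))) {..<n}) `
     {\<xi> :: nat \<Rightarrow> 'h::chilbert. L2_set (\<lambda>j. norm (\<xi> j)) {..<n} \<le> 1})"
proof (rule bdd_aboveI2)
  fix \<xi> :: "nat \<Rightarrow> 'h" assume "\<xi> \<in> {\<xi>. L2_set (\<lambda>j. norm (\<xi> j)) {..<n} \<le> 1}"
  then have \<xi>: "norm (\<xi> j) \<le> 1" if "j < n" for j
    using member_le_L2_set[of "{..<n}" j "\<lambda>j. norm (\<xi> j)"] that by simp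
  have "L2_set (\<lambda>i. norm (\<Sum>j<n. blinfun_apply (a i j) (\<xi> j))) {..<n}
      \<le> (\<Sum>i<n. norm (\<Sum>j<n. blinfun_apply (a i j) (\<xi> j)))"
    by (rule L2_set_le_sum) simp
  also have "\<dots> \<le> (\<Sum>i<n. \<Sum>j<n. norm (a i j))"
  proof (intro sum_mono order_trans[OF norm_sum])
    fix i j assume "j \<in> {..<n}"
    then show "norm (blinfun_apply (a i j) (\<xi> j)) \<le> norm (a i j)"
      using norm_blinfun[of "a i j" "\<xi> j"] mult_left_mono[OF \<xi>[of j] norm_ge_zero[of "a i j"]] by simp
  qed
  finally show "L2_set (\<lambda>i. norm (\<Sum>j<n. blinfun_apply (a i j) (\<xi> j))) {..<n}
      \<le> (\<Sum>i<n. \<Sum>j<n. norm (a i j))" .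
qed

lemma matrix_norm_cong:
  assumes "\<And>i j. i < n \<Longrightarrow> j < n \<Longrightarrow> a i j = b i j"
  shows "matrix_norm n a = matrix_norm n b"
proof -
  have "(\<Sum>j<n. blinfun_apply (a i j) (\<xi> j)) = (\<Sum>j<n. blinfun_apply (b i j) (\<xi> j))" if "i < n" for i \<xi>
    using assms that by (intro sum.cong) auto
  then have "L2_set (\<lambda>i. norm (\<Sum>j<n. blinfun_apply (a i j) (\<xi> j))) {..<n}
      = L2_set (\<lambda>i. norm (\<Sum>j<n. blinfun_apply (b i j) (\<xi> j))) {..<n}" for \<xi>
    by (intro L2_set_cong) auto
  then show ?thesis
    unfolding matrix_norm_def by (simp only:)
qed

lemma matrix_norm_bound:
  fixes a :: "nat \<Rightarrow> nat \<Rightarrow> 'a :: chilbert \<Rightarrow>\<^sub>L 'a"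
  assumes "\<And>\<xi>. L2_set (\<lambda>j. norm (\<xi> j)) {..<n} \<le> 1 \<Longrightarrow>
    L2_set (\<lambda>i. norm (\<Sum>j<n. blinfun_apply (a i j) (\<xi> j))) {..<n} \<le> B"
  shows "matrix_norm n a \<le> B"
proof -
  have "L2_set (\<lambda>j. norm ((\<lambda>_. 0) j)) {..<n} \<le> 1"
    by (simp add: L2_set_0')
  then show ?thesis
    unfolding matrix_norm_def
    by (intro cSUP_least assms) (auto intro!: exI[of _ "\<lambda>_. 0 :: 'a"])
qed

lemma matrix_norm_ge:
  "L2_set (\<lambda>i. norm (\<Sum>j<n. blinfun_apply (a i j) (\<xi> j))) {..<n}
     \<le> matrix_norm n a * L2_set (\<lambda>j. norm (\<xi> j)) {..<n}"
proof (cases "L2_set (\<lambda>j. norm (\<xi> j)) {..<n} = 0")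
  case True
  then have "\<xi> j = 0" if "j < n" for j
    using that by (simp add: L2_set_eq_0_iff)
  then have "(\<Sum>j<n. blinfun_apply (a i j) (\<xi> j)) = 0" for i
    by (intro sum.neutral) auto
  then have "L2_set (\<lambda>i. norm (\<Sum>j<n. blinfun_apply (a i j) (\<xi> j))) {..<n} = 0"
    by (intro L2_set_0') simp
  then show ?thesis
    using True by simp
next
  case False
  define r where "r = L2_set (\<lambda>j. norm (\<xi> j)) {..<n}"
  have r: "r > 0"
    using False L2_set_nonneg[of "\<lambda>j. norm (\<xi> j)" "{..<n}"] unfolding r_def by linarith
  define \<zeta> where "\<zeta> j = (1 / r) *\<^sub>R \<xi> j" for j
  have "L2_set (\<lambda>j. norm (\<zeta> j)) {..<n} = (1 / r) * r"
    unfolding r_def[symmetric] \<zeta>_def norm_scaleR using r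
    by (subst L2_set_right_distrib[symmetric]) (auto simp: r_def)
  then have "L2_set (\<lambda>i. norm (\<Sum>j<n. blinfun_apply (a i j) (\<zeta> j))) {..<n} \<le> matrix_norm n a"
    unfolding matrix_norm_def using r by (intro cSUP_upper matrix_norm_bdd) simp
  moreover have "L2_set (\<lambda>i. norm (\<Sum>j<n. blinfun_apply (a i j) (\<zeta> j))) {..<n}
      = (1 / r) * L2_set (\<lambda>i. norm (\<Sum>j<n. blinfun_apply (a i j) (\<xi> j))) {..<n}"
    using r L2_set_right_distrib[of "1 / r" "\<lambda>i. norm (\<Sum>j<n. blinfun_apply (a i j) (\<xi> j))"]
    by (simp add: \<zeta>_def blinfun.scaleR_right scaleR_sum_right[symmetric])
  ultimately show ?thesis
    using r by (simp add: r_def[symmetric] field_simps)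
qed

lemma matrix_norm_nonneg: "matrix_norm n a \<ge> 0"
proof -
  have "L2_set (\<lambda>i. norm (\<Sum>j<n. blinfun_apply (a i j) 0)) {..<n} \<le> matrix_norm n a"
    unfolding matrix_norm_def
    by (rule cSUP_upper2[OF matrix_norm_bdd, where x = "\<lambda>_. 0"]) (auto simp: L2_set_0')
  then show ?thesis
    by (simp add: L2_set_0')
qed

lemma matrix_norm_1: "matrix_norm 1 a = norm (a 0 0)"
proof (rule antisym)
  show "matrix_norm 1 a \<le> norm (a 0 0)"
  proof (rule matrix_norm_bound)
    fix \<xi> :: "nat \<Rightarrow> 'a" assume "L2_set (\<lambda>j. norm (\<xi> j)) {..<1} \<le> 1"
    then show "L2_set (\<lambda>i. norm (\<Sum>j<1. blinfun_apply (a i j) (\<xi> j))) {..<1} \<le> norm (a 0 0)"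
      using norm_blinfun[of "a 0 0" "\<xi> 0"] mult_left_mono[of "norm (\<xi> 0)" 1 "norm (a 0 0)"]
      by (simp add: L2_set_def)
  qed
  show "norm (a 0 0) \<le> matrix_norm 1 a"
  proof (rule norm_blinfun_bound)
    show "norm (blinfun_apply (a 0 0) x) \<le> matrix_norm 1 a * norm x" for x
      using matrix_norm_ge[of a "\<lambda>_. x" 1] by (simp add: L2_set_def)
  qed (rule matrix_norm_nonneg)
qed

text \<open>The matrix \<open>(L a\<^sub>i\<^sub>j R)\<close> is \<open>(a\<^sub>i\<^sub>j)\<close> multiplied by the diagonal matrices with constant
  entries \<open>L\<close> and \<open>R\<close>, whose norms are \<open>\<parallel>L\<parallel>\<close> and \<open>\<parallel>R\<parallel>\<close> for every matrix size.\<close>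

lemma matrix_norm_conjugate:
  "matrix_norm n (\<lambda>i j. (L o\<^sub>L a i j) o\<^sub>L R) \<le> norm L * norm R * matrix_norm n a"
proof (rule matrix_norm_bound)
  fix \<xi> :: "nat \<Rightarrow> 'a" assume \<xi>: "L2_set (\<lambda>j. norm (\<xi> j)) {..<n} \<le> 1"
  define \<zeta> where "\<zeta> j = blinfun_apply R (\<xi> j)" for j
  have "L2_set (\<lambda>j. norm (\<zeta> j)) {..<n} \<le> L2_set (\<lambda>j. norm R * norm (\<xi> j)) {..<n}"
    by (intro L2_set_mono) (auto simp: \<zeta>_def norm_blinfun)
  also have "\<dots> \<le> norm R"
    using \<xi> mult_left_mono[OF \<xi> norm_ge_zero[of R]] by (simp add: L2_set_right_distrib[symmetric])
  finally have \<zeta>: "L2_set (\<lambda>j. norm (\<zeta> j)) {..<n} \<le> norm R" .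
  have "L2_set (\<lambda>i. norm (\<Sum>j<n. blinfun_apply ((L o\<^sub>L a i j) o\<^sub>L R) (\<xi> j))) {..<n}
      = L2_set (\<lambda>i. norm (blinfun_apply L (\<Sum>j<n. blinfun_apply (a i j) (\<zeta> j)))) {..<n}"
    by (simp add: \<zeta>_def blinfun.sum_right)
  also have "\<dots> \<le> L2_set (\<lambda>i. norm L * norm (\<Sum>j<n. blinfun_apply (a i j) (\<zeta> j))) {..<n}"
    by (intro L2_set_mono) (auto simp: norm_blinfun)
  also have "\<dots> = norm L * L2_set (\<lambda>i. norm (\<Sum>j<n. blinfun_apply (a i j) (\<zeta> j))) {..<n}"
    by (simp add: L2_set_right_distrib)
  also have "\<dots> \<le> norm L * (matrix_norm n a * norm R)"
    by (intro mult_left_mono order_trans[OF matrix_norm_ge] \<zeta> matrix_norm_nonneg) auto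
  finally show "L2_set (\<lambda>i. norm (\<Sum>j<n. blinfun_apply ((L o\<^sub>L a i j) o\<^sub>L R) (\<xi> j))) {..<n}
      \<le> norm L * norm R * matrix_norm n a"
    by (simp add: mult_ac)
qed

lemma cb_norm_conjugate:
  assumes "\<And>x. x \<in> X \<Longrightarrow> T x = (L o\<^sub>L x) o\<^sub>L R"
  shows "cb_norm X T \<le> ennreal (norm L * norm R)"
  unfolding cb_norm_def amplification_norm_def
proof (intro SUP_least ennreal_leI)
  fix n and a :: "nat \<Rightarrow> nat \<Rightarrow> 'a \<Rightarrow>\<^sub>L 'a"
  assume a: "a \<in> {a. (\<forall>i<n. \<forall>j<n. a i j \<in> X) \<and> matrix_norm n a \<le> 1}"
  have "matrix_norm n (\<lambda>i j. T (a i j)) = matrix_norm n (\<lambda>i j. (L o\<^sub>L a i j) o\<^sub>L R)"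
    using a assms by (intro matrix_norm_cong) auto
  also have "\<dots> \<le> norm L * norm R * matrix_norm n a"
    by (rule matrix_norm_conjugate)
  also have "\<dots> \<le> norm L * norm R"
    using a by (simp add: mult_left_le)
  finally show "matrix_norm n (\<lambda>i j. T (a i j)) \<le> norm L * norm R" .
qed

lemma norm_le_cb_norm:
  assumes "clinear_on X T" "operator_space X" "x \<in> X"
  shows "ennreal (norm (T x)) \<le> cb_norm X T * ennreal (norm x)"
proof (cases "x = 0")
  case True
  have "T 0 = 0"
    using assms(1,3) unfolding clinear_on_def by (metis scale_op_simps(4))
  then show ?thesis
    by (simp add: True)
next
  case False
  define c where "c = complex_of_real (1 / norm x)"
  have n: "norm (scale_op c x) = 1" "scale_op c x \<in> X" "T (scale_op c x) = scale_op c (T x)"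
    using False assms by (auto simp: c_def norm_scale_op operator_space_def clinear_on_def norm_divide)
  have "ennreal (matrix_norm 1 (\<lambda>i j. T (scale_op c x))) \<le> amplification_norm 1 X T"
    unfolding amplification_norm_def
    by (rule SUP_upper2[where i = "\<lambda>i j. scale_op c x"]) (use n in \<open>auto simp: matrix_norm_1[simplified]\<close>)
  also have "\<dots> \<le> cb_norm X T"
    unfolding cb_norm_def by (rule SUP_upper) simp
  finally have "ennreal (norm (T x) / norm x) \<le> cb_norm X T"
    using n False by (simp add: matrix_norm_1[simplified] norm_scale_op c_def norm_divide)
  then have "ennreal (norm (T x) / norm x) * ennreal (norm x) \<le> cb_norm X T * ennreal (norm x)"
    by (rule mult_right_mono) simp
  then show ?thesis
    using False by (simp add: ennreal_mult[symmetric])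
qed

text \<open>Already the first amplification gives \<open>\<parallel>x\<parallel> = \<parallel>T\<inverse> T x\<parallel> \<le> \<parallel>T\<inverse>\<parallel> \<parallel>T\<parallel> \<parallel>x\<parallel>\<close>.\<close>

lemma d_cb_ge_1:
  assumes X: "operator_space X" and Y: "operator_space Y" and x: "x \<in> X" "x \<noteq> 0"
  shows "1 \<le> d_cb X Y"
  unfolding d_cb_def
proof (rule INF_greatest)
  fix T assume "T \<in> {T. cb_isomorphism X Y T}"
  then have T: "bij_betw T X Y" "clinear_on X T"
    by (auto simp: cb_isomorphism_def)
  let ?S = "inv_into X T"
  have S: "?S (T z) = z" if "z \<in> X" for z
    using T(1) that by (rule bij_betw_inv_into_left)
  have YX: "\<exists>z\<in>X. y = T z" if "y \<in> Y" for y
    using T(1) that by (auto simp: bij_betw_def)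
  have "clinear_on Y ?S"
    unfolding clinear_on_def
  proof (intro conjI ballI allI)
    fix y y' assume "y \<in> Y" "y' \<in> Y"
    then obtain z z' where "z \<in> X" "y = T z" "z' \<in> X" "y' = T z'"
      using YX by blast
    moreover have "?S (T (z + z')) = z + z'"
      using calculation X by (intro S) (auto simp: operator_space_def)
    ultimately show "?S (y + y') = ?S y + ?S y'"
      using T(2) by (simp add: clinear_on_def S)
  next
    fix c y assume "y \<in> Y"
    then obtain z where "z \<in> X" "y = T z"
      using YX by blast
    moreover have "?S (T (scale_op c z)) = scale_op c z"
      using calculation X by (intro S) (auto simp: operator_space_def)
    ultimately show "?S (scale_op c y) = scale_op c (?S y)"
      using T(2) by (simp add: clinear_on_def S)
  qed
  then have "ennreal (norm x) \<le> cb_norm Y ?S * ennreal (norm (T x))"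
    using norm_le_cb_norm[OF _ Y, of ?S "T x"] S[OF x(1)] T(1) x(1) by (auto simp: bij_betwE)
  also have "\<dots> \<le> cb_norm Y ?S * (cb_norm X T * ennreal (norm x))"
    using norm_le_cb_norm[OF T(2) X x(1)] by (intro mult_left_mono) auto
  finally have "1 * ennreal (norm x) \<le> (cb_norm X T * cb_norm Y ?S) * ennreal (norm x)"
    by (simp add: mult_ac)
  then show "1 \<le> cb_norm X T * cb_norm Y ?S"
    using x(2) ennreal_mult_le_mult_iff[of "ennreal (norm x)" 1] by (simp add: mult.commute[of _ "ennreal (norm x)"])
qed

lemma d_cb_conjugate_le:
  assumes T: "\<And>x. x \<in> X \<Longrightarrow> (L o\<^sub>L x) o\<^sub>L R \<in> Y" and S: "\<And>y. y \<in> Y \<Longrightarrow> (L' o\<^sub>L y) o\<^sub>L R' \<in> X"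
    and ST: "\<And>x. x \<in> X \<Longrightarrow> (L' o\<^sub>L ((L o\<^sub>L x) o\<^sub>L R)) o\<^sub>L R' = x"
    and TS: "\<And>y. y \<in> Y \<Longrightarrow> (L o\<^sub>L ((L' o\<^sub>L y) o\<^sub>L R')) o\<^sub>L R = y"
    and L: "clinear_op L"
  shows "d_cb X Y \<le> ennreal (norm L * norm R * (norm L' * norm R'))"
proof -
  define T where "T x = (L o\<^sub>L x) o\<^sub>L R" for x
  have bij: "bij_betw T X Y"
    by (rule bij_betw_byWitness[where f' = "\<lambda>y. (L' o\<^sub>L y) o\<^sub>L R'"]) (use assms in \<open>auto simp: T_def\<close>)
  have inv: "inv_into X T y = (L' o\<^sub>L y) o\<^sub>L R'" if "y \<in> Y" for y
    using bij_betw_inv_into_left[OF bij S[OF that]] TS[OF that] by (simp add: T_def)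
  have cb: "cb_norm X T \<le> ennreal (norm L * norm R)" "cb_norm Y (inv_into X T) \<le> ennreal (norm L' * norm R')"
    by (rule cb_norm_conjugate; simp add: T_def inv)+
  have "cb_isomorphism X Y T"
    unfolding cb_isomorphism_def clinear_on_def
    using bij cb by (auto simp: T_def blinfun_compose_distrib blinfun_compose_scale_op_left
        blinfun_compose_scale_op_right[OF L] intro: le_less_trans)
  then have "d_cb X Y \<le> cb_norm X T * cb_norm Y (inv_into X T)"
    unfolding d_cb_def by (intro INF_lower) simp
  also have "\<dots> \<le> ennreal (norm L * norm R) * ennreal (norm L' * norm R')"
    using cb by (intro mult_mono) auto
  finally show ?thesis
    by (simp add: ennreal_mult)
qed

section \<open>Luzin families\<close>

text \<open>The requirement on the next member \<open>S\<close> of a Luzin family: it is almost disjoint from the members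
  of \<open>\<F>\<close> so far, but for every \<open>n\<close> it meets all but finitely many of them in an element \<open>\<ge> n\<close>.\<close>

definition luzin_step :: "nat set set \<Rightarrow> nat set \<Rightarrow> bool" where
  "luzin_step \<F> S \<longleftrightarrow> infinite S \<and> (\<forall>F\<in>\<F>. finite (S \<inter> F)) \<and> (\<forall>n. finite {F \<in> \<F>. S \<inter> F \<subseteq> {..<n}})"

text \<open>Enumerate \<open>\<F>\<close> as \<open>F\<^sub>0, F\<^sub>1, \<dots>\<close> and let \<open>S\<close> consist of one point \<open>p\<^sub>i \<ge> i\<close> of
  \<open>F\<^sub>i - (F\<^sub>0 \<union> \<dots> \<union> F\<^sub>i\<^sub>-\<^sub>1)\<close> for each \<open>i\<close>. Then \<open>S \<inter> F\<^sub>j\<close> is among the first \<open>j + 1\<close> points,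
  and it contains a point \<open>\<ge> j\<close>.\<close>

lemma luzin_step_exists:
  assumes \<F>: "countable \<F>" "infinite \<F>" "\<And>F. F \<in> \<F> \<Longrightarrow> infinite F"
    "\<And>F G. F \<in> \<F> \<Longrightarrow> G \<in> \<F> \<Longrightarrow> F \<noteq> G \<Longrightarrow> finite (F \<inter> G)"
  shows "\<exists>S. luzin_step \<F> S"
proof -
  define F where "F = from_nat_into \<F>"
  have F: "bij_betw F UNIV \<F>"
    using bij_betw_from_nat_into[OF \<F>(1,2)] by (simp add: F_def)
  have Fin: "F i \<in> \<F>" for i
    using F by (auto simp: bij_betw_def)
  have "\<exists>k. k \<in> F i - (\<Union>j<i. F j) \<and> k \<ge> i" for i
  proof -
    have "F i - (\<Union>j<i. F j) = F i - (\<Union>j<i. F i \<inter> F j)"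
      by blast
    moreover have "finite (\<Union>j<i. F i \<inter> F j)"
    proof (intro finite_UN_I \<F>(4) Fin)
      show "F i \<noteq> F j" if "j \<in> {..<i}" for j
        using F that by (auto simp: bij_betw_def inj_on_eq_iff)
    qed simp
    ultimately have "infinite (F i - (\<Union>j<i. F j))"
      using \<F>(3)[OF Fin[of i]] by (metis Diff_infinite_finite)
    then show ?thesis
      by (meson infinite_nat_iff_unbounded_le)
  qed
  then have "\<exists>p. \<forall>i. p i \<in> F i - (\<Union>j<i. F j) \<and> p i \<ge> i"
    by (intro choice allI)
  then obtain p where p0: "\<forall>i. p i \<in> F i - (\<Union>j<i. F j) \<and> p i \<ge> i"
    by (rule exE)
  have p: "p i \<in> F i" "p i \<ge> i" "j < i \<Longrightarrow> p i \<notin> F j" for i j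
    using spec[OF p0, of i] by auto
  have "luzin_step \<F> (range p)"
    unfolding luzin_step_def
  proof (intro conjI ballI allI)
    show "infinite (range p)"
      unfolding infinite_nat_iff_unbounded_le using p(2) by blast
    show "finite (range p \<inter> G)" if G: "G \<in> \<F>" for G
    proof -
      obtain j where "G = F j"
        using F G by (auto simp: bij_betw_def)
      have "range p \<inter> G \<subseteq> p ` {..j}"
      proof
        fix k assume "k \<in> range p \<inter> G"
        then obtain i where "k = p i" "p i \<in> F j"
          using \<open>G = F j\<close> by auto
        moreover from this have "i \<le> j"
          using p(3)[of j i] by (cases "i \<le> j") auto
        ultimately show "k \<in> p ` {..j}"
          by auto
      qed
      then show ?thesis
        by (rule finite_subset) simp
    qed
    show "finite {G \<in> \<F>. range p \<inter> G \<subseteq> {..<n}}" for n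
    proof (rule finite_subset)
      show "{G \<in> \<F>. range p \<inter> G \<subseteq> {..<n}} \<subseteq> F ` {..<n}"
      proof safe
        fix G assume G: "G \<in> \<F>" "range p \<inter> G \<subseteq> {..<n}"
        then obtain j where j: "G = F j"
          using F by (auto simp: bij_betw_def)
        then have "p j < n"
          using G(2) p(1)[of j] by auto
        then show "G \<in> F ` {..<n}"
          using j p(2)[of j] by auto
      qed
    qed simp
  qed
  then show ?thesis ..
qed

text \<open>A well-order of type \<open>\<omega>\<^sub>1\<close>, obtained as the successor cardinal of the natural numbers.\<close>

lemma omega_1_exists:
  obtains r :: "nat set rel" where "Well_order r" "uncountable (Field r)"
    "\<And>s. s \<in> Field r \<Longrightarrow> countable (underS r s)"
proof -
  include cardinal_syntax
  define r :: "nat set rel" where "r = cardSuc natLeq"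
  have c: "Card_order r"
    by (simp add: r_def cardSuc_Card_order natLeq_Card_order)
  have "natLeq <o |Field r|"
    using cardSuc_greater[OF natLeq_Card_order] card_of_Field_ordIso[OF c] ordIso_symmetric
      ordLess_ordIso_trans unfolding r_def by blast
  then have "uncountable (Field r)"
    using not_ordLess_ordLeq by (auto simp: countable_card_le_natLeq)
  moreover have "countable (underS r s)" if "s \<in> Field r" for s
    using card_of_underS[OF c that] unfolding r_def
    by (simp add: countable_card_le_natLeq cardSuc_ordLeq_ordLess natLeq_Card_order card_of_Card_order)
  ultimately show ?thesis
    using that[of r] c by (simp add: card_order_on_well_order_on)
qed

text \<open>Recursion along \<open>\<omega>\<^sub>1\<close>, each step being possible because only countably many sets have been
  constructed before. Given uncountable \<open>X\<close> and \<open>Y\<close>, some \<open>y \<in> Y\<close> has infinitely many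
  predecessors in \<open>X\<close>, and all but finitely many of them meet \<open>A y\<close> above \<open>n\<close>.\<close>

lemma luzin_family_exists:
  obtains J :: "nat set set" and A :: "nat set \<Rightarrow> nat set" where "uncountable J"
    "\<And>s. s \<in> J \<Longrightarrow> infinite (A s)"
    "\<And>s s'. s \<in> J \<Longrightarrow> s' \<in> J \<Longrightarrow> s \<noteq> s' \<Longrightarrow> finite (A s \<inter> A s')"
    "\<And>X Y n. X \<subseteq> J \<Longrightarrow> Y \<subseteq> J \<Longrightarrow> uncountable X \<Longrightarrow> uncountable Y \<Longrightarrow>
       \<exists>x\<in>X. \<exists>y\<in>Y. \<exists>k\<ge>n. k \<in> A x \<inter> A y"
proof -
  obtain r :: "nat set rel" where wo: "Well_order r" and unc: "uncountable (Field r)"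
    and cnt: "\<And>s. s \<in> Field r \<Longrightarrow> countable (underS r s)"
    using omega_1_exists by blast
  define J where "J = Field r"
  have wf: "wf (r - Id)"
    using wo by (simp add: well_order_on_def)
  have tot: "x \<in> underS r y \<or> y \<in> underS r x" if "x \<in> J" "y \<in> J" "x \<noteq> y" for x y
    using wo that by (auto simp: J_def underS_def well_order_on_def linear_order_on_def total_on_def)
  have underJ: "x \<in> J" if "x \<in> underS r s" for x s
    using that by (auto simp: J_def underS_def Field_def)
  \<comment> \<open>The disjoint sets \<open>B i\<close> make the family infinite before the first step.\<close>
  define B where "B i = {prod_encode (i, j) | j. True}" for i :: nat
  have B: "infinite (B i)" "inj B" "i \<noteq> j \<Longrightarrow> B i \<inter> B j = {}" for i j
  proof -
    have "B i = range (\<lambda>j. prod_encode (i, j))" for i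
      by (auto simp: B_def)
    moreover have "inj (\<lambda>j. prod_encode (i, j))" for i
      by (auto intro!: injI)
    ultimately show "infinite (B i)"
      by (simp add: finite_image_iff)
    show dis: "i \<noteq> j \<Longrightarrow> B i \<inter> B j = {}" for i j
      by (auto simp: B_def)
    have "B i \<noteq> {}" for i
      by (auto simp: B_def)
    with dis show "inj B"
      by (metis injI inf.idem)
  qed
  define A where "A = wfrec (r - Id) (\<lambda>f s. SOME S. luzin_step (range B \<union> f ` underS r s) S)"
  define \<F> where "\<F> s = range B \<union> A ` underS r s" for s
  have A: "A s = (SOME S. luzin_step (\<F> s) S)" for s
  proof -
    have "cut A (r - Id) s ` underS r s = A ` underS r s"
      by (intro image_cong) (auto simp: cut_def underS_def)
    then show ?thesis
      unfolding \<F>_def by (subst A_def, subst wfrec[OF wf]) (simp add: A_def[symmetric])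
  qed
  have step: "luzin_step (\<F> s) (A s)" if "s \<in> J" for s
    using that
  proof (induction s rule: wf_induct_rule[OF wf])
    case (1 s)
    have IH: "luzin_step (\<F> x) (A x)" if "x \<in> underS r s" for x
      using 1 that underJ[OF that] by (auto simp: underS_def)
    have "\<exists>S. luzin_step (\<F> s) S"
    proof (rule luzin_step_exists)
      show "countable (\<F> s)"
        using cnt 1(2) by (auto simp: \<F>_def J_def)
      show "infinite (\<F> s)"
        using B(2) by (auto simp: \<F>_def finite_image_iff)
      show "infinite F" if "F \<in> \<F> s" for F
        using that B(1) IH by (auto simp: \<F>_def luzin_step_def)
      show "finite (F \<inter> G)" if FG: "F \<in> \<F> s" "G \<in> \<F> s" "F \<noteq> G" for F G
      proof -
        have AB: "finite (A x \<inter> B i)" if "x \<in> underS r s" for x i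
          using IH[OF that] by (auto simp: luzin_step_def \<F>_def)
        have AA: "finite (A x \<inter> A y)" if "y \<in> underS r s" "x \<in> underS r y" for x y
          using IH[OF that(1)] that(2) by (auto simp: luzin_step_def \<F>_def Int_commute)
        have AA': "finite (A x \<inter> A y)" if "x \<in> underS r s" "y \<in> underS r s" "A x \<noteq> A y" for x y
          using tot[of x y] AA[of x y] AA[of y x] that underJ by (auto simp: Int_commute)
        have BB: "finite (B i \<inter> B j)" if "B i \<noteq> B j" for i j
          using B(3)[of i j] that by (cases "i = j") auto
        consider i j where "F = B i" "G = B j" | i x where "F = B i" "G = A x" "x \<in> underS r s"
          | x j where "F = A x" "G = B j" "x \<in> underS r s"
          | x y where "F = A x" "G = A y" "x \<in> underS r s" "y \<in> underS r s"
          using FG(1,2) by (auto simp: \<F>_def)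
        then show ?thesis
          by cases (use FG(3) AB AA' BB in \<open>auto simp: Int_commute[of "B _" "A _"]\<close>)
      qed
    qed
    then show ?case
      unfolding A[of s] by (rule someI_ex)
  qed
  have inf: "infinite (A s)" if "s \<in> J" for s
    using step[OF that] by (simp add: luzin_step_def)
  have fin': "finite (A x \<inter> A y)" if "y \<in> J" "x \<in> underS r y" for x y
    using step[OF that(1)] that(2) by (auto simp: luzin_step_def \<F>_def Int_commute)
  have fin: "finite (A s \<inter> A s')" if "s \<in> J" "s' \<in> J" "s \<noteq> s'" for s s'
    using tot[OF that] fin'[of s s'] fin'[of s' s] that by (auto simp: Int_commute)
  have inj: "inj_on A J"
    using inf fin by (intro inj_onI) (metis inf.idem)
  have "\<exists>x\<in>X. \<exists>y\<in>Y. \<exists>k\<ge>n. k \<in> A x \<inter> A y"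
    if XY: "X \<subseteq> J" "Y \<subseteq> J" "uncountable X" "uncountable Y" for X Y n
  proof -
    have "infinite X"
      using XY(3) countable_finite by blast
    then obtain X0 where X0: "X0 \<subseteq> X" "infinite X0" "countable X0"
      using infinite_countable_subset' by blast
    have "\<exists>y\<in>Y. X0 \<subseteq> underS r y"
    proof (rule ccontr)
      assume "\<not> (\<exists>y\<in>Y. X0 \<subseteq> underS r y)"
      have "Y \<subseteq> (\<Union>x\<in>X0. insert x (underS r x))"
      proof
        fix y assume y: "y \<in> Y"
        then obtain x where "x \<in> X0" "x \<notin> underS r y"
          using \<open>\<not> (\<exists>y\<in>Y. X0 \<subseteq> underS r y)\<close> by blast
        moreover have "x \<in> J" "y \<in> J"
          using y calculation(1) X0(1) XY(1,2) by auto
        ultimately show "y \<in> (\<Union>x\<in>X0. insert x (underS r x))"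
          using tot[of x y] by auto
      qed
      moreover have "countable (\<Union>x\<in>X0. insert x (underS r x))"
        using X0 XY(1) cnt by (intro countable_UN countable_insert) (auto simp: J_def)
      ultimately show False
        using XY(4) countable_subset by blast
    qed
    then obtain y where y: "y \<in> Y" "X0 \<subseteq> underS r y"
      by blast
    have "infinite (A ` X0)"
      using X0 XY(1) inj by (metis finite_image_iff inj_on_subset)
    moreover have "finite {F \<in> \<F> y. A y \<inter> F \<subseteq> {..<n}}"
      using step[of y] y(1) XY(2) by (auto simp: luzin_step_def)
    ultimately obtain F where "F \<in> A ` X0" "F \<notin> {F \<in> \<F> y. A y \<inter> F \<subseteq> {..<n}}"
      by (meson finite_subset subsetI)
    then obtain x where x: "x \<in> X0" "\<not> A y \<inter> A x \<subseteq> {..<n}"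
      using y(2) by (auto simp: \<F>_def)
    then obtain k where "k \<in> A y" "k \<in> A x" "k \<ge> n"
      by (meson IntE lessThan_iff not_less subsetI)
    then show ?thesis
      using x(1) X0(1) y(1) by blast
  qed
  then show ?thesis
    using that[of J A] unc inf fin by (simp add: J_def)
qed

lemma uncountable_split:
  assumes "uncountable J"
  obtains J1 J2 where "J = J1 \<union> J2" "J1 \<inter> J2 = {}" "uncountable J1" "uncountable J2"
proof -
  have "infinite J"
    using assms countable_finite by blast
  include cardinal_syntax
  have "|J <+> J| =o |J|"
    using \<open>infinite J\<close>
    by (simp add: card_of_Plus_infinite1 card_of_mono1)
  then obtain f where f: "bij_betw f (J <+> J) J"
    using card_of_ordIso by blast
  have inj: "inj_on f (Inl ` J)" "inj_on f (Inr ` J)"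
    using f by (auto simp: bij_betw_def intro: inj_on_subset)
  show ?thesis
  proof (rule that)
    show "J = f ` (Inl ` J) \<union> f ` (Inr ` J)"
      using f by (auto simp: bij_betw_def Plus_def image_Un)
    show "f ` (Inl ` J) \<inter> f ` (Inr ` J) = {}"
    proof -
      have "f (Inl a) \<noteq> f (Inr b)" if "a \<in> J" "b \<in> J" for a b
        using f that unfolding bij_betw_def by (metis InlI InrI Inl_not_Inr inj_onD)
      then show ?thesis
        by auto
    qed
    show "uncountable (f ` (Inl ` J))" "uncountable (f ` (Inr ` J))"
      using assms inj by (auto simp: countable_image_inj_eq)
  qed
qed

lemma uncountable_fiber:
  assumes "uncountable I" "f ` I \<subseteq> Q" "countable Q"
  obtains q where "q \<in> Q" "uncountable {i \<in> I. f i = q}"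
proof -
  have "I = (\<Union>q\<in>Q. {i \<in> I. f i = q})"
    using assms(2) by auto
  then show ?thesis
    using that assms(1,3) by (metis (no_types, lifting) countable_UN)
qed

section \<open>Rank-one operators\<close>

lift_definition rank1 :: "'h::chilbert \<Rightarrow> 'h \<Rightarrow> ('h \<Rightarrow>\<^sub>L 'h)" is "\<lambda>x y z. cinner z y *\<^sub>C x"
proof -
  fix x y :: 'h
  show "bounded_linear (\<lambda>z. cinner z y *\<^sub>C x)"
  proof (rule bounded_linear_intro[where K = "norm y * norm x"])
    show "norm (cinner z y *\<^sub>C x) \<le> norm z * (norm y * norm x)" for z
      using mult_right_mono[OF cmod_cinner_le[of z y] norm_ge_zero[of x]]
      by (simp add: norm_scaleC mult.assoc)
  qed (auto simp: cinner_add_left scaleC_add_left scaleR_scaleC cinner_scaleC_left scaleC_scaleC)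
qed

lemma rank1_apply [simp]: "blinfun_apply (rank1 x y) z = cinner z y *\<^sub>C x"
  by (simp add: rank1.rep_eq)

lemma is_adjoint_rank1: "is_adjoint (rank1 x y) (rank1 y x)"
proof (rule is_adjointI)
  fix z w
  show "cinner (blinfun_apply (rank1 x y) z) w = cinner z (blinfun_apply (rank1 y x) w)"
    using cinner_commute[of x w] by (simp add: cinner_scaleC_left cinner_scaleC_right mult.commute)
qed

lemma compose_rank1: "clinear_op a \<Longrightarrow> a o\<^sub>L rank1 x y = rank1 (blinfun_apply a x) y"
  by (auto intro!: blinfun_eqI simp: clinear_op_def)

lemma rank1_compose: "is_adjoint a b \<Longrightarrow> rank1 x y o\<^sub>L a = rank1 x (blinfun_apply b y)"
  by (auto intro!: blinfun_eqI simp: is_adjoint_def)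

lemma rank1_linear:
  "rank1 (x + x') y = rank1 x y + rank1 x' y"
  "rank1 x (y + y') = rank1 x y + rank1 x y'"
  "rank1 (c *\<^sub>C x) y = scale_op c (rank1 x y)"
  "rank1 x (c *\<^sub>C y) = scale_op (cnj c) (rank1 x y)"
  by (auto intro!: blinfun_eqI simp: plus_blinfun.rep_eq scaleC_add_right cinner_add_right
      scaleC_add_left scaleC_scaleC mult.commute cinner_scaleC_right)

lemma rank1_zero [simp]: "rank1 0 y = 0" "rank1 x 0 = 0"
  by (auto intro!: blinfun_eqI)

lemma rank1_self_eq_0_iff: "rank1 x x = 0 \<longleftrightarrow> x = 0"
proof
  assume "rank1 x x = 0"
  then have "cinner x x *\<^sub>C x = 0"
    using rank1_apply[of x x x] by simp
  then have "cmod (cinner x x) * norm x = 0"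
    by (metis norm_scaleC norm_zero)
  then show "x = 0"
    using cinner_eq_0_imp[of x] by auto
qed simp

section \<open>Square-summable families\<close>

lemma ell2_eqI: "(\<And>i. ell2_nth x i = ell2_nth y i) \<Longrightarrow> x = y"
  by (simp add: ell2_nth_inject[symmetric] fun_eq_iff)

lemmas ell2_nth_simps [simp] = plus_ell2.rep_eq zero_ell2.rep_eq minus_ell2.rep_eq
  uminus_ell2.rep_eq scaleR_ell2.rep_eq scaleC_ell2.rep_eq

lift_definition ket :: "'i \<Rightarrow> 'i ell2" is "\<lambda>i j. if j = i then 1 else 0"
proof -
  fix i :: 'i
  have "(\<lambda>j. (cmod (if j = i then 1 else 0))\<^sup>2) summable_on UNIV"
    by (rule finite_nonzero_values_imp_summable_on) simp
  then show "square_summable (\<lambda>j. if j = i then 1 else 0)"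
    by (simp add: square_summable_def)
qed

lemma ell2_nth_ket: "ell2_nth (ket i) j = (if j = i then 1 else 0)"
  by (rule ket.rep_eq[THEN fun_cong])

lemma cinner_ket: "cinner x (ket i) = ell2_nth x i"
proof -
  have "cinner x (ket i) = (\<Sum>\<^sub>\<infinity>j. ell2_nth x j * cnj (ell2_nth (ket i) j))"
    by (simp add: cinner_ell2_def ell2_cinner.rep_eq)
  also have "\<dots> = (\<Sum>\<^sub>\<infinity>j\<in>{i}. ell2_nth x j * cnj (ell2_nth (ket i) j))"
    by (rule infsum_cong_neutral) (auto simp: ell2_nth_ket)
  also have "\<dots> = ell2_nth x i"
    by (simp add: ell2_nth_ket)
  finally show ?thesis .
qed

lemma cinner_ket_left: "cinner (ket i) x = cnj (ell2_nth x i)"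
  by (metis cinner_commute cinner_ket)

text \<open>The adjoint \<open>b\<close> has zero matrix, too, so it kills the basis vectors; hence all coordinates
  \<open>\<langle>a x, e\<^sub>j\<rangle> = \<langle>x, b e\<^sub>j\<rangle>\<close> vanish.\<close>

lemma operator_eq_0_if_matrix_0:
  assumes "is_adjoint a b" "\<And>i j. ell2_nth (blinfun_apply a (ket i)) j = 0"
  shows "a = 0"
proof (rule blinfun_eqI)
  fix x
  have "blinfun_apply b (ket j) = 0" for j
  proof (rule ell2_eqI)
    fix i
    have "ell2_nth (blinfun_apply b (ket j)) i = cinner (blinfun_apply b (ket j)) (ket i)"
      by (simp add: cinner_ket)
    also have "\<dots> = cinner (ket j) (blinfun_apply a (ket i))"
      using is_adjoint_sym[OF assms(1)] by (simp add: is_adjoint_def)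
    also have "\<dots> = 0"
      by (simp add: cinner_ket_left assms(2))
    finally show "ell2_nth (blinfun_apply b (ket j)) i = ell2_nth 0 i"
      by simp
  qed
  then have "ell2_nth (blinfun_apply a x) j = 0" for j
    using is_adjointD[OF assms(1), of x "ket j"] by (simp add: cinner_ket)
  then show "blinfun_apply a x = blinfun_apply 0 x"
    by (auto intro: ell2_eqI)
qed

section \<open>Weighted partial permutations\<close>

text \<open>The algebras act on \<open>\<ell>\<^sup>2(\<nat>) \<otimes> \<ell>\<^sup>2(\<nat>) \<otimes> \<complex>\<^sup>2\<close>, whose basis is indexed by the sites
  \<open>(k, m, i)\<close>. The sites are embedded into the reals, and all operators vanish on the other
  coordinates.\<close>

type_synonym site = "nat \<times> nat \<times> bool"

definition pt :: "site \<Rightarrow> real" where "pt p = real (to_nat p)"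

lemma pt_eq_iff [simp]: "pt p = pt q \<longleftrightarrow> p = q"
  by (simp add: pt_def)

lemma inj_pt: "inj pt"
  by (rule injI) simp

text \<open>The vector \<open>p \<mapsto> f p * x (\<sigma> p)\<close> on the sites, extended by zero.\<close>

definition wfun :: "(site \<Rightarrow> complex) \<Rightarrow> (site \<Rightarrow> site) \<Rightarrow> (real \<Rightarrow> complex) \<Rightarrow> real \<Rightarrow> complex" where
  "wfun f \<sigma> x r = (if r \<in> range pt then f (inv pt r) * x (pt (\<sigma> (inv pt r))) else 0)"

definition wop :: "(site \<Rightarrow> complex) \<Rightarrow> (site \<Rightarrow> site) \<Rightarrow> (real ell2 \<Rightarrow>\<^sub>L real ell2)" where
  "wop f \<sigma> = Blinfun (\<lambda>x. Abs_ell2 (wfun f \<sigma> (ell2_nth x)))"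

text \<open>The condition under which \<open>wop f \<sigma>\<close> is a bounded operator, of norm at most \<open>B\<close>.\<close>

definition wbounded :: "(site \<Rightarrow> complex) \<Rightarrow> (site \<Rightarrow> site) \<Rightarrow> real \<Rightarrow> bool" where
  "wbounded f \<sigma> B \<longleftrightarrow> B \<ge> 0 \<and> (\<forall>p. cmod (f p) \<le> B) \<and> inj_on \<sigma> {p. f p \<noteq> 0}"

lemma wfun_pt [simp]: "wfun f \<sigma> x (pt p) = f p * x (pt (\<sigma> p))"
  by (simp add: wfun_def inv_f_f[OF inj_pt])

lemma wfun_not_pt [simp]: "r \<notin> range pt \<Longrightarrow> wfun f \<sigma> x r = 0"
  by (simp add: wfun_def)

lemma wfun_eq_0: "r \<notin> pt ` {p. f p \<noteq> 0} \<Longrightarrow> wfun f \<sigma> x r = 0"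
  by (cases "r \<in> range pt") (auto simp del: split_paired_All)

lemma wfun_finite_sum:
  assumes "wbounded f \<sigma> B" "finite F"
  shows "(\<Sum>r\<in>F. (cmod (wfun f \<sigma> (ell2_nth x) r))\<^sup>2) \<le> (B * norm x)\<^sup>2"
proof -
  define S where "S = {p. pt p \<in> F \<and> f p \<noteq> 0}"
  have "pt ` S \<subseteq> F"
    by (auto simp: S_def)
  then have fin: "finite S"
    using assms(2) inj_pt finite_imageD finite_subset inj_on_subset subset_UNIV by metis
  have inj: "inj_on (\<lambda>p. pt (\<sigma> p)) S"
  proof (rule inj_onI)
    fix p q assume "p \<in> S" "q \<in> S" "pt (\<sigma> p) = pt (\<sigma> q)"
    then show "p = q"
      using assms(1) inj_onD[of \<sigma> "{p. f p \<noteq> 0}" p q] unfolding wbounded_def S_def by simp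
  qed
  have "(\<Sum>r\<in>F. (cmod (wfun f \<sigma> (ell2_nth x) r))\<^sup>2) = (\<Sum>r\<in>pt ` S. (cmod (wfun f \<sigma> (ell2_nth x) r))\<^sup>2)"
  proof (rule sum.mono_neutral_right)
    show "\<forall>r\<in>F - pt ` S. (cmod (wfun f \<sigma> (ell2_nth x) r))\<^sup>2 = 0"
    proof
      fix r assume "r \<in> F - pt ` S"
      then have "r \<notin> pt ` {p. f p \<noteq> 0}"
        by (auto simp: S_def simp del: split_paired_All split_paired_Ex)
      then show "(cmod (wfun f \<sigma> (ell2_nth x) r))\<^sup>2 = 0"
        by (simp add: wfun_eq_0)
    qed
  qed (use assms(2) \<open>pt ` S \<subseteq> F\<close> in auto)
  also have "\<dots> = (\<Sum>p\<in>S. (cmod (f p) * cmod (ell2_nth x (pt (\<sigma> p))))\<^sup>2)"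
    by (subst sum.reindex) (auto simp: norm_mult inj_on_subset[OF inj_pt])
  also have "\<dots> \<le> (\<Sum>p\<in>S. (B * cmod (ell2_nth x (pt (\<sigma> p))))\<^sup>2)"
    using assms(1) by (intro sum_mono power_mono mult_right_mono) (auto simp: wbounded_def)
  also have "\<dots> = B\<^sup>2 * (\<Sum>r\<in>(\<lambda>p. pt (\<sigma> p)) ` S. (cmod (ell2_nth x r))\<^sup>2)"
    by (subst sum.reindex[OF inj]) (simp add: power_mult_distrib sum_distrib_left)
  also have "\<dots> \<le> B\<^sup>2 * (norm x)\<^sup>2"
    using fin by (intro mult_left_mono sum_le_norm_ell2) auto
  finally show ?thesis
    by (simp add: power_mult_distrib)
qed

lemma square_summable_wfun:
  assumes "wbounded f \<sigma> B"
  shows "square_summable (wfun f \<sigma> (ell2_nth x))"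
  unfolding square_summable_def
  by (rule nonneg_bdd_above_summable_on)
     (auto intro!: bdd_aboveI2[where M = "(B * norm x)\<^sup>2"] wfun_finite_sum[OF assms])

lemma
  assumes "wbounded f \<sigma> B"
  shows ell2_nth_wop: "ell2_nth (blinfun_apply (wop f \<sigma>) x) = wfun f \<sigma> (ell2_nth x)"
    and norm_wop_le: "norm (wop f \<sigma>) \<le> B"
proof -
  define T where "T x = Abs_ell2 (wfun f \<sigma> (ell2_nth x))" for x
  have nth: "ell2_nth (T x) = wfun f \<sigma> (ell2_nth x)" for x
    unfolding T_def by (rule Abs_ell2_inverse) (simp add: square_summable_wfun[OF assms])
  have bound: "norm (T x) \<le> B * norm x" for x
  proof (rule power2_le_imp_le)
    show "(norm (T x))\<^sup>2 \<le> (B * norm x)\<^sup>2"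
      unfolding norm_ell2_power2 [of "T x"]
      by (intro infsum_le_finite_sums ell2_summable) (simp add: nth wfun_finite_sum[OF assms])
    show "0 \<le> B * norm x"
      using assms by (simp add: wbounded_def)
  qed
  have "bounded_linear T"
  proof (rule bounded_linear_intro)
    show "T (x + y) = T x + T y" "T (r *\<^sub>R x) = r *\<^sub>R T x" for x y r
      by (auto intro!: ell2_eqI simp: nth wfun_def algebra_simps)
    show "norm (T x) \<le> norm x * B" for x
      using bound[of x] by (simp add: mult.commute)
  qed
  then have T: "blinfun_apply (wop f \<sigma>) = T"
    unfolding wop_def T_def by (rule bounded_linear_Blinfun_apply)
  then show "ell2_nth (blinfun_apply (wop f \<sigma>) x) = wfun f \<sigma> (ell2_nth x)"
    by (simp add: nth)
  show "norm (wop f \<sigma>) \<le> B"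
    using assms by (intro norm_blinfun_bound) (auto simp: T bound wbounded_def)
qed

text \<open>Substituting \<open>q = \<sigma> p\<close> in the inner product; the hypotheses say that \<open>\<sigma>\<close> and \<open>\<tau>\<close> are inverse
  bijections between the supports of \<open>f\<close> and \<open>g\<close>.\<close>

lemma is_adjoint_wop:
  assumes b: "wbounded f \<sigma> B" "wbounded g \<tau> C"
    and fg: "\<And>p. f p \<noteq> 0 \<Longrightarrow> \<tau> (\<sigma> p) = p \<and> g (\<sigma> p) = cnj (f p)"
    and gf: "\<And>p. g p \<noteq> 0 \<Longrightarrow> \<sigma> (\<tau> p) = p \<and> f (\<tau> p) = cnj (g p)"
  shows "is_adjoint (wop f \<sigma>) (wop g \<tau>)"
proof (rule is_adjointI)
  fix x y
  define S where "S = {p. f p \<noteq> 0}"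
  define S' where "S' = {p. g p \<noteq> 0}"
  have sup: "r \<notin> pt ` S \<Longrightarrow> wfun f \<sigma> z r = 0" "r \<notin> pt ` S' \<Longrightarrow> wfun g \<tau> z r = 0" for r z
    unfolding S_def S'_def by (rule wfun_eq_0, assumption)+
  have bij: "bij_betw \<sigma> S S'"
    by (rule bij_betw_byWitness[where f' = \<tau>]) (use fg gf in \<open>auto simp: S_def S'_def\<close>)
  have red: "(\<Sum>\<^sub>\<infinity>r. F r) = (\<Sum>\<^sub>\<infinity>p\<in>Q. F (pt p))"
    if "\<And>r. r \<notin> pt ` Q \<Longrightarrow> F r = 0" for F :: "real \<Rightarrow> complex" and Q
  proof -
    have "(\<Sum>\<^sub>\<infinity>r. F r) = (\<Sum>\<^sub>\<infinity>r\<in>pt ` Q. F r)"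
      by (rule infsum_cong_neutral) (use that in auto)
    also have "\<dots> = (\<Sum>\<^sub>\<infinity>p\<in>Q. F (pt p))"
      by (subst infsum_reindex) (auto simp: inj_on_def o_def)
    finally show ?thesis .
  qed
  have "cinner (blinfun_apply (wop f \<sigma>) x) y = (\<Sum>\<^sub>\<infinity>r. wfun f \<sigma> (ell2_nth x) r * cnj (ell2_nth y r))"
    by (simp add: cinner_ell2_def ell2_cinner.rep_eq ell2_nth_wop[OF b(1)])
  also have "\<dots> = (\<Sum>\<^sub>\<infinity>p\<in>S. f p * ell2_nth x (pt (\<sigma> p)) * cnj (ell2_nth y (pt p)))"
    by (subst red[of S]) (simp_all add: sup)
  also have "\<dots> = (\<Sum>\<^sub>\<infinity>p\<in>S. ell2_nth x (pt (\<sigma> p)) * cnj (g (\<sigma> p) * ell2_nth y (pt (\<tau> (\<sigma> p)))))"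
    by (rule infsum_cong) (use fg in \<open>auto simp: S_def\<close>)
  also have "\<dots> = (\<Sum>\<^sub>\<infinity>q\<in>S'. ell2_nth x (pt q) * cnj (g q * ell2_nth y (pt (\<tau> q))))"
    by (rule infsum_reindex_bij_betw[OF bij])
  also have "\<dots> = (\<Sum>\<^sub>\<infinity>r. ell2_nth x r * cnj (wfun g \<tau> (ell2_nth y) r))"
    by (subst red[of S']) (simp_all add: sup)
  also have "\<dots> = cinner x (blinfun_apply (wop g \<tau>) y)"
    by (simp add: cinner_ell2_def ell2_cinner.rep_eq ell2_nth_wop[OF b(2)])
  finally show "cinner (blinfun_apply (wop f \<sigma>) x) y = cinner x (blinfun_apply (wop g \<tau>) y)" .
qed

lemma site_eqI:
  assumes "\<And>p. ell2_nth x (pt p) = ell2_nth y (pt p)"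
    "\<And>r. r \<notin> range pt \<Longrightarrow> ell2_nth x r = 0" "\<And>r. r \<notin> range pt \<Longrightarrow> ell2_nth y r = 0"
  shows "x = y"
proof (rule ell2_eqI)
  show "ell2_nth x r = ell2_nth y r" for r
    using assms by (cases "r \<in> range pt") auto
qed

lemma site_op_eqI:
  assumes "\<And>x k m i. ell2_nth (blinfun_apply a x) (pt (k, m, i)) = ell2_nth (blinfun_apply b x) (pt (k, m, i))"
    "\<And>x r. r \<notin> range pt \<Longrightarrow> ell2_nth (blinfun_apply a x) r = 0"
    "\<And>x r. r \<notin> range pt \<Longrightarrow> ell2_nth (blinfun_apply b x) r = 0"
  shows "a = b"
  by (rule blinfun_eqI, rule site_eqI) (use assms in \<open>auto simp del: split_paired_All\<close>)

section \<open>Blocks over a set of sites\<close>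

text \<open>On \<open>\<ell>\<^sup>2(\<nat>) \<otimes> \<ell>\<^sup>2(\<nat>) \<otimes> \<complex>\<^sup>2\<close> the operator \<open>blk A m u v\<close> below is \<open>P\<^sub>A \<otimes> q\<^sub>m \<otimes> |u\<rangle>\<langle>v|\<close>, where
  \<open>P\<^sub>A\<close> is the coordinate projection onto \<open>A\<close> and \<open>q\<^sub>m\<close> the one onto the \<open>m\<close>-th basis vector. It is
  assembled from the matrix \<open>|u\<rangle>\<langle>v| = diag(u) (1 + flip) diag(v)\<close>. The Hilbert space vector
  \<open>bvec k m u\<close> is \<open>e\<^sub>k \<otimes> e\<^sub>m \<otimes> u\<close>.\<close>

definition dop :: "nat set \<Rightarrow> nat \<Rightarrow> (bool \<Rightarrow> real) \<Rightarrow> (real ell2 \<Rightarrow>\<^sub>L real ell2)" where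
  "dop A m u = wop (\<lambda>(k, m', i). if k \<in> A \<and> m' = m then of_real (u i) else 0) id"

definition flip_op :: "real ell2 \<Rightarrow>\<^sub>L real ell2" where
  "flip_op = wop (\<lambda>_. 1) (\<lambda>(k, m, i). (k, m, \<not> i))"

definition blk :: "nat set \<Rightarrow> nat \<Rightarrow> (bool \<Rightarrow> real) \<Rightarrow> (bool \<Rightarrow> real) \<Rightarrow> (real ell2 \<Rightarrow>\<^sub>L real ell2)" where
  "blk A m u v = dop A m u o\<^sub>L ((id_blinfun + flip_op) o\<^sub>L dop A m v)"

lemma wbounded_dop:
  "wbounded (\<lambda>(k, m', i). if k \<in> A \<and> m' = m then complex_of_real (u i) else 0) id
     (\<bar>u False\<bar> + \<bar>u True\<bar>)"
proof -
  have "\<bar>u i\<bar> \<le> \<bar>u False\<bar> + \<bar>u True\<bar>" for i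
    by (cases i) auto
  then show ?thesis
    by (auto simp: wbounded_def inj_on_def split: if_splits)
qed

lemma wbounded_flip: "wbounded (\<lambda>_. 1) (\<lambda>(k, m, i). (k, m, \<not> i)) 1"
  by (auto simp: wbounded_def inj_on_def)

lemma ell2_nth_blk_pt:
  "ell2_nth (blinfun_apply (blk A m u v) x) (pt (k, m', i)) =
     (if k \<in> A \<and> m' = m then of_real (u i) *
        (of_real (v False) * ell2_nth x (pt (k, m, False)) + of_real (v True) * ell2_nth x (pt (k, m, True))) else 0)"
  by (cases i) (auto simp: blk_def dop_def flip_op_def plus_blinfun.rep_eq
      ell2_nth_wop[OF wbounded_dop] ell2_nth_wop[OF wbounded_flip] algebra_simps)

lemma ell2_nth_blk_not_pt: "r \<notin> range pt \<Longrightarrow> ell2_nth (blinfun_apply (blk A m u v) x) r = 0"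
  by (simp add: blk_def dop_def ell2_nth_wop[OF wbounded_dop])

lemma is_adjoint_blk: "is_adjoint (blk A m u v) (blk A m v u)"
proof -
  have d: "is_adjoint (dop A m u) (dop A m u)" for u
    unfolding dop_def by (rule is_adjoint_wop[OF wbounded_dop wbounded_dop]) auto
  have f: "is_adjoint flip_op flip_op"
    unfolding flip_op_def by (rule is_adjoint_wop[OF wbounded_flip wbounded_flip]) auto
  show ?thesis
    unfolding blk_def blinfun_compose_assoc[symmetric]
    by (subst blinfun_compose_assoc) (intro is_adjoint_compose is_adjoint_add is_adjoint_id d f)
qed

definition dot :: "(bool \<Rightarrow> real) \<Rightarrow> (bool \<Rightarrow> real) \<Rightarrow> real" where
  "dot u v = u False * v False + u True * v True"

lemma dot_commute: "dot u v = dot v u"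
  by (simp add: dot_def)

definition bvec :: "nat \<Rightarrow> nat \<Rightarrow> (bool \<Rightarrow> real) \<Rightarrow> real ell2" where
  "bvec k m u = of_real (u False) *\<^sub>C ket (pt (k, m, False)) + of_real (u True) *\<^sub>C ket (pt (k, m, True))"

lemma ell2_nth_bvec_pt:
  "ell2_nth (bvec k m u) (pt (k', m', i)) = (if k' = k \<and> m' = m then of_real (u i) else 0)"
  by (cases i) (auto simp: bvec_def ell2_nth_ket)

lemma ell2_nth_bvec_not_pt: "r \<notin> range pt \<Longrightarrow> ell2_nth (bvec k m u) r = 0"
  by (auto simp: bvec_def ell2_nth_ket)

lemma cinner_bvec: "cinner x (bvec k m u) =
  of_real (u False) * ell2_nth x (pt (k, m, False)) + of_real (u True) * ell2_nth x (pt (k, m, True))"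
  by (simp add: bvec_def cinner_add_right cinner_scaleC_right cinner_ket)

lemma cinner_bvec_bvec: "cinner (bvec k m u) (bvec k m v) = of_real (dot u v)"
  by (simp add: cinner_bvec ell2_nth_bvec_pt dot_def mult.commute)

lemma norm_bvec: "(norm (bvec k m u))\<^sup>2 = dot u u"
  using cinner_self[of "bvec k m u"] by (simp only: cinner_bvec_bvec of_real_eq_iff)

lemma blk_bvec:
  "blinfun_apply (blk A m u v) (bvec k m' w) = (if k \<in> A \<and> m' = m then of_real (dot v w) *\<^sub>C bvec k m u else 0)"
  by (rule site_eqI) (auto simp: ell2_nth_blk_pt ell2_nth_blk_not_pt ell2_nth_bvec_pt ell2_nth_bvec_not_pt dot_def)

lemma blk_compose:
  "blk A m u v o\<^sub>L blk B m' u' v' = (if m = m' then scale_op (of_real (dot v u')) (blk (A \<inter> B) m u v') else 0)"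
  by (rule site_op_eqI) (auto simp: ell2_nth_blk_pt ell2_nth_blk_not_pt dot_def algebra_simps)

lemma blk_Un:
  assumes "A \<inter> B = {}"
  shows "blk (A \<union> B) m u v = blk A m u v + blk B m u v"
  using assms
  by (intro site_op_eqI) (auto simp: ell2_nth_blk_pt ell2_nth_blk_not_pt plus_blinfun.rep_eq)

lemma blk_empty: "blk {} m u v = 0"
  by (rule site_op_eqI) (auto simp: ell2_nth_blk_pt ell2_nth_blk_not_pt)

lemma blk_singleton: "blk {k} m u v = rank1 (bvec k m u) (bvec k m v)"
  by (rule site_op_eqI)
     (auto simp: ell2_nth_blk_pt ell2_nth_bvec_pt cinner_bvec ell2_nth_blk_not_pt ell2_nth_bvec_not_pt)

lemma blk_scale:
  "blk A m (\<lambda>i. c * u i) v = scale_op (of_real c) (blk A m u v)"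
  "blk A m u (\<lambda>i. c * v i) = scale_op (of_real c) (blk A m u v)"
  by (rule site_op_eqI, auto simp: ell2_nth_blk_pt ell2_nth_blk_not_pt algebra_simps)+

lemma norm_blk_projection: "dot u u = 1 \<Longrightarrow> norm (blk A m u u) \<le> 1"
  by (rule norm_projection_le_1[OF is_adjoint_blk]) (simp add: blk_compose scale_op_simps)

text \<open>With \<open>p = |u\<rangle>\<langle>u|\<close> and \<open>q = |v\<rangle>\<langle>v|\<close> one has \<open>q p q = \<langle>u, v\<rangle>\<^sup>2 q\<close>; now use the C*-identity.\<close>

lemma norm_blk_product:
  assumes "dot u u = 1" "dot v v = 1"
  shows "norm (blk A m u u o\<^sub>L blk B m' v v) \<le> (if m = m' then \<bar>dot u v\<bar> else 0)"
proof (cases "m = m'")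
  case True
  let ?x = "blk A m u u o\<^sub>L blk B m v v"
  have adj: "is_adjoint ?x (blk B m v v o\<^sub>L blk A m u u)"
    by (intro is_adjoint_compose is_adjoint_blk)
  have "(blk B m v v o\<^sub>L blk A m u u) o\<^sub>L ?x = scale_op (of_real ((dot u v)\<^sup>2)) (blk (A \<inter> B) m v v)"
  proof -
    have "blk A m u u o\<^sub>L ?x = (blk A m u u o\<^sub>L blk A m u u) o\<^sub>L blk B m v v"
      by (rule blinfun_compose_assoc[symmetric])
    also have "blk A m u u o\<^sub>L blk A m u u = blk A m u u"
      using assms by (simp add: blk_compose scale_op_simps)
    finally have "(blk B m v v o\<^sub>L blk A m u u) o\<^sub>L ?x = blk B m v v o\<^sub>L ?x"
      by (simp only: blinfun_compose_assoc)
    also have "\<dots> = blk B m v v o\<^sub>L scale_op (of_real (dot u v)) (blk (A \<inter> B) m u v)"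
      by (simp add: blk_compose)
    also have "\<dots> = scale_op (of_real (dot u v)) (blk B m v v o\<^sub>L blk (A \<inter> B) m u v)"
      by (rule blinfun_compose_scale_op_right[OF is_adjoint_clinear[OF is_adjoint_blk]])
    also have "\<dots> = scale_op (of_real ((dot u v)\<^sup>2)) (blk (A \<inter> B) m v v)"
      by (simp add: blk_compose scale_op_simps dot_commute[of v u] power2_eq_square Int_left_commute Int_absorb1)
    finally show ?thesis .
  qed
  then have "(norm ?x)\<^sup>2 = (dot u v)\<^sup>2 * norm (blk (A \<inter> B) m v v)"
    using norm_compose_adjoint[OF adj] by (simp add: norm_scale_op norm_power)
  also have "\<dots> \<le> (dot u v)\<^sup>2"
    using norm_blk_projection[OF assms(2), of "A \<inter> B" m] by (simp add: mult_left_le)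
  finally have "norm ?x \<le> \<bar>dot u v\<bar>"
    using abs_le_square_iff[of "norm ?x" "dot u v"] by simp
  then show ?thesis
    using True by simp
qed (simp add: blk_compose)

section \<open>Rescaling operators\<close>

text \<open>Conjugation by \<open>resc l \<sigma>\<close> permutes the coordinate \<open>m\<close> and rescales the vectors \<open>u\<close> of the blocks;
  this is the source of the completely bounded isomorphisms.\<close>

definition resc :: "(nat \<Rightarrow> bool \<Rightarrow> real) \<Rightarrow> (nat \<Rightarrow> nat) \<Rightarrow> (real ell2 \<Rightarrow>\<^sub>L real ell2)" where
  "resc l \<sigma> = wop (\<lambda>(k, m, i). of_real (l m i)) (\<lambda>(k, m, i). (k, \<sigma> m, i))"

lemma wbounded_resc:
  assumes "\<And>m i. \<bar>l m i\<bar> \<le> B" "inj \<sigma>"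
  shows "wbounded (\<lambda>(k, m, i). complex_of_real (l m i)) (\<lambda>(k, m, i). (k, \<sigma> m, i)) B"
  using assms order_trans[OF abs_ge_zero assms(1)] by (auto simp: wbounded_def inj_on_def)

lemma ell2_nth_resc:
  assumes "\<And>m i. \<bar>l m i\<bar> \<le> B" "inj \<sigma>"
  shows "ell2_nth (blinfun_apply (resc l \<sigma>) x) (pt (k, m, i)) = of_real (l m i) * ell2_nth x (pt (k, \<sigma> m, i))"
    "r \<notin> range pt \<Longrightarrow> ell2_nth (blinfun_apply (resc l \<sigma>) x) r = 0"
    "norm (resc l \<sigma>) \<le> B"
  using ell2_nth_wop[OF wbounded_resc[OF assms]] norm_wop_le[OF wbounded_resc[OF assms]]
  by (auto simp: resc_def)

lemma is_adjoint_resc: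
  assumes l: "\<And>m i. \<bar>l m i\<bar> \<le> B" and \<sigma>: "\<And>m. \<sigma> (\<tau> m) = m" "\<And>m. \<tau> (\<sigma> m) = m"
  shows "is_adjoint (resc l \<sigma>) (resc (\<lambda>m. l (\<tau> m)) \<tau>)"
  unfolding resc_def
  by (rule is_adjoint_wop[OF wbounded_resc wbounded_resc])
     (use \<sigma> in \<open>auto intro: l inj_on_inverseI[of _ \<tau>] inj_on_inverseI[of _ \<sigma>] simp: \<sigma>\<close>)

lemma resc_ket:
  assumes l: "\<And>m i. \<bar>l m i\<bar> \<le> B" and \<sigma>: "\<And>m. \<sigma> (\<tau> m) = m" "\<And>m. \<tau> (\<sigma> m) = m"
  shows "blinfun_apply (resc l \<sigma>) (ket (pt (k, m, i))) = of_real (l (\<tau> m) i) *\<^sub>C ket (pt (k, \<tau> m, i))"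
proof (rule site_eqI)
  have "inj \<sigma>"
    by (metis injI \<sigma>(2))
  note n = ell2_nth_resc[OF l this]
  show "ell2_nth (blinfun_apply (resc l \<sigma>) (ket (pt (k, m, i)))) (pt p) =
      ell2_nth (of_real (l (\<tau> m) i) *\<^sub>C ket (pt (k, \<tau> m, i))) (pt p)" for p
    using \<sigma> by (cases p) (auto simp: n(1) ell2_nth_ket)
  show "r \<notin> range pt \<Longrightarrow> ell2_nth (blinfun_apply (resc l \<sigma>) (ket (pt (k, m, i)))) r = 0" for r
    by (rule n(2))
qed (auto simp: ell2_nth_ket)

lemma resc_blk:
  assumes l: "\<And>m i. \<bar>l m i\<bar> \<le> B" and \<sigma>: "\<And>m. \<sigma> (\<tau> m) = m" "\<And>m. \<tau> (\<sigma> m) = m"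
  shows "(resc l \<sigma> o\<^sub>L blk A m u v) o\<^sub>L resc (\<lambda>m. l (\<tau> m)) \<tau>
    = blk A (\<tau> m) (\<lambda>i. l (\<tau> m) i * u i) (\<lambda>i. l (\<tau> m) i * v i)"
proof -
  have "inj \<sigma>" "inj \<tau>"
    by (metis injI \<sigma>(2)) (metis injI \<sigma>(1))
  note n = ell2_nth_resc[OF l \<open>inj \<sigma>\<close>] ell2_nth_resc[OF l \<open>inj \<tau>\<close>]
  show ?thesis
    by (rule site_op_eqI)
       (auto simp: n(1,2,4) \<sigma> ell2_nth_blk_pt ell2_nth_blk_not_pt algebra_simps)
qed

lemma resc_resc:
  assumes l: "\<And>m i. \<bar>l m i\<bar> \<le> B" "\<And>m i. \<bar>l' m i\<bar> \<le> B'"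
    and \<sigma>: "\<And>m. \<sigma> (\<tau> m) = m" "\<And>m. \<tau> (\<sigma> m) = m" and ll': "\<And>m i. l' m i * l (\<tau> m) i = 1"
    and x: "\<And>r. r \<notin> range pt \<Longrightarrow> ell2_nth x r = 0"
  shows "blinfun_apply (resc l' \<tau>) (blinfun_apply (resc l \<sigma>) x) = x"
proof (rule site_eqI)
  have "inj \<sigma>" "inj \<tau>"
    by (metis injI \<sigma>(2)) (metis injI \<sigma>(1))
  note n = ell2_nth_resc[OF l(1) \<open>inj \<sigma>\<close>] ell2_nth_resc[OF l(2) \<open>inj \<tau>\<close>]
  show "ell2_nth (blinfun_apply (resc l' \<tau>) (blinfun_apply (resc l \<sigma>) x)) (pt p) = ell2_nth x (pt p)" for p
  proof (cases p)
    case (fields k m i)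
    have "complex_of_real (l' m i) * complex_of_real (l (\<tau> m) i) = 1"
      by (metis ll' of_real_1 of_real_mult)
    then show ?thesis
      using \<sigma> by (simp add: fields n(1,4) mult.assoc[symmetric])
  qed
  show "r \<notin> range pt \<Longrightarrow> ell2_nth (blinfun_apply (resc l' \<tau>) (blinfun_apply (resc l \<sigma>) x)) r = 0" for r
    by (rule n(5))
qed (rule x)

lemma closed_span_mono:
  assumes "G \<subseteq> H"
  shows "closed_span G \<subseteq> closed_span H"
proof
  fix a assume "a \<in> closed_span G"
  then show "a \<in> closed_span H"
    by (rule closed_span_minimal)
       (use assms in \<open>auto intro: closed_span_base closed_span_zero closed_span_add closed_span_scale closed_closed_span\<close>)
qed

lemma closed_span_sum:
  "(\<And>i. i \<in> F \<Longrightarrow> f i \<in> closed_span G) \<Longrightarrow> (\<Sum>i\<in>F. f i) \<in> closed_span G"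
  by (induction F rule: infinite_finite_induct) (auto intro: closed_span_zero closed_span_add)

section \<open>The compact operators\<close>

text \<open>\<open>Kop\<close> is the algebra of compact operators on the closed span of the basis vectors at the sites.\<close>

definition munits :: "(real ell2 \<Rightarrow>\<^sub>L real ell2) set" where
  "munits = {rank1 (ket (pt p)) (ket (pt q)) | p q. True}"

definition Kop :: "(real ell2 \<Rightarrow>\<^sub>L real ell2) set" where
  "Kop = closed_span munits"

lemma countable_munits: "countable munits"
proof -
  have "munits = (\<lambda>(p, q). rank1 (ket (pt p)) (ket (pt q))) ` UNIV"
    unfolding munits_def by (auto simp del: split_paired_All split_paired_Ex)
  then show ?thesis
    by (metis countable_image countableI_type)
qed

lemma Kop_unit: "rank1 (ket (pt p)) (ket (pt q)) \<in> Kop"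
  unfolding Kop_def by (rule closed_span_base) (unfold munits_def, blast)

lemmas Kop_simps = closed_span_zero[of munits, folded Kop_def] closed_span_add[of _ munits, folded Kop_def]
  closed_span_scale[of _ munits, folded Kop_def] closed_span_diff[of _ munits, folded Kop_def]

lemma Kop_rank1_bvec:
  "rank1 (bvec k m u) (ket (pt q)) \<in> Kop" "rank1 (ket (pt q)) (bvec k m u) \<in> Kop"
  "rank1 (bvec k m u) (bvec k' m' v) \<in> Kop"
  unfolding bvec_def rank1_linear by (intro Kop_simps Kop_unit)+

lemma Kop_blk_finite: "finite A \<Longrightarrow> blk A m u v \<in> Kop"
proof (induction rule: finite_induct)
  case (insert k A)
  then have "blk (insert k A) m u v = blk {k} m u v + blk A m u v"
    using blk_Un[of "{k}" A] by simp
  then show ?case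
    using insert by (simp add: blk_singleton Kop_rank1_bvec Kop_simps)
qed (simp add: blk_empty Kop_simps)

lemma blk_ket:
  "blinfun_apply (blk A m u v) (ket (pt (k, m', i))) =
     (if k \<in> A \<and> m' = m then of_real (v i) *\<^sub>C bvec k m u else 0)"
  by (rule site_eqI; cases i)
     (auto simp: ell2_nth_blk_pt ell2_nth_blk_not_pt ell2_nth_bvec_pt ell2_nth_bvec_not_pt ell2_nth_ket)

lemma blk_compose_munit: "blk A m u v o\<^sub>L rank1 (ket (pt p)) (ket (pt q)) \<in> Kop"
  by (cases p) (auto simp: compose_rank1[OF is_adjoint_clinear[OF is_adjoint_blk]] blk_ket rank1_linear
      intro!: Kop_simps Kop_rank1_bvec)

lemma munit_compose_blk: "rank1 (ket (pt p)) (ket (pt q)) o\<^sub>L blk A m u v \<in> Kop"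
  by (cases q) (auto simp: rank1_compose[OF is_adjoint_blk] blk_ket rank1_linear
      intro!: Kop_simps Kop_rank1_bvec)

lemma munit_compose_munit:
  "rank1 (ket (pt p)) (ket (pt q)) o\<^sub>L rank1 (ket (pt p')) (ket (pt q')) \<in> Kop"
  by (auto simp: compose_rank1[OF is_adjoint_clinear[OF is_adjoint_rank1]] rank1_linear
      intro!: Kop_simps Kop_unit)

text \<open>Compact operators map weakly null sequences to norm null sequences.\<close>

lemma Kop_tendsto_0:
  assumes "a \<in> Kop"
  shows "(\<lambda>k. blinfun_apply a (bvec k m u)) \<longlonglongrightarrow> 0"
proof -
  let ?N = "{a. (\<lambda>k. blinfun_apply a (bvec k m u)) \<longlonglongrightarrow> 0}"
  define C where "C = sqrt (dot u u) + 1"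
  have norm: "norm (bvec k m u) \<le> C" for k
    using norm_bvec[of k m u] by (simp add: C_def real_le_rsqrt add_increasing2)
  have "dot u u \<ge> 0"
    by (simp add: dot_def)
  then have C: "C > 0"
    by (simp add: C_def add_nonneg_pos)
  have "a \<in> ?N"
    using assms unfolding Kop_def
  proof (rule closed_span_minimal)
    show "g \<in> ?N" if g: "g \<in> munits" for g
    proof -
      obtain p k m' i where g: "g = rank1 (ket (pt p)) (ket (pt (k, m', i)))"
        using g by (auto simp: munits_def)
      have "eventually (\<lambda>k'. k' \<ge> Suc k) sequentially"
        by (rule eventually_ge_at_top)
      then have "eventually (\<lambda>k'. blinfun_apply g (bvec k' m u) = 0) sequentially"
        by eventually_elim (simp add: g cinner_ket ell2_nth_bvec_pt)
      then show ?thesis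
        by (simp add: tendsto_eventually)
    qed
    show "closed ?N"
      unfolding closed_sequential_limits
    proof (intro allI impI)
      fix f l assume f: "(\<forall>n. f n \<in> ?N) \<and> f \<longlonglongrightarrow> l"
      have "(\<lambda>k. blinfun_apply l (bvec k m u)) \<longlonglongrightarrow> 0"
      proof (rule tendstoI)
        fix e :: real assume e: "e > 0"
        then have "e / 2 / C > 0"
          using C by simp
        then obtain n where n: "norm (l - f n) < e / 2 / C"
          using f by (metis LIMSEQ_iff norm_minus_commute order_refl)
        have "eventually (\<lambda>k. dist (blinfun_apply (f n) (bvec k m u)) 0 < e / 2) sequentially"
          using f e by (intro tendstoD) auto
        then show "eventually (\<lambda>k. dist (blinfun_apply l (bvec k m u)) 0 < e) sequentially"
        proof eventually_elim
          case (elim k)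
          have "norm (blinfun_apply (l - f n) (bvec k m u)) \<le> norm (l - f n) * C"
            using norm_blinfun[of "l - f n" "bvec k m u"] mult_left_mono[OF norm[of k] norm_ge_zero[of "l - f n"]]
            by linarith
          also have "\<dots> < e / 2"
            using n C pos_less_divide_eq[of C "norm (l - f n)" "e / 2"] by simp
          finally have "norm (blinfun_apply (l - f n) (bvec k m u) + blinfun_apply (f n) (bvec k m u)) < e / 2 + e / 2"
            using elim by (intro norm_add_less) simp_all
          then show ?case
            by (simp add: minus_blinfun.rep_eq)
        qed
      qed
      then show "l \<in> ?N"
        by simp
    qed
    show "x + y \<in> ?N"
      if "x \<in> ?N"
        "y \<in> ?N" for x y
      using that by (auto simp: plus_blinfun.rep_eq intro: tendsto_add_zero)
    show "scale_op c x \<in> ?N"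
      if "x \<in> ?N" for c x
      using that bounded_linear.tendsto[OF bounded_linear_scaleC[of c], of "\<lambda>k. blinfun_apply x (bvec k m u)" 0]
      by simp
  qed simp
  then show ?thesis
    by simp
qed

section \<open>Algebras from a Luzin family\<close>

text \<open>The unit vectors \<open>(1, 0)\<close> and \<open>(1, x) / \<surd>(1 + x\<^sup>2)\<close>. The cosine of their angle determines \<open>x > 0\<close>.\<close>

definition dirv :: "real \<Rightarrow> bool \<Rightarrow> bool \<Rightarrow> real" where
  "dirv x b = (if b then (\<lambda>i. if i then 0 else 1) else (\<lambda>i. inverse (sqrt (1 + x\<^sup>2)) * (if i then x else 1)))"

lemma dot_dirv:
  "dot (dirv x b) (dirv x b) = 1"
  "dot (dirv x True) (dirv x False) = inverse (sqrt (1 + x\<^sup>2))"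
proof -
  have pos: "1 + x\<^sup>2 > 0"
    by (simp add: add_pos_nonneg)
  then have "inverse (sqrt (1 + x\<^sup>2)) * inverse (sqrt (1 + x\<^sup>2)) = inverse (1 + x\<^sup>2)"
    by (metis inverse_mult_distrib less_imp_le real_sqrt_mult_self abs_of_pos)
  then have "inverse (sqrt (1 + x\<^sup>2)) * inverse (sqrt (1 + x\<^sup>2)) * (1 + x\<^sup>2) = 1"
    using pos by simp
  then show "dot (dirv x b) (dirv x b) = 1"
    by (simp add: dirv_def dot_def algebra_simps power2_eq_square)
qed (simp add: dirv_def dot_def)

text \<open>An almost disjoint family indexed by \<open>J1 \<union> J2\<close>; the last hypothesis says that no two uncountable
  subfamilies become disjoint after removing a finite set. The two parts of the index set carry the
  two kinds of unit vectors.\<close>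

locale luzin =
  fixes J1 J2 :: "'s set" and A :: "'s \<Rightarrow> nat set"
  assumes disj: "J1 \<inter> J2 = {}"
    and unc: "uncountable J1" "uncountable J2"
    and inf: "\<And>s. s \<in> J1 \<union> J2 \<Longrightarrow> infinite (A s)"
    and almost_disjoint: "\<And>s s'. s \<in> J1 \<union> J2 \<Longrightarrow> s' \<in> J1 \<union> J2 \<Longrightarrow> s \<noteq> s' \<Longrightarrow> finite (A s \<inter> A s')"
    and luzin: "\<And>X Y n. X \<subseteq> J1 \<union> J2 \<Longrightarrow> Y \<subseteq> J1 \<union> J2 \<Longrightarrow> uncountable X \<Longrightarrow> uncountable Y \<Longrightarrow>
       \<exists>x\<in>X. \<exists>y\<in>Y. \<exists>k\<ge>n. k \<in> A x \<inter> A y"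
begin

definition \<Lambda> :: "('s \<times> nat) set" where "\<Lambda> = (J1 \<union> J2) \<times> UNIV"

lemma fst_\<Lambda>: "\<kappa> \<in> \<Lambda> \<Longrightarrow> fst \<kappa> \<in> J1 \<union> J2"
  by (auto simp: \<Lambda>_def)

definition dir :: "(nat \<Rightarrow> real) \<Rightarrow> 's \<times> nat \<Rightarrow> bool \<Rightarrow> real" where
  "dir t \<kappa> = dirv (t (snd \<kappa>)) (fst \<kappa> \<in> J1)"

definition gen :: "(nat \<Rightarrow> real) \<Rightarrow> 's \<times> nat \<Rightarrow> (real ell2 \<Rightarrow>\<^sub>L real ell2)" where
  "gen t \<kappa> = blk (A (fst \<kappa>)) (snd \<kappa>) (dir t \<kappa>) (dir t \<kappa>)"

text \<open>An orthonormal sequence that is fixed by \<open>gen t \<kappa>\<close> for \<open>k \<in> A (fst \<kappa>)\<close>.\<close>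

definition w :: "(nat \<Rightarrow> real) \<Rightarrow> 's \<times> nat \<Rightarrow> nat \<Rightarrow> real ell2" where
  "w t \<kappa> k = bvec k (snd \<kappa>) (dir t \<kappa>)"

definition gens :: "(nat \<Rightarrow> real) \<Rightarrow> (real ell2 \<Rightarrow>\<^sub>L real ell2) set" where
  "gens t = munits \<union> gen t ` \<Lambda>"

definition Alg :: "(nat \<Rightarrow> real) \<Rightarrow> (real ell2 \<Rightarrow>\<^sub>L real ell2) set" where
  "Alg t = closed_span (gens t)"

lemma dot_dir [simp]: "dot (dir t \<kappa>) (dir t \<kappa>) = 1"
  by (simp add: dir_def dot_dirv)

lemma norm_w: "norm (w t \<kappa> k) = 1"
  using norm_bvec[of k "snd \<kappa>" "dir t \<kappa>"] norm_ge_zero[of "w t \<kappa> k"]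
  unfolding w_def dot_dir power2_eq_1_iff by linarith

lemma is_adjoint_gen: "is_adjoint (gen t \<kappa>) (gen t \<kappa>)"
  by (simp add: gen_def is_adjoint_blk)

lemma gen_idem: "gen t \<kappa> o\<^sub>L gen t \<kappa> = gen t \<kappa>"
  by (simp add: gen_def blk_compose scale_op_simps)

lemma norm_gen_le: "norm (gen t \<kappa>) \<le> 1"
  by (simp add: gen_def norm_blk_projection)

lemma gen_w: "k \<in> A (fst \<kappa>) \<Longrightarrow> blinfun_apply (gen t \<kappa>) (w t \<kappa> k) = w t \<kappa> k"
  by (simp add: gen_def w_def blk_bvec)

lemma gen_compose_gen:
  assumes "\<kappa> \<in> \<Lambda>" "\<mu> \<in> \<Lambda>" "\<kappa> \<noteq> \<mu>"
  shows "gen t \<kappa> o\<^sub>L gen t \<mu> \<in> Kop"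
proof (cases "snd \<kappa> = snd \<mu>")
  case True
  then have "fst \<kappa> \<noteq> fst \<mu>"
    using assms(3) by (simp add: prod_eq_iff)
  then have "finite (A (fst \<kappa>) \<inter> A (fst \<mu>))"
    using assms almost_disjoint by (auto simp: \<Lambda>_def)
  then show ?thesis
    by (simp add: gen_def blk_compose Kop_blk_finite Kop_simps)
qed (simp add: gen_def blk_compose Kop_simps)

lemma Kop_subset_Alg: "Kop \<subseteq> Alg t"
  unfolding Kop_def Alg_def by (rule closed_span_mono) (simp add: gens_def)

lemma gen_in_Alg: "\<kappa> \<in> \<Lambda> \<Longrightarrow> gen t \<kappa> \<in> Alg t"
  unfolding Alg_def by (rule closed_span_base) (simp add: gens_def)

lemma gens_munit_Kop: "g \<in> gens t \<Longrightarrow> h \<in> munits \<Longrightarrow> g o\<^sub>L h \<in> Kop"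
  "g \<in> gens t \<Longrightarrow> h \<in> munits \<Longrightarrow> h o\<^sub>L g \<in> Kop"
  by (auto simp: gens_def munits_def gen_def munit_compose_munit blk_compose_munit munit_compose_blk)

lemma cstar_Alg: "cstar_algebra (Alg t)"
  unfolding Alg_def
proof (rule cstar_algebra_closed_span)
  show "\<exists>h\<in>closed_span (gens t). is_adjoint g h" if "g \<in> gens t" for g
    using that unfolding gens_def munits_def
  proof (elim UnE imageE)
    fix \<kappa> assume "g = gen t \<kappa>" "\<kappa> \<in> \<Lambda>"
    then show "\<exists>h\<in>closed_span ({rank1 (ket (pt p)) (ket (pt q)) |p q. True} \<union> gen t ` \<Lambda>). is_adjoint g h"
      using is_adjoint_gen[of t \<kappa>] by (intro bexI[of _ g]) (simp_all add: closed_span_base)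
  next
    assume "g \<in> {rank1 (ket (pt p)) (ket (pt q)) |p q. True}"
    then show "\<exists>h\<in>closed_span ({rank1 (ket (pt p)) (ket (pt q)) |p q. True} \<union> gen t ` \<Lambda>). is_adjoint g h"
      using is_adjoint_rank1 by (blast intro: closed_span_base)
  qed
  show "g o\<^sub>L h \<in> closed_span (gens t)" if g: "g \<in> gens t" and h: "h \<in> gens t" for g h
  proof -
    have K: "x \<in> closed_span (gens t)" if "x \<in> Kop" for x
      using that Kop_subset_Alg by (auto simp: Alg_def)
    show ?thesis
    proof (cases "g \<in> munits \<or> h \<in> munits")
      case True
      then show ?thesis
        using gens_munit_Kop g h K by blast
    next
      case False
      then obtain \<kappa> \<mu> where gh: "g = gen t \<kappa>" "\<kappa> \<in> \<Lambda>" "h = gen t \<mu>" "\<mu> \<in> \<Lambda>"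
        using g h by (auto simp: gens_def)
      then show ?thesis
        using gen_compose_gen[of \<kappa> \<mu> t] gen_idem K gen_in_Alg[of \<kappa> t]
        by (cases "\<kappa> = \<mu>") (auto simp: Alg_def)
    qed
  qed
qed

lemmas AlgD = cstar_algebraD[OF cstar_Alg] cstar_algebra_diff[OF cstar_Alg]

lemma Kop_ideal:
  assumes "a \<in> Alg t" "k \<in> Kop"
  shows "a o\<^sub>L k \<in> Kop" "k o\<^sub>L a \<in> Kop"
proof -
  have cl: "clinear_op a" if "a \<in> closed_span (gens t) \<or> a \<in> closed_span munits" for a
    using that AlgD(1)[of a t] Kop_subset_Alg[of t] by (auto simp: Alg_def Kop_def)
  show "a o\<^sub>L k \<in> Kop"
    using assms unfolding Kop_def Alg_def
    by (rule closed_span_compose[rotated 2]) (use gens_munit_Kop cl in \<open>auto simp: Kop_def\<close>)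
  show "k o\<^sub>L a \<in> Kop"
    using assms(2,1) unfolding Kop_def Alg_def
    by (rule closed_span_compose[rotated 2]) (use gens_munit_Kop cl in \<open>auto simp: Kop_def\<close>)
qed

lemma Alg_not_pt:
  assumes "a \<in> Alg t" "r \<notin> range pt"
  shows "ell2_nth (blinfun_apply a x) r = 0"
proof -
  have "a \<in> {a. ell2_nth (blinfun_apply a x) r = 0}"
    using assms(1) unfolding Alg_def
  proof (rule closed_span_minimal)
    show "closed {a. ell2_nth (blinfun_apply a x) r = 0}"
    proof -
      have "closed {a. cinner (blinfun_apply a x) (ket r) = 0}"
        by (rule closed_Collect_eq)
           (auto intro!: continuous_intros bounded_linear.continuous_on[OF bounded_linear_cinner_left])
      then show ?thesis
        by (simp add: cinner_ket)
    qed
    show "g \<in> {a. ell2_nth (blinfun_apply a x) r = 0}" if "g \<in> gens t" for g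
      using that assms(2) by (auto simp: gens_def munits_def gen_def ell2_nth_blk_not_pt ell2_nth_ket)
  qed (auto simp: plus_blinfun.rep_eq)
  then show ?thesis
    by simp
qed

lemma Alg_ket_not_pt:
  assumes "a \<in> Alg t" "r \<notin> range pt"
  shows "blinfun_apply a (ket r) = 0"
proof (rule ell2_eqI)
  fix j
  obtain b where b: "b \<in> Alg t" "is_adjoint a b"
    using AlgD(7)[OF assms(1)] by blast
  have "ell2_nth (blinfun_apply a (ket r)) j = cinner (ket r) (blinfun_apply b (ket j))"
    using b(2) by (simp add: is_adjoint_def cinner_ket[symmetric])
  also have "\<dots> = 0"
    using Alg_not_pt[OF b(1) assms(2)] by (simp add: cinner_ket_left)
  finally show "ell2_nth (blinfun_apply a (ket r)) j = ell2_nth 0 j"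
    by simp
qed

section \<open>Characters\<close>

text \<open>The filter of \<open>k \<rightarrow> \<infinity>\<close> within the set that belongs to \<open>\<kappa>\<close>.\<close>

definition along :: "'s \<times> nat \<Rightarrow> nat filter" where
  "along \<kappa> = inf_class.inf sequentially (principal (A (fst \<kappa>)))"

lemma along_nonbot: "\<kappa> \<in> \<Lambda> \<Longrightarrow> along \<kappa> \<noteq> bot"
proof
  assume \<kappa>: "\<kappa> \<in> \<Lambda>" and "along \<kappa> = bot"
  then have "eventually (\<lambda>_. False) (along \<kappa>)"
    by simp
  then obtain N where "\<And>k. k \<ge> N \<Longrightarrow> k \<notin> A (fst \<kappa>)"
    by (auto simp: along_def eventually_inf_principal eventually_sequentially)
  then have "A (fst \<kappa>) \<subseteq> {..<N}"
    by (meson lessThan_iff not_less subsetI)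
  then show False
    using inf[OF fst_\<Lambda>[OF \<kappa>]] finite_subset[OF _ finite_lessThan] by blast
qed

lemma eventually_along: "eventually (\<lambda>k. k \<in> A (fst \<kappa>)) (along \<kappa>)"
  by (simp add: along_def eventually_inf_principal)

lemma eventually_along_ge: "eventually (\<lambda>k. k \<ge> n) (along \<kappa>)"
  by (auto simp: along_def eventually_inf_principal eventually_sequentially)

lemma eventually_along_notin_finite:
  assumes "finite (A (fst \<kappa>) \<inter> B)"
  shows "eventually (\<lambda>k. k \<notin> B) (along \<kappa>)"
proof -
  obtain n where n: "\<And>k. k \<in> A (fst \<kappa>) \<inter> B \<Longrightarrow> k < n"
    using assms finite_nat_set_iff_bounded by auto
  show ?thesis
    using eventually_along[of \<kappa>] eventually_along_ge[of n \<kappa>]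
  proof eventually_elim
    case (elim k)
    then show ?case
      using n[of k] by auto
  qed
qed

text \<open>Modulo the compact operators the algebra is \<open>c\<^sub>0(\<Lambda>)\<close>, and the character at \<open>\<kappa>\<close> is the asymptotic
  eigenvalue \<open>c\<close> of \<open>a\<close> on the vectors \<open>w t \<kappa> k\<close>. As a relation between \<open>a\<close> and \<open>c\<close> it is visibly
  linear, multiplicative and norm decreasing; existence of \<open>c\<close> then follows from the generators.\<close>

definition chi_rel :: "(nat \<Rightarrow> real) \<Rightarrow> 's \<times> nat \<Rightarrow> (real ell2 \<Rightarrow>\<^sub>L real ell2) \<Rightarrow> complex \<Rightarrow> bool" where
  "chi_rel t \<kappa> a c \<longleftrightarrow> ((\<lambda>k. blinfun_apply a (w t \<kappa> k) - c *\<^sub>C w t \<kappa> k) \<longlongrightarrow> 0) (along \<kappa>)"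

lemma chi_rel_eventually:
  assumes "eventually (\<lambda>k. blinfun_apply a (w t \<kappa> k) = c *\<^sub>C w t \<kappa> k) (along \<kappa>)"
  shows "chi_rel t \<kappa> a c"
  unfolding chi_rel_def by (rule tendsto_eventually) (use assms in eventually_elim, simp)

lemma chi_rel_add:
  assumes "chi_rel t \<kappa> a c" "chi_rel t \<kappa> b d"
  shows "chi_rel t \<kappa> (a + b) (c + d)"
  using tendsto_add[OF assms[unfolded chi_rel_def]]
  by (simp add: chi_rel_def plus_blinfun.rep_eq scaleC_add_left algebra_simps)

lemma chi_rel_scale:
  assumes "chi_rel t \<kappa> a c"
  shows "chi_rel t \<kappa> (scale_op d a) (d * c)"
proof -
  have "((\<lambda>k. d *\<^sub>C (blinfun_apply a (w t \<kappa> k) - c *\<^sub>C w t \<kappa> k)) \<longlongrightarrow> d *\<^sub>C 0) (along \<kappa>)"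
    by (rule bounded_linear.tendsto[OF bounded_linear_scaleC assms[unfolded chi_rel_def]])
  moreover have "d *\<^sub>C (x - y) = d *\<^sub>C x - d *\<^sub>C y" for x y :: "real ell2"
    using scaleC_add_right[of d "x - y" y] by simp
  ultimately show ?thesis
    by (simp add: chi_rel_def scaleC_scaleC)
qed

lemma chi_rel_compose:
  assumes a: "chi_rel t \<kappa> a c" and b: "chi_rel t \<kappa> b d" and "clinear_op a"
  shows "chi_rel t \<kappa> (a o\<^sub>L b) (c * d)"
proof -
  have "((\<lambda>k. blinfun_apply a (blinfun_apply b (w t \<kappa> k) - d *\<^sub>C w t \<kappa> k)) \<longlongrightarrow> blinfun_apply a 0) (along \<kappa>)"
    using b by (intro blinfun.tendsto tendsto_const) (simp add: chi_rel_def)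
  moreover have "((\<lambda>k. d *\<^sub>C (blinfun_apply a (w t \<kappa> k) - c *\<^sub>C w t \<kappa> k)) \<longlongrightarrow> d *\<^sub>C 0) (along \<kappa>)"
    by (rule bounded_linear.tendsto[OF bounded_linear_scaleC a[unfolded chi_rel_def]])
  ultimately have "((\<lambda>k. blinfun_apply a (blinfun_apply b (w t \<kappa> k) - d *\<^sub>C w t \<kappa> k)
      + d *\<^sub>C (blinfun_apply a (w t \<kappa> k) - c *\<^sub>C w t \<kappa> k)) \<longlongrightarrow> blinfun_apply a 0 + d *\<^sub>C 0) (along \<kappa>)"
    by (rule tendsto_add)
  moreover have "d *\<^sub>C (x - y) = d *\<^sub>C x - d *\<^sub>C y" for x y :: "real ell2"
    using scaleC_add_right[of d "x - y" y] by simp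
  ultimately show ?thesis
    using \<open>clinear_op a\<close>
    by (simp add: chi_rel_def blinfun.diff_right clinear_op_def scaleC_scaleC mult.commute)
qed

lemma chi_rel_le_norm:
  assumes "chi_rel t \<kappa> a c" "\<kappa> \<in> \<Lambda>"
  shows "cmod c \<le> norm a"
proof (rule field_le_epsilon)
  fix e :: real assume "e > 0"
  have "eventually (\<lambda>k. dist (blinfun_apply a (w t \<kappa> k) - c *\<^sub>C w t \<kappa> k) 0 < e) (along \<kappa>)"
    using assms(1) \<open>e > 0\<close> unfolding chi_rel_def by (rule tendstoD)
  then obtain k where "norm (blinfun_apply a (w t \<kappa> k) - c *\<^sub>C w t \<kappa> k) < e"
    using eventually_happens'[OF along_nonbot[OF assms(2)]] by fastforce
  moreover have "norm (blinfun_apply a (w t \<kappa> k)) \<le> norm a"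
    using norm_blinfun[of a "w t \<kappa> k"] by (simp add: norm_w)
  moreover have "norm (c *\<^sub>C w t \<kappa> k) = cmod c"
    by (simp add: norm_scaleC norm_w)
  ultimately show "cmod c \<le> norm a + e"
    using norm_triangle_ineq2[of "c *\<^sub>C w t \<kappa> k" "blinfun_apply a (w t \<kappa> k)"]
    by (simp add: norm_minus_commute)
qed

lemma chi_rel_diff:
  assumes "chi_rel t \<kappa> a c" "chi_rel t \<kappa> b d"
  shows "chi_rel t \<kappa> (a - b) (c - d)"
  using chi_rel_add[OF assms(1) chi_rel_scale[OF assms(2), of "-1"]] by (simp add: scale_op_simps)

lemma chi_rel_0: "chi_rel t \<kappa> 0 0"
  by (simp add: chi_rel_def)

lemma chi_rel_unique:
  assumes "chi_rel t \<kappa> a c" "chi_rel t \<kappa> a d" "\<kappa> \<in> \<Lambda>"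
  shows "c = d"
  using chi_rel_le_norm[OF chi_rel_diff[OF assms(1,2)] assms(3)] by simp

lemma chi_rel_limit:
  assumes "\<And>n. chi_rel t \<kappa> (f n) (c n)" "f \<longlonglongrightarrow> a" "\<kappa> \<in> \<Lambda>"
  obtains d where "chi_rel t \<kappa> a d" "c \<longlonglongrightarrow> d"
proof -
  have le: "dist (c m) (c n) \<le> dist (f m) (f n)" for m n
    using chi_rel_le_norm[OF chi_rel_diff[OF assms(1)[of m] assms(1)[of n]] assms(3)] by (simp add: dist_norm)
  have "Cauchy c"
    unfolding Cauchy_def
  proof (intro allI impI)
    fix e :: real assume "e > 0"
    then obtain M where "\<And>m n. m \<ge> M \<Longrightarrow> n \<ge> M \<Longrightarrow> dist (f m) (f n) < e"
      using LIMSEQ_imp_Cauchy[OF assms(2)] unfolding Cauchy_def by blast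
    then show "\<exists>M. \<forall>m\<ge>M. \<forall>n\<ge>M. dist (c m) (c n) < e"
      using le le_less_trans by blast
  qed
  then obtain d where d: "c \<longlonglongrightarrow> d"
    by (auto simp: Cauchy_convergent_iff convergent_def)
  have "chi_rel t \<kappa> a d"
    unfolding chi_rel_def
  proof (rule tendstoI)
    fix e :: real assume e: "e > 0"
    have "eventually (\<lambda>n. dist (f n) a < e / 3 \<and> dist (c n) d < e / 3) sequentially"
      using tendstoD[OF assms(2), of "e / 3"] tendstoD[OF d, of "e / 3"] e by (auto intro: eventually_conj)
    then obtain n where n: "norm (f n - a) < e / 3" "cmod (c n - d) < e / 3"
      by (auto simp: eventually_sequentially dist_norm)
    have "eventually (\<lambda>k. dist (blinfun_apply (f n) (w t \<kappa> k) - c n *\<^sub>C w t \<kappa> k) 0 < e / 3) (along \<kappa>)"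
      using assms(1)[of n] e unfolding chi_rel_def by (intro tendstoD) auto
    then show "eventually (\<lambda>k. dist (blinfun_apply a (w t \<kappa> k) - d *\<^sub>C w t \<kappa> k) 0 < e) (along \<kappa>)"
    proof eventually_elim
      case (elim k)
      let ?v = "w t \<kappa> k"
      have "norm (blinfun_apply (a - f n) ?v) \<le> norm (f n - a)"
        using norm_blinfun[of "a - f n" ?v] by (simp add: norm_w norm_minus_commute)
      moreover have "norm ((c n - d) *\<^sub>C ?v) = cmod (c n - d)"
        by (simp add: norm_scaleC norm_w)
      moreover have "blinfun_apply a ?v - d *\<^sub>C ?v = blinfun_apply (a - f n) ?v
          + ((c n - d) *\<^sub>C ?v + (blinfun_apply (f n) ?v - c n *\<^sub>C ?v))"
        using scaleC_add_left[of "c n - d" d ?v] by (simp add: minus_blinfun.rep_eq algebra_simps)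
      ultimately have "norm (blinfun_apply a ?v - d *\<^sub>C ?v) < e / 3 + (e / 3 + e / 3)"
        using n elim norm_triangle_ineq[of "blinfun_apply (a - f n) ?v" "(c n - d) *\<^sub>C ?v + (blinfun_apply (f n) ?v - c n *\<^sub>C ?v)"]
          norm_triangle_ineq[of "(c n - d) *\<^sub>C ?v" "blinfun_apply (f n) ?v - c n *\<^sub>C ?v"]
        by simp
      then show ?case
        by simp
    qed
  qed
  then show ?thesis
    using that d by blast
qed

lemma chi_rel_gen:
  assumes "\<kappa> \<in> \<Lambda>" "\<mu> \<in> \<Lambda>"
  shows "chi_rel t \<kappa> (gen t \<mu>) (if \<kappa> = \<mu> then 1 else 0)"
proof (rule chi_rel_eventually)
  show "eventually (\<lambda>k. blinfun_apply (gen t \<mu>) (w t \<kappa> k) = (if \<kappa> = \<mu> then 1 else 0) *\<^sub>C w t \<kappa> k) (along \<kappa>)"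
  proof (cases "\<kappa> = \<mu>")
    case True
    show ?thesis
      using eventually_along[of \<kappa>] by eventually_elim (simp add: True gen_w)
  next
    case False
    show ?thesis
    proof (cases "snd \<kappa> = snd \<mu>")
      case True
      then have "fst \<kappa> \<noteq> fst \<mu>"
        using False by (simp add: prod_eq_iff)
      then have "finite (A (fst \<kappa>) \<inter> A (fst \<mu>))"
        using assms almost_disjoint by (auto simp: \<Lambda>_def)
      from eventually_along_notin_finite[OF this] show ?thesis
        by eventually_elim (simp add: False gen_def w_def blk_bvec)
    qed (simp add: False gen_def w_def blk_bvec)
  qed
qed

lemma chi_rel_Kop: "a \<in> Kop \<Longrightarrow> chi_rel t \<kappa> a 0"
  unfolding chi_rel_def w_def along_def
  using Kop_tendsto_0 by (auto intro: tendsto_mono[OF inf_le1])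

lemma chi_rel_exists:
  assumes "a \<in> Alg t" "\<kappa> \<in> \<Lambda>"
  shows "\<exists>c. chi_rel t \<kappa> a c"
proof -
  let ?D = "{a. \<exists>c. chi_rel t \<kappa> a c}"
  have "a \<in> ?D"
    using assms(1) unfolding Alg_def
  proof (rule closed_span_minimal)
    show "g \<in> ?D" if "g \<in> gens t" for g
    proof (cases "g \<in> munits")
      case True
      then show ?thesis
        using chi_rel_Kop[of g t \<kappa>] closed_span_base[of g munits] unfolding Kop_def by blast
    next
      case False
      then show ?thesis
        using that chi_rel_gen[OF assms(2)] unfolding gens_def by blast
    qed
    show "closed ?D"
      unfolding closed_sequential_limits
    proof (intro allI impI)
      fix f l assume "(\<forall>n. f n \<in> ?D) \<and> f \<longlonglongrightarrow> l"
      then have "\<forall>n. \<exists>c. chi_rel t \<kappa> (f n) c" "f \<longlonglongrightarrow> l"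
        by simp_all
      then obtain c where "\<And>n. chi_rel t \<kappa> (f n) (c n)"
        using choice[of "\<lambda>n c. chi_rel t \<kappa> (f n) c"] by blast
      then show "l \<in> ?D"
        using chi_rel_limit[OF _ \<open>f \<longlonglongrightarrow> l\<close> assms(2)] by blast
    qed
    show "0 \<in> ?D"
      using chi_rel_0 by blast
    show "x + y \<in> ?D"
      if "x \<in> ?D" "y \<in> ?D" for x y
      using that chi_rel_add[of t \<kappa> x _ y] by blast
    show "scale_op d x \<in> ?D"
      if "x \<in> ?D" for d x
      using that chi_rel_scale[of t \<kappa> x] by blast
  qed
  then show ?thesis
    by simp
qed

section \<open>The compact operators are the common kernel of the characters\<close>

text \<open>By the theorem of Pythagoras, \<open>\<parallel>\<Sum> c\<^sub>i g\<^sub>i x\<parallel>\<^sup>2 = \<Sum> |c\<^sub>i|\<^sup>2 \<parallel>g\<^sub>i x\<parallel>\<^sup>2\<close>, and \<open>\<Sum> \<parallel>g\<^sub>i x\<parallel>\<^sup>2 \<le> \<parallel>x\<parallel>\<^sup>2\<close>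
  because \<open>\<Sum> g\<^sub>i\<close> is a projection.\<close>

lemma norm_sum_orthogonal_projections:
  fixes g :: "'b \<Rightarrow> ('h::chilbert \<Rightarrow>\<^sub>L 'h)"
  assumes F: "finite F" and adj: "\<And>i. i \<in> F \<Longrightarrow> is_adjoint (g i) (g i)"
    and idem: "\<And>i. i \<in> F \<Longrightarrow> g i o\<^sub>L g i = g i"
    and orth: "\<And>i j. i \<in> F \<Longrightarrow> j \<in> F \<Longrightarrow> i \<noteq> j \<Longrightarrow> g i o\<^sub>L g j = 0"
    and c: "\<And>i. i \<in> F \<Longrightarrow> cmod (c i) \<le> e" and e: "e \<ge> 0"
  shows "norm (\<Sum>i\<in>F. scale_op (c i) (g i)) \<le> e"
proof (rule norm_blinfun_bound[OF e])
  fix x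
  have pyth: "(norm (\<Sum>i\<in>F. d i *\<^sub>C blinfun_apply (g i) x))\<^sup>2 = (\<Sum>i\<in>F. (cmod (d i))\<^sup>2 * (norm (blinfun_apply (g i) x))\<^sup>2)" for d
  proof -
    have "pairwise (\<lambda>i j. orthogonal (d i *\<^sub>C blinfun_apply (g i) x) (d j *\<^sub>C blinfun_apply (g j) x)) F"
    proof (rule pairwiseI)
      fix i j assume ij: "i \<in> F" "j \<in> F" "i \<noteq> j"
      have "cinner (blinfun_apply (g i) x) (blinfun_apply (g j) x) = cinner x (blinfun_apply (g i o\<^sub>L g j) x)"
        using adj[OF ij(1)] by (simp add: is_adjoint_def)
      then show "orthogonal (d i *\<^sub>C blinfun_apply (g i) x) (d j *\<^sub>C blinfun_apply (g j) x)"
        using orth[OF ij] by (simp add: orthogonal_def inner_eq_Re_cinner cinner_scaleC_left cinner_scaleC_right)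
    qed
    from norm_sum_Pythagorean[OF F this] show ?thesis
      by (simp add: norm_scaleC power_mult_distrib)
  qed
  define S where "S = (\<Sum>i\<in>F. (norm (blinfun_apply (g i) x))\<^sup>2)"
  define y where "y = (\<Sum>i\<in>F. blinfun_apply (g i) x)"
  have S1: "S = (norm y)\<^sup>2"
    using pyth[of "\<lambda>_. 1"] by (simp add: S_def y_def)
  have "complex_of_real S = cinner y x"
  proof -
    have "complex_of_real ((norm (blinfun_apply (g i) x))\<^sup>2) = cinner (blinfun_apply (g i) x) x" if "i \<in> F" for i
    proof -
      have "cinner (blinfun_apply (g i) x) (blinfun_apply (g i) x) = cinner (blinfun_apply (g i o\<^sub>L g i) x) x"
        using adj[OF that] by (simp add: is_adjoint_def)
      then show ?thesis
        by (simp only: cinner_self idem[OF that])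
    qed
    then show ?thesis
      unfolding S_def y_def of_real_sum cinner_sum_left by (intro sum.cong refl)
  qed
  then have "cmod (cinner y x) = \<bar>S\<bar>"
    by (metis norm_of_real)
  then have "(norm y)\<^sup>2 \<le> norm y * norm x"
    using cmod_cinner_le[of y x] S1 by simp
  then have "norm y \<le> norm x"
    by (cases "norm y = 0") (auto simp: power2_eq_square)
  have "(norm (blinfun_apply (\<Sum>i\<in>F. scale_op (c i) (g i)) x))\<^sup>2 = (\<Sum>i\<in>F. (cmod (c i))\<^sup>2 * (norm (blinfun_apply (g i) x))\<^sup>2)"
    by (simp add: blinfun.sum_left pyth)
  also have "\<dots> \<le> (\<Sum>i\<in>F. e\<^sup>2 * (norm (blinfun_apply (g i) x))\<^sup>2)"
    using c by (intro sum_mono mult_right_mono power_mono) auto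
  also have "\<dots> = e\<^sup>2 * (norm y)\<^sup>2"
    by (simp add: sum_distrib_left[symmetric] S1[symmetric] S_def)
  also have "\<dots> \<le> (e * norm x)\<^sup>2"
    using \<open>norm y \<le> norm x\<close> by (simp add: power_mult_distrib mult_left_mono power_mono)
  finally show "norm (blinfun_apply (\<Sum>i\<in>F. scale_op (c i) (g i)) x) \<le> e * norm x"
    by (rule power2_le_imp_le) (simp add: e)
qed

text \<open>Finitely many generators become mutually orthogonal projections after removing the finite set \<open>U\<close>
  of points in which their sets overlap, and this changes them by finite-rank operators.\<close>

lemma dist_Kop_le:
  assumes F: "finite F" "F \<subseteq> \<Lambda>" and c: "\<And>\<kappa>. \<kappa> \<in> F \<Longrightarrow> cmod (c \<kappa>) \<le> e" and e: "e \<ge> 0"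
  shows "\<exists>k\<in>Kop. norm ((\<Sum>\<kappa>\<in>F. scale_op (c \<kappa>) (gen t \<kappa>)) - k) \<le> e"
proof -
  define U where "U = (\<Union>\<kappa>\<in>F. \<Union>\<mu>\<in>{\<mu>\<in>F. fst \<mu> \<noteq> fst \<kappa>}. A (fst \<kappa>) \<inter> A (fst \<mu>))"
  have U: "finite U"
    unfolding U_def
  proof (intro finite_UN_I)
    fix \<kappa> \<mu> assume "\<kappa> \<in> F" "\<mu> \<in> {\<mu> \<in> F. fst \<mu> \<noteq> fst \<kappa>}"
    then show "finite (A (fst \<kappa>) \<inter> A (fst \<mu>))"
      using F(2) by (intro almost_disjoint fst_\<Lambda>) auto
  qed (use F(1) in simp_all)
  define h where "h \<kappa> = blk (A (fst \<kappa>) - U) (snd \<kappa>) (dir t \<kappa>) (dir t \<kappa>)" for \<kappa>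
  have split: "gen t \<kappa> = blk (A (fst \<kappa>) \<inter> U) (snd \<kappa>) (dir t \<kappa>) (dir t \<kappa>) + h \<kappa>" for \<kappa>
  proof -
    have "A (fst \<kappa>) = (A (fst \<kappa>) \<inter> U) \<union> (A (fst \<kappa>) - U)"
      by blast
    then show ?thesis
      unfolding gen_def h_def using blk_Un[of "A (fst \<kappa>) \<inter> U" "A (fst \<kappa>) - U"] by auto
  qed
  have K: "(\<Sum>\<kappa>\<in>F. scale_op (c \<kappa>) (blk (A (fst \<kappa>) \<inter> U) (snd \<kappa>) (dir t \<kappa>) (dir t \<kappa>))) \<in> Kop"
    unfolding Kop_def using U Kop_blk_finite[unfolded Kop_def]
    by (intro closed_span_sum closed_span_scale) auto
  have "norm (\<Sum>\<kappa>\<in>F. scale_op (c \<kappa>) (h \<kappa>)) \<le> e"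
  proof (rule norm_sum_orthogonal_projections[OF F(1) _ _ _ c e])
    show "is_adjoint (h \<kappa>) (h \<kappa>)" "h \<kappa> o\<^sub>L h \<kappa> = h \<kappa>" for \<kappa>
      by (simp_all add: h_def is_adjoint_blk blk_compose scale_op_simps)
    show "h \<kappa> o\<^sub>L h \<mu> = 0" if "\<kappa> \<in> F" "\<mu> \<in> F" "\<kappa> \<noteq> \<mu>" for \<kappa> \<mu>
    proof (cases "snd \<kappa> = snd \<mu>")
      case True
      then have "fst \<mu> \<noteq> fst \<kappa>"
        using that(3) by (auto simp: prod_eq_iff)
      have "A (fst \<kappa>) \<inter> A (fst \<mu>) \<subseteq> U"
      proof
        fix k assume "k \<in> A (fst \<kappa>) \<inter> A (fst \<mu>)"
        then show "k \<in> U"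
          unfolding U_def by (intro UN_I[OF that(1)] UN_I[of \<mu>]) (simp_all add: that(2) \<open>fst \<mu> \<noteq> fst \<kappa>\<close>)
      qed
      then have "(A (fst \<kappa>) - U) \<inter> (A (fst \<mu>) - U) = {}"
        by blast
      then show ?thesis
        using True by (simp add: h_def blk_compose blk_empty scale_op_simps)
    qed (simp add: h_def blk_compose)
  qed
  moreover have "(\<Sum>\<kappa>\<in>F. scale_op (c \<kappa>) (gen t \<kappa>))
      - (\<Sum>\<kappa>\<in>F. scale_op (c \<kappa>) (blk (A (fst \<kappa>) \<inter> U) (snd \<kappa>) (dir t \<kappa>) (dir t \<kappa>)))
      = (\<Sum>\<kappa>\<in>F. scale_op (c \<kappa>) (h \<kappa>))"
    by (simp add: split scale_op_simps sum.distrib)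
  ultimately show ?thesis
    by (intro bexI[OF _ K]) (simp only:)
qed

lemma cspan_gens_form:
  assumes "b \<in> cspan (gens t)"
  shows "\<exists>F c k. finite F \<and> F \<subseteq> \<Lambda> \<and> k \<in> Kop \<and> b = k + (\<Sum>\<kappa>\<in>F. scale_op (c \<kappa>) (gen t \<kappa>))"
  using assms
proof (induction rule: cspan_induct)
  case zero
  then show ?case
    by (intro exI[of _ "{}"] exI[of _ 0]) (auto simp: Kop_simps)
next
  case (add d g a)
  then obtain F c k where a: "finite F" "F \<subseteq> \<Lambda>" "k \<in> Kop" "a = k + (\<Sum>\<kappa>\<in>F. scale_op (c \<kappa>) (gen t \<kappa>))"
    by blast
  consider "g \<in> munits" | \<mu> where "\<mu> \<in> \<Lambda>" "g = gen t \<mu>"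
    using add.hyps(1) by (auto simp: gens_def)
  then show ?case
  proof cases
    case 1
    then have "scale_op d g + k \<in> Kop"
      using closed_span_base[of g munits] a(3) by (auto simp: Kop_def intro: closed_span_add closed_span_scale)
    then show ?thesis
      using a by (intro exI[of _ F] exI[of _ c] exI[of _ "scale_op d g + k"]) auto
  next
    case 2
    define c' where "c' \<kappa> = (if \<kappa> \<in> F then c \<kappa> else 0) + (if \<kappa> = \<mu> then d else 0)" for \<kappa>
    have "(\<Sum>\<kappa>\<in>insert \<mu> F. scale_op (c' \<kappa>) (gen t \<kappa>))
        = (\<Sum>\<kappa>\<in>insert \<mu> F. scale_op (if \<kappa> \<in> F then c \<kappa> else 0) (gen t \<kappa>))
          + (\<Sum>\<kappa>\<in>insert \<mu> F. scale_op (if \<kappa> = \<mu> then d else 0) (gen t \<kappa>))"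
      by (simp add: c'_def scale_op_simps(7) sum.distrib del: sum.insert)
    also have "(\<Sum>\<kappa>\<in>insert \<mu> F. scale_op (if \<kappa> \<in> F then c \<kappa> else 0) (gen t \<kappa>)) = (\<Sum>\<kappa>\<in>F. scale_op (c \<kappa>) (gen t \<kappa>))"
      using a(1) by (intro sum.mono_neutral_cong_right) (auto simp: scale_op_simps)
    also have "(\<Sum>\<kappa>\<in>insert \<mu> F. scale_op (if \<kappa> = \<mu> then d else 0) (gen t \<kappa>)) = (\<Sum>\<kappa>\<in>{\<mu>}. scale_op d (gen t \<kappa>))"
      using a(1) by (intro sum.mono_neutral_cong_right) (auto simp: scale_op_simps)
    finally have "scale_op d g + a = k + (\<Sum>\<kappa>\<in>insert \<mu> F. scale_op (c' \<kappa>) (gen t \<kappa>))"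
      using a(4) 2 by (simp add: algebra_simps)
    then show ?thesis
      using a 2 by (intro exI[of _ "insert \<mu> F"] exI[of _ c'] exI[of _ k]) auto
  qed
qed

text \<open>Approximate \<open>a\<close> by a compact operator plus a finite combination of generators. The coefficients are
  the values of the characters, hence small, and so the combination is close to the compact
  operators.\<close>

lemma Kop_if_chi_0:
  assumes a: "a \<in> Alg t" and chi: "\<And>\<kappa>. \<kappa> \<in> \<Lambda> \<Longrightarrow> chi_rel t \<kappa> a 0"
  shows "a \<in> Kop"
proof -
  have "a \<in> closure Kop"
    unfolding closure_approachable
  proof (intro allI impI)
    fix e :: real assume "e > 0"
    then obtain b where b: "b \<in> cspan (gens t)" "dist b a < e / 2"
      using a unfolding Alg_def closed_span_def closure_approachable by (meson half_gt_zero)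
    then obtain F c k where bF: "finite F" "F \<subseteq> \<Lambda>" "k \<in> Kop" "b = k + (\<Sum>\<kappa>\<in>F. scale_op (c \<kappa>) (gen t \<kappa>))"
      using cspan_gens_form by metis
    have c: "cmod (c \<kappa>) \<le> e / 2" if "\<kappa> \<in> F" for \<kappa>
    proof -
      have \<kappa>: "\<kappa> \<in> \<Lambda>"
        using that bF by blast
      have sum: "chi_rel t \<kappa> (\<Sum>\<mu>\<in>G. scale_op (c \<mu>) (gen t \<mu>)) (\<Sum>\<mu>\<in>G. c \<mu> * (if \<kappa> = \<mu> then 1 else 0))"
        if "finite G" "G \<subseteq> \<Lambda>" for G
        using that
      proof (induction rule: finite_induct)
        case (insert \<mu> G)
        have "chi_rel t \<kappa> (scale_op (c \<mu>) (gen t \<mu>)) (c \<mu> * (if \<kappa> = \<mu> then 1 else 0))"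
          using insert.prems by (intro chi_rel_scale chi_rel_gen \<kappa>) simp
        then show ?case
          using insert unfolding sum.insert[OF insert.hyps(1,2)] by (intro chi_rel_add) simp_all
      qed (simp add: chi_rel_0)
      have "(\<Sum>\<mu>\<in>F. c \<mu> * (if \<kappa> = \<mu> then 1 else 0)) = c \<kappa>"
        using bF(1) that by (simp add: if_distrib cong: if_cong)
      then have "chi_rel t \<kappa> b (0 + c \<kappa>)"
        unfolding bF(4) using chi_rel_add[OF chi_rel_Kop[OF bF(3)] sum[OF bF(1,2)]] by simp
      from chi_rel_le_norm[OF chi_rel_diff[OF this chi[OF \<kappa>]] \<kappa>] show ?thesis
        using b(2) by (simp add: dist_norm)
    qed
    have "e / 2 \<ge> 0"
      using \<open>e > 0\<close> by simp
    from dist_Kop_le[where c = c and t = t, OF bF(1,2) c this] obtain k' where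
      k': "k' \<in> Kop" "norm ((\<Sum>\<kappa>\<in>F. scale_op (c \<kappa>) (gen t \<kappa>)) - k') \<le> e / 2"
      by blast
    have "dist (k + k') b \<le> e / 2"
      using k'(2) by (simp add: bF(4) dist_norm norm_minus_commute)
    then have "dist (k + k') a < e"
      using b(2) dist_triangle[of "k + k'" a b] by simp
    then show "\<exists>y\<in>Kop. dist y a < e"
      using k'(1) bF(3) Kop_simps(2) by blast
  qed
  then show ?thesis
    by (simp add: Kop_def closure_closed closed_closed_span)
qed

end

lemma munit_corner:
  assumes "clinear_op a"
  shows "rank1 x x o\<^sub>L (a o\<^sub>L rank1 x x) = scale_op (cinner (blinfun_apply a x) x) (rank1 x x)"
  by (simp add: compose_rank1 assms is_adjoint_clinear[OF is_adjoint_rank1] rank1_linear)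

context luzin
begin

section \<open>*-isomorphisms preserve the compact operators\<close>

text \<open>If \<open>y = q e\<^sub>p \<noteq> 0\<close> then \<open>q |e\<^sub>p\<rangle>\<langle>e\<^sub>p| q = |y\<rangle>\<langle>y|\<close> is a nonzero multiple of \<open>q\<close>, so \<open>q\<close> has rank
  one. The compressions of the algebra by \<open>|e\<^sub>p\<rangle>\<langle>e\<^sub>p|\<close> are one-dimensional as well, and this is an
  algebraic property.\<close>

lemma minimal_in_Kop:
  assumes q: "q \<in> Alg t" "is_adjoint q q" "q \<noteq> 0"
    and min: "\<And>a. a \<in> Alg t \<Longrightarrow> \<exists>c. q o\<^sub>L (a o\<^sub>L q) = scale_op c q"
  shows "q \<in> Kop"
proof -
  have "\<exists>p. blinfun_apply q (ket (pt p)) \<noteq> 0"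
  proof (rule ccontr)
    assume no: "\<not> (\<exists>p. blinfun_apply q (ket (pt p)) \<noteq> 0)"
    have "blinfun_apply q (ket i) = 0" for i
      using no Alg_ket_not_pt[OF q(1), of i] by (cases "i \<in> range pt") (auto simp del: split_paired_Ex split_paired_All)
    then show False
      using operator_eq_0_if_matrix_0[OF q(2)] q(3) by simp
  qed
  then obtain p where p: "blinfun_apply q (ket (pt p)) \<noteq> 0"
    by blast
  define y where "y = blinfun_apply q (ket (pt p))"
  have y: "q o\<^sub>L (rank1 (ket (pt p)) (ket (pt p)) o\<^sub>L q) = rank1 y y"
    by (simp add: rank1_compose[OF q(2)] compose_rank1[OF is_adjoint_clinear[OF q(2)]] y_def)
  have K: "rank1 y y \<in> Kop"
    unfolding y[symmetric] by (intro Kop_ideal[OF q(1)] Kop_unit)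
  have "\<exists>c. rank1 y y = scale_op c q"
    unfolding y[symmetric] by (intro min subsetD[OF Kop_subset_Alg] Kop_unit)
  then obtain c where c: "rank1 y y = scale_op c q"
    by blast
  have "rank1 y y \<noteq> 0"
    using p by (simp add: rank1_self_eq_0_iff y_def)
  then have "c \<noteq> 0"
    using c by (auto simp: scale_op_simps)
  then have "q = scale_op (inverse c) (rank1 y y)"
    by (simp add: c scale_op_simps)
  then show ?thesis
    using Kop_simps(3)[OF K] by simp
qed

lemma star_isomorphism_Kop:
  assumes iso: "star_isomorphism (Alg t) (Alg t') \<phi>" and k: "k \<in> Kop"
  shows "\<phi> k \<in> Kop"
proof -
  let ?D = "{k \<in> Kop. \<phi> k \<in> Kop}"
  note \<phi> = star_isomorphismD[OF iso]
  have KA: "x \<in> Kop \<Longrightarrow> x \<in> Alg t" for x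
    using Kop_subset_Alg by blast
  have inj: "\<phi> x = \<phi> y \<Longrightarrow> x \<in> Alg t \<Longrightarrow> y \<in> Alg t \<Longrightarrow> x = y" for x y
    using \<phi>(1) by (auto simp: bij_betw_def inj_on_def)
  have \<phi>0: "\<phi> 0 = 0"
    using \<phi>(4)[OF AlgD(2), of 0] by (simp add: scale_op_simps)
  have diag: "\<phi> (rank1 (ket (pt p)) (ket (pt p))) \<in> Kop" for p
  proof (rule minimal_in_Kop)
    let ?e = "rank1 (ket (pt p)) (ket (pt p))"
    have e: "?e \<in> Alg t"
      by (intro KA Kop_unit)
    show "\<phi> ?e \<in> Alg t'" "is_adjoint (\<phi> ?e) (\<phi> ?e)"
      using \<phi>(2)[OF e] \<phi>(6)[OF e e is_adjoint_rank1] by auto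
    have "ket (pt p) \<noteq> 0"
      using ell2_nth_ket[of "pt p" "pt p"] by auto
    then have "?e \<noteq> 0"
      by (simp add: rank1_self_eq_0_iff)
    then show "\<phi> ?e \<noteq> 0"
      using inj[of ?e 0] e AlgD(2) \<phi>0 by auto
    fix b assume "b \<in> Alg t'"
    then obtain a where a: "a \<in> Alg t" "b = \<phi> a"
      using \<phi>(1) by (auto simp: bij_betw_def)
    obtain c where "?e o\<^sub>L (a o\<^sub>L ?e) = scale_op c ?e"
      using munit_corner[OF AlgD(1)[OF a(1)]] by blast
    then have "\<phi> (?e o\<^sub>L (a o\<^sub>L ?e)) = scale_op c (\<phi> ?e)"
      using \<phi>(4)[OF e] by simp
    then show "\<exists>c. \<phi> ?e o\<^sub>L (b o\<^sub>L \<phi> ?e) = scale_op c (\<phi> ?e)"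
      using \<phi>(5) a e AlgD(6) by auto
  qed
  have "k \<in> ?D"
    using k[unfolded Kop_def]
  proof (rule closed_span_minimal)
    show "g \<in> ?D" if g: "g \<in> munits" for g
    proof -
      obtain p q where g: "g = rank1 (ket (pt p)) (ket (pt q))"
        using g unfolding munits_def by blast
      let ?e = "rank1 (ket (pt p)) (ket (pt p))"
      have gK: "g \<in> Kop"
        unfolding g by (rule Kop_unit)
      have "?e o\<^sub>L g = g"
        unfolding g compose_rank1[OF is_adjoint_clinear[OF is_adjoint_rank1]] by (simp add: cinner_ket ell2_nth_ket)
      then have "\<phi> g = \<phi> ?e o\<^sub>L \<phi> g"
        using \<phi>(5)[OF KA[OF Kop_unit] KA[OF gK], of p p] by simp
      also have "\<dots> \<in> Kop"
        by (intro Kop_ideal(2)[of _ t'] \<phi>(2) KA gK diag)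
      finally show ?thesis
        using gK by simp
    qed
    show "closed ?D"
      unfolding closed_sequential_limits
    proof (intro allI impI)
      fix f l assume f: "(\<forall>n. f n \<in> ?D) \<and> f \<longlonglongrightarrow> l"
      have closed: "closed Kop"
        by (simp add: Kop_def closed_closed_span)
      have l: "l \<in> Kop"
        using closed_sequentially[OF closed, of f l] f by simp
      have "(\<lambda>n. \<phi> (f n)) \<longlonglongrightarrow> \<phi> l"
      proof (rule Lim_transform_bound[where g = "\<lambda>n. f n - l" and f = "\<lambda>n. \<phi> (f n) - \<phi> l", THEN LIM_zero_cancel])
        show "\<forall>\<^sub>F n in sequentially. norm (\<phi> (f n) - \<phi> l) \<le> norm (f n - l)"
        proof (rule always_eventually, rule allI)
          fix n
          have "f n \<in> Alg t" "l \<in> Alg t"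
            using f l KA by auto
          then show "norm (\<phi> (f n) - \<phi> l) \<le> norm (f n - l)"
            using star_isomorphism_contractive[OF cstar_Alg cstar_Alg iso, of "f n - l"]
              star_isomorphism_diff[OF cstar_Alg iso, of "f n" l] AlgD(8) by simp
        qed
        show "(\<lambda>n. f n - l) \<longlonglongrightarrow> 0"
          using f by (simp add: LIM_zero)
      qed
      then have "\<phi> l \<in> Kop"
        using closed_sequentially[OF closed, of "\<lambda>n. \<phi> (f n)" "\<phi> l"] f by simp
      then show "l \<in> ?D"
        using l by simp
    qed
  qed (use Kop_simps \<phi>0 \<phi>(3,4) KA in auto)
  then show ?thesis
    by simp
qed

section \<open>Generators modulo the compact operators\<close>

text \<open>The image \<open>p\<close> of a generator is a projection outside the compact operators, so some character takes
  the value \<open>1\<close> at \<open>p\<close>. Modulo compact operators \<open>p\<close> is minimal, that is, \<open>p a p\<close> is a multiple of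
  \<open>p\<close>; hence all other characters vanish at \<open>p\<close>.\<close>

lemma star_isomorphism_gen:
  assumes iso: "star_isomorphism (Alg t) (Alg t') \<phi>" and \<kappa>: "\<kappa> \<in> \<Lambda>"
  shows "\<exists>\<mu>\<in>\<Lambda>. \<phi> (gen t \<kappa>) - gen t' \<mu> \<in> Kop"
proof -
  note \<phi> = star_isomorphismD[OF iso]
  note inv = star_isomorphism_inv[OF cstar_Alg iso]
  let ?\<psi> = "inv_into (Alg t) \<phi>"
  define g where "g = gen t \<kappa>"
  define p where "p = \<phi> g"
  have g: "g \<in> Alg t"
    by (simp add: g_def gen_in_Alg \<kappa>)
  have p: "p \<in> Alg t'"
    by (simp add: p_def \<phi>(2) g)
  have pp: "p o\<^sub>L p = p"
    unfolding p_def \<phi>(5)[OF g g, symmetric] by (simp add: g_def gen_idem)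
  have "p \<notin> Kop"
  proof
    assume "p \<in> Kop"
    then have "?\<psi> p \<in> Kop"
      by (rule star_isomorphism_Kop[OF inv])
    then have "g \<in> Kop"
      using \<phi>(1) g by (simp add: p_def bij_betw_inv_into_left)
    then show False
      using chi_rel_unique[OF chi_rel_Kop chi_rel_gen[OF \<kappa> \<kappa>] \<kappa>] by (auto simp: g_def)
  qed
  then obtain \<mu> where \<mu>: "\<mu> \<in> \<Lambda>" "\<not> chi_rel t' \<mu> p 0"
    using Kop_if_chi_0[OF p] by blast
  obtain c where c: "chi_rel t' \<mu> p c"
    using chi_rel_exists[OF p \<mu>(1)] by blast
  have "chi_rel t' \<mu> p (c * c)"
    using chi_rel_compose[OF c c AlgD(1)[OF p]] by (simp add: pp)
  then have "c * c = c"
    using chi_rel_unique c \<mu>(1) by blast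
  moreover have "c \<noteq> 0"
    using c \<mu>(2) by auto
  ultimately have c1: "chi_rel t' \<mu> p 1"
    using c by simp
  define a where "a = ?\<psi> (gen t' \<mu>)"
  have a: "a \<in> Alg t" "\<phi> a = gen t' \<mu>"
    using star_isomorphismD(2)[OF inv gen_in_Alg[OF \<mu>(1)]] \<phi>(1) gen_in_Alg[OF \<mu>(1)]
    by (auto simp: a_def bij_betw_inv_into_right)
  obtain c0 where c0: "chi_rel t \<kappa> a c0"
    using chi_rel_exists[OF a(1) \<kappa>] by blast
  have in1: "g o\<^sub>L (a o\<^sub>L g) \<in> Alg t" "scale_op c0 g \<in> Alg t"
    using a g AlgD(4,6) by auto
  have "(g o\<^sub>L (a o\<^sub>L g)) - scale_op c0 g \<in> Kop"
  proof (rule Kop_if_chi_0)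
    show "(g o\<^sub>L (a o\<^sub>L g)) - scale_op c0 g \<in> Alg t"
      using cstar_algebra_diff[OF cstar_Alg in1] .
    fix \<nu> assume \<nu>: "\<nu> \<in> \<Lambda>"
    let ?d = "if \<nu> = \<kappa> then 1 else 0 :: complex"
    obtain d where d: "chi_rel t \<nu> a d"
      using chi_rel_exists[OF a(1) \<nu>] by blast
    have gd: "chi_rel t \<nu> g ?d"
      unfolding g_def by (rule chi_rel_gen[OF \<nu> \<kappa>])
    have "chi_rel t \<nu> ((g o\<^sub>L (a o\<^sub>L g)) - scale_op c0 g) (?d * (d * ?d) - c0 * ?d)"
      by (intro chi_rel_diff chi_rel_compose chi_rel_scale gd d AlgD(1)[OF g] AlgD(1)[OF a(1)])
    moreover have "?d * (d * ?d) - c0 * ?d = 0"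
      using chi_rel_unique[OF d _ \<nu>, of c0] c0 by auto
    ultimately show "chi_rel t \<nu> ((g o\<^sub>L (a o\<^sub>L g)) - scale_op c0 g) 0"
      by simp
  qed
  then have "\<phi> ((g o\<^sub>L (a o\<^sub>L g)) - scale_op c0 g) \<in> Kop"
    by (rule star_isomorphism_Kop[OF iso])
  moreover have "\<phi> ((g o\<^sub>L (a o\<^sub>L g)) - scale_op c0 g) = (p o\<^sub>L (gen t' \<mu> o\<^sub>L p)) - scale_op c0 p"
    using star_isomorphism_diff[OF cstar_Alg iso in1] g a AlgD(6)[of _ t] by (simp add: p_def \<phi>(4,5))
  ultimately have corner: "(p o\<^sub>L (gen t' \<mu> o\<^sub>L p)) - scale_op c0 p \<in> Kop"
    by simp
  have chi: "e * ((if \<nu> = \<mu> then 1 else 0) * e) - c0 * e = 0" if \<nu>: "\<nu> \<in> \<Lambda>" "chi_rel t' \<nu> p e" for \<nu> e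
  proof -
    have "chi_rel t' \<nu> ((p o\<^sub>L (gen t' \<mu> o\<^sub>L p)) - scale_op c0 p) (e * ((if \<nu> = \<mu> then 1 else 0) * e) - c0 * e)"
      by (intro chi_rel_diff chi_rel_compose chi_rel_scale \<nu> chi_rel_gen \<mu> AlgD(1)[OF p]
          AlgD(1)[OF gen_in_Alg[OF \<mu>(1), of t']])
    from chi_rel_unique[OF this chi_rel_Kop[OF corner] \<nu>(1)] show ?thesis .
  qed
  have c0_1: "c0 = 1"
    using chi[OF \<mu>(1) c1] by simp
  have "p - gen t' \<mu> \<in> Kop"
  proof (rule Kop_if_chi_0)
    show "p - gen t' \<mu> \<in> Alg t'"
      using cstar_algebra_diff[OF cstar_Alg p gen_in_Alg[OF \<mu>(1)]] .
    fix \<nu> assume \<nu>: "\<nu> \<in> \<Lambda>"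
    obtain d where d: "chi_rel t' \<nu> p d"
      using chi_rel_exists[OF p \<nu>] by blast
    have "chi_rel t' \<nu> (p - gen t' \<mu>) (d - (if \<nu> = \<mu> then 1 else 0))"
      by (intro chi_rel_diff d chi_rel_gen \<nu> \<mu>)
    moreover have "d - (if \<nu> = \<mu> then 1 else 0) = 0"
      using chi[OF \<nu> d] c0_1 chi_rel_unique[OF d _ \<nu>, of 1] c1 by auto
    ultimately show "chi_rel t' \<nu> (p - gen t' \<mu>) 0"
      by simp
  qed
  then show ?thesis
    using \<mu>(1) by (auto simp: p_def g_def)
qed

lemma star_isomorphism_gen_inj:
  assumes iso: "star_isomorphism (Alg t) (Alg t') \<phi>" and \<kappa>: "\<kappa> \<in> \<Lambda>" "\<kappa>' \<in> \<Lambda>"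
    and K: "\<phi> (gen t \<kappa>) - gen t' \<mu> \<in> Kop" "\<phi> (gen t \<kappa>') - gen t' \<mu> \<in> Kop"
  shows "\<kappa> = \<kappa>'"
proof -
  have inA: "gen t \<kappa> \<in> Alg t" "gen t \<kappa>' \<in> Alg t" "gen t \<kappa> - gen t \<kappa>' \<in> Alg t"
    using \<kappa> gen_in_Alg AlgD(8) by auto
  have "\<phi> (gen t \<kappa> - gen t \<kappa>') = (\<phi> (gen t \<kappa>) - gen t' \<mu>) - (\<phi> (gen t \<kappa>') - gen t' \<mu>)"
    using star_isomorphism_diff[OF cstar_Alg iso inA(1,2)] by simp
  also have "\<dots> \<in> Kop"
    using K by (rule Kop_simps(4))
  finally have "inv_into (Alg t) \<phi> (\<phi> (gen t \<kappa> - gen t \<kappa>')) \<in> Kop"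
    by (rule star_isomorphism_Kop[OF star_isomorphism_inv[OF cstar_Alg iso]])
  then have "gen t \<kappa> - gen t \<kappa>' \<in> Kop"
    using star_isomorphismD(1)[OF iso] inA(3) by (simp add: bij_betw_inv_into_left)
  from chi_rel_unique[OF chi_rel_Kop[OF this] chi_rel_diff[OF chi_rel_gen[OF \<kappa>(1,1)] chi_rel_gen[OF \<kappa>]] \<kappa>(1)]
  show ?thesis
    by (auto split: if_splits)
qed

lemma star_isomorphism_gen_inv:
  assumes iso: "star_isomorphism (Alg t) (Alg t') \<phi>" and \<kappa>: "\<kappa> \<in> \<Lambda>" "\<mu> \<in> \<Lambda>"
    and K: "\<phi> (gen t \<kappa>) - gen t' \<mu> \<in> Kop"
  shows "inv_into (Alg t) \<phi> (gen t' \<mu>) - gen t \<kappa> \<in> Kop"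
proof -
  note inv = star_isomorphism_inv[OF cstar_Alg iso]
  let ?\<psi> = "inv_into (Alg t) \<phi>"
  have g: "gen t \<kappa> \<in> Alg t" "gen t' \<mu> \<in> Alg t'" "\<phi> (gen t \<kappa>) \<in> Alg t'"
    using \<kappa> gen_in_Alg star_isomorphismD(2)[OF iso] by auto
  have "?\<psi> (\<phi> (gen t \<kappa>) - gen t' \<mu>) = gen t \<kappa> - ?\<psi> (gen t' \<mu>)"
    using star_isomorphism_diff[OF cstar_Alg inv g(3,2)] star_isomorphismD(1)[OF iso] g(1)
    by (simp add: bij_betw_inv_into_left)
  then have "gen t \<kappa> - ?\<psi> (gen t' \<mu>) \<in> Kop"
    using star_isomorphism_Kop[OF inv K] by simp
  then have "scale_op (-1) (gen t \<kappa> - ?\<psi> (gen t' \<mu>)) \<in> Kop"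
    by (rule Kop_simps(3))
  then show ?thesis
    by (simp add: scale_op_simps)
qed

section \<open>Angles are invariants\<close>

text \<open>By separability of the compact operators the differences \<open>\<phi> (gen t (\<alpha> i)) - gen t' (\<beta> i)\<close> are
  within \<open>e\<close> of a single compact operator for uncountably many \<open>i \<in> I1\<close>, and likewise for \<open>I2\<close>. For
  large \<open>k\<close> these compact operators are negligible at \<open>e\<^sub>k \<otimes> e\<^sub>m \<otimes> u\<close> and \<open>e\<^sub>k \<otimes> e\<^sub>m \<otimes> v\<close>. The Luzin
  property yields \<open>i\<close>, \<open>j\<close> and a large \<open>k\<close> in both sets, so that these two vectors are almost fixed
  by \<open>\<phi> (gen t (\<alpha> i))\<close> and \<open>\<phi> (gen t (\<alpha> j))\<close>, whose product has norm at most \<open>B\<close>.\<close>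

lemma angle_le:
  assumes iso: "star_isomorphism (Alg t) (Alg t') \<phi>"
    and I: "uncountable I1" "uncountable I2" "inj_on \<beta> I1" "inj_on \<beta> I2"
    and \<alpha>\<beta>: "\<And>i. i \<in> I1 \<union> I2 \<Longrightarrow> \<alpha> i \<in> \<Lambda> \<and> \<beta> i \<in> \<Lambda> \<and> \<phi> (gen t (\<alpha> i)) - gen t' (\<beta> i) \<in> Kop"
    and I1: "\<And>i. i \<in> I1 \<Longrightarrow> snd (\<beta> i) = m \<and> dir t' (\<beta> i) = u"
    and I2: "\<And>i. i \<in> I2 \<Longrightarrow> snd (\<beta> i) = m \<and> dir t' (\<beta> i) = v"
    and B: "\<And>i j. i \<in> I1 \<Longrightarrow> j \<in> I2 \<Longrightarrow> norm (gen t (\<alpha> i) o\<^sub>L gen t (\<alpha> j)) \<le> B"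
  shows "\<bar>dot u v\<bar> \<le> B"
proof (rule field_le_epsilon)
  fix e' :: real assume "e' > 0"
  \<comment> \<open>The two unit vectors are moved by at most \<open>2 * e\<close> each.\<close>
  define e where "e = e' / 4"
  have e: "e > 0"
    using \<open>e' > 0\<close> by (simp add: e_def)
  note \<phi> = star_isomorphismD[OF iso]
  obtain Q where Q: "countable Q" "\<And>a e. a \<in> Kop \<Longrightarrow> e > 0 \<Longrightarrow> \<exists>q\<in>Q. norm (a - q) < e" "Q \<subseteq> Kop"
    using closed_span_separable[OF countable_munits] cspan_subset_closed_span unfolding Kop_def
    by (metis subset_trans)
  define q where "q i = (SOME q. q \<in> Q \<and> norm (\<phi> (gen t (\<alpha> i)) - gen t' (\<beta> i) - q) < e)" for i
  have q: "q i \<in> Q \<and> norm (\<phi> (gen t (\<alpha> i)) - gen t' (\<beta> i) - q i) < e" if "i \<in> I1 \<union> I2" for i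
    unfolding q_def by (rule someI_ex) (use Q(2)[OF _ e] \<alpha>\<beta>[OF that] in blast)
  obtain q1 where q1: "q1 \<in> Q" "uncountable {i \<in> I1. q i = q1}"
    by (rule uncountable_fiber[OF I(1) _ Q(1), of q]) (use q in auto)
  obtain q2 where q2: "q2 \<in> Q" "uncountable {i \<in> I2. q i = q2}"
    by (rule uncountable_fiber[OF I(2) _ Q(1), of q]) (use q in auto)
  have "q1 \<in> Kop" "q2 \<in> Kop"
    using q1(1) q2(1) Q(3) by auto
  then have "eventually (\<lambda>k. dist (blinfun_apply q1 (bvec k m u)) 0 < e \<and> dist (blinfun_apply q2 (bvec k m v)) 0 < e) sequentially"
    using e by (intro eventually_conj tendstoD[OF Kop_tendsto_0])
  then obtain n where n: "\<And>k. k \<ge> n \<Longrightarrow> norm (blinfun_apply q1 (bvec k m u)) < e"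
      "\<And>k. k \<ge> n \<Longrightarrow> norm (blinfun_apply q2 (bvec k m v)) < e"
    by (auto simp: eventually_sequentially)
  have inj: "inj_on (\<lambda>i. fst (\<beta> i)) I1" "inj_on (\<lambda>i. fst (\<beta> i)) I2"
    using I(3,4) I1 I2 by (auto simp: inj_on_def prod_eq_iff)
  let ?X = "(\<lambda>i. fst (\<beta> i)) ` {i \<in> I1. q i = q1}" and ?Y = "(\<lambda>i. fst (\<beta> i)) ` {i \<in> I2. q i = q2}"
  have "\<exists>x\<in>?X. \<exists>y\<in>?Y. \<exists>k\<ge>n. k \<in> A x \<inter> A y"
  proof (rule luzin)
    show "?X \<subseteq> J1 \<union> J2" "?Y \<subseteq> J1 \<union> J2"
      using \<alpha>\<beta> fst_\<Lambda> by blast+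
    show "uncountable (?X)"
      using q1(2) countable_image_inj_on[of "\<lambda>i. fst (\<beta> i)" "{i \<in> I1. q i = q1}"] inj_on_subset[OF inj(1)] by auto
    show "uncountable (?Y)"
      using q2(2) countable_image_inj_on[of "\<lambda>i. fst (\<beta> i)" "{i \<in> I2. q i = q2}"] inj_on_subset[OF inj(2)] by auto
  qed
  then obtain i j k where ij: "i \<in> I1" "q i = q1" "j \<in> I2" "q j = q2"
    and k: "k \<ge> n" "k \<in> A (fst (\<beta> i))" "k \<in> A (fst (\<beta> j))"
    by auto
  define \<eta> where "\<eta> = bvec k m u"
  define \<zeta> where "\<zeta> = bvec k m v"
  define x where "x = \<phi> (gen t (\<alpha> i))"
  define y where "y = \<phi> (gen t (\<alpha> j))"
  have w: "\<eta> = w t' (\<beta> i) k" "\<zeta> = w t' (\<beta> j) k"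
    using I1[OF ij(1)] I2[OF ij(3)] by (auto simp: \<eta>_def \<zeta>_def w_def)
  have norm1: "norm \<eta> = 1" "norm \<zeta> = 1"
    by (simp_all add: w norm_w)
  have g\<eta>: "blinfun_apply (gen t' (\<beta> i)) \<eta> = \<eta>" "blinfun_apply (gen t' (\<beta> j)) \<zeta> = \<zeta>"
    using k by (simp_all add: w gen_w)
  have gA: "gen t (\<alpha> i) \<in> Alg t" "gen t (\<alpha> j) \<in> Alg t"
    using ij \<alpha>\<beta> by (auto intro: gen_in_Alg)
  have approx: "norm (blinfun_apply z \<xi> - \<xi>) \<le> 2 * e"
    if "norm (z - g - q0) < e" "blinfun_apply g \<xi> = \<xi>" "norm (blinfun_apply q0 \<xi>) < e" "norm \<xi> = 1"
    for z g q0 and \<xi> :: "real ell2"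
  proof -
    have "norm (blinfun_apply (z - g - q0) \<xi>) \<le> e"
      using norm_blinfun[of "z - g - q0" \<xi>] that by simp
    then have "norm (blinfun_apply (z - g - q0) \<xi> + blinfun_apply q0 \<xi>) \<le> e + e"
      using that(3) by (intro norm_triangle_mono) auto
    then show ?thesis
      using that(2) by (simp add: minus_blinfun.rep_eq)
  qed
  have x\<eta>: "norm (blinfun_apply x \<eta> - \<eta>) \<le> 2 * e"
    using q[of i] ij n(1)[OF k(1)] norm1 g\<eta> unfolding x_def \<eta>_def by (intro approx) auto
  have y\<zeta>: "norm (blinfun_apply y \<zeta> - \<zeta>) \<le> 2 * e"
    using q[of j] ij n(2)[OF k(1)] norm1 g\<eta> unfolding y_def \<zeta>_def by (intro approx) auto
  have contr: "norm (\<phi> a) \<le> norm a" if "a \<in> Alg t" for a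
    using star_isomorphism_contractive[OF cstar_Alg cstar_Alg iso that] .
  have "norm y \<le> 1"
    unfolding y_def using contr[OF gA(2)] norm_gen_le order_trans by blast
  have "cmod (cinner (blinfun_apply y \<zeta>) (blinfun_apply x \<eta>)) \<le> B"
  proof -
    have "is_adjoint x x"
      unfolding x_def by (rule \<phi>(6)[OF gA(1) gA(1) is_adjoint_gen])
    then have "cinner (blinfun_apply y \<zeta>) (blinfun_apply x \<eta>) = cinner (blinfun_apply (x o\<^sub>L y) \<zeta>) \<eta>"
      by (simp add: is_adjoint_def)
    also have "cmod \<dots> \<le> norm (blinfun_apply (x o\<^sub>L y) \<zeta>)"
      using cmod_cinner_le[of "blinfun_apply (x o\<^sub>L y) \<zeta>" \<eta>] norm1 by simp
    also have "\<dots> \<le> norm (x o\<^sub>L y)"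
      using norm_blinfun[of "x o\<^sub>L y" \<zeta>] norm1 by simp
    also have "x o\<^sub>L y = \<phi> (gen t (\<alpha> i) o\<^sub>L gen t (\<alpha> j))"
      by (simp add: x_def y_def \<phi>(5)[OF gA])
    also have "norm \<dots> \<le> B"
      using contr[OF AlgD(6)[OF gA]] B[OF ij(1,3)] by linarith
    finally show ?thesis .
  qed
  moreover have "cmod (cinner (\<zeta> - blinfun_apply y \<zeta>) \<eta>) \<le> 2 * e"
    using cmod_cinner_le[of "\<zeta> - blinfun_apply y \<zeta>" \<eta>] y\<zeta> norm1 by (simp add: norm_minus_commute)
  moreover have "cmod (cinner (blinfun_apply y \<zeta>) (\<eta> - blinfun_apply x \<eta>)) \<le> 2 * e"
  proof -
    have "cmod (cinner (blinfun_apply y \<zeta>) (\<eta> - blinfun_apply x \<eta>))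
        \<le> norm (blinfun_apply y \<zeta>) * norm (\<eta> - blinfun_apply x \<eta>)"
      by (rule cmod_cinner_le)
    also have "\<dots> \<le> 1 * norm (\<eta> - blinfun_apply x \<eta>)"
      using norm_blinfun[of y \<zeta>] norm1 \<open>norm y \<le> 1\<close> by (intro mult_right_mono) auto
    finally show ?thesis
      using x\<eta> by (simp add: norm_minus_commute)
  qed
  moreover have "cinner \<zeta> \<eta> = cinner (blinfun_apply y \<zeta>) (blinfun_apply x \<eta>)
      + cinner (\<zeta> - blinfun_apply y \<zeta>) \<eta> + cinner (blinfun_apply y \<zeta>) (\<eta> - blinfun_apply x \<eta>)"
    by (simp add: cinner_diff_left cinner_diff_right)
  moreover have "cmod (p1 + p2 + p3) \<le> cmod p1 + cmod p2 + cmod p3" for p1 p2 p3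
    by (meson add_mono_thms_linordered_semiring(3) norm_triangle_ineq order_trans)
  ultimately have "cmod (cinner \<zeta> \<eta>) \<le> B + 2 * e + 2 * e"
    by (smt (verit))
  moreover have "cmod (cinner \<zeta> \<eta>) = \<bar>dot u v\<bar>"
    by (simp add: \<zeta>_def \<eta>_def cinner_bvec_bvec dot_commute)
  ultimately show "\<bar>dot u v\<bar> \<le> B + e'"
    by (simp add: e_def)
qed

lemma norm_gen_gen:
  "norm (gen t \<kappa> o\<^sub>L gen t \<mu>) \<le> (if snd \<kappa> = snd \<mu> then \<bar>dot (dir t \<kappa>) (dir t \<mu>)\<bar> else 0)"
  unfolding gen_def by (rule norm_blk_product) simp_all

text \<open>The generators over \<open>J1 \<times> {m}\<close> correspond modulo compact operators to generators of the other
  algebra, and uncountably many of them to generators with the same \<open>m\<close> and the same kind of vector;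
  likewise for \<open>J2 \<times> {m}\<close>. Comparing angles in both directions shows that the angle between
  the two vectors is preserved. It is neither \<open>0\<close> nor a right angle, so it is the angle that belongs
  to a parameter of the other algebra.\<close>

lemma star_isomorphic_params:
  assumes iso: "star_isomorphic (Alg t) (Alg t')" and pos: "\<And>m. t m > 0" "\<And>m. t' m > 0"
  shows "\<exists>m'. t m = t' m'"
proof -
  obtain \<phi> where \<phi>: "star_isomorphism (Alg t) (Alg t') \<phi>"
    using iso by (auto simp: star_isomorphic_def)
  note inv = star_isomorphism_inv[OF cstar_Alg \<phi>]
  define f where "f \<kappa> = (SOME \<mu>. \<mu> \<in> \<Lambda> \<and> \<phi> (gen t \<kappa>) - gen t' \<mu> \<in> Kop)" for \<kappa>
  have f: "f \<kappa> \<in> \<Lambda> \<and> \<phi> (gen t \<kappa>) - gen t' (f \<kappa>) \<in> Kop" if "\<kappa> \<in> \<Lambda>" for \<kappa>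
    unfolding f_def by (rule someI_ex) (use star_isomorphism_gen[OF \<phi> that] in blast)
  have f_inj: "inj_on f \<Lambda>"
    by (rule inj_onI) (metis f star_isomorphism_gen_inj[OF \<phi>])
  have finv: "inv_into (Alg t) \<phi> (gen t' (f \<kappa>)) - gen t \<kappa> \<in> Kop" if "\<kappa> \<in> \<Lambda>" for \<kappa>
    using star_isomorphism_gen_inv[OF \<phi> that] f[OF that] by blast
  define cl where "cl \<kappa> = (snd (f \<kappa>), fst (f \<kappa>) \<in> J1)" for \<kappa>
  have unc': "uncountable (J1 \<times> {m})" "uncountable (J2 \<times> {m})"
    using unc countable_image[of _ fst] by (metis fst_image_times insert_not_empty)+
  obtain c1 where c1: "uncountable {\<kappa> \<in> J1 \<times> {m}. cl \<kappa> = c1}"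
    by (rule uncountable_fiber[OF unc'(1), of cl UNIV]) auto
  obtain c2 where c2: "uncountable {\<kappa> \<in> J2 \<times> {m}. cl \<kappa> = c2}"
    by (rule uncountable_fiber[OF unc'(2), of cl UNIV]) auto
  define I1 where "I1 = {\<kappa> \<in> J1 \<times> {m}. cl \<kappa> = c1}"
  define I2 where "I2 = {\<kappa> \<in> J2 \<times> {m}. cl \<kappa> = c2}"
  have unc12: "uncountable I1" "uncountable I2"
    using c1 c2 by (auto simp: I1_def I2_def)
  have I\<Lambda>: "\<kappa> \<in> \<Lambda>" if "\<kappa> \<in> I1 \<union> I2" for \<kappa>
    using that by (auto simp: I1_def I2_def \<Lambda>_def)
  have inj: "inj_on f I1" "inj_on f I2"
    using I\<Lambda> by (auto intro: inj_on_subset[OF f_inj])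
  define u where "u = dirv (t m) True"
  define v where "v = dirv (t m) False"
  define u' where "u' = dirv (t' (fst c1)) (snd c1)"
  define v' where "v' = dirv (t' (fst c2)) (snd c2)"
  have d1: "snd \<kappa> = m \<and> dir t \<kappa> = u" "snd (f \<kappa>) = fst c1 \<and> dir t' (f \<kappa>) = u'" if "\<kappa> \<in> I1" for \<kappa>
    using that by (auto simp: I1_def cl_def dir_def u_def u'_def)
  have d2: "snd \<kappa> = m \<and> dir t \<kappa> = v" "snd (f \<kappa>) = fst c2 \<and> dir t' (f \<kappa>) = v'" if "\<kappa> \<in> I2" for \<kappa>
  proof -
    have "fst \<kappa> \<notin> J1"
      using that disj by (auto simp: I2_def)
    then show "snd \<kappa> = m \<and> dir t \<kappa> = v" "snd (f \<kappa>) = fst c2 \<and> dir t' (f \<kappa>) = v'"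
      using that by (auto simp: I2_def cl_def dir_def v_def v'_def)
  qed
  have uv: "dot u v = inverse (sqrt (1 + (t m)\<^sup>2))"
    by (simp add: u_def v_def dot_dirv)
  have root: "sqrt (1 + x\<^sup>2) > 1" if "x > 0" for x :: real
    using that by (simp add: zero_less_power)
  have uv01: "0 < dot u v" "dot u v < 1"
  proof -
    have "sqrt (1 + (t m)\<^sup>2) > 1"
      by (rule root[OF pos(1)])
    then show "0 < dot u v" "dot u v < 1"
      unfolding uv by (simp_all add: inverse_less_1_iff del: real_sqrt_gt_0_iff real_sqrt_gt_1_iff)
  qed
  have le: "\<bar>dot u v\<bar> \<le> (if fst c1 = fst c2 then \<bar>dot u' v'\<bar> else 0)"
  proof (rule angle_le[OF inv unc12, of "\<lambda>\<kappa>. \<kappa>" f])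
    show "f i \<in> \<Lambda> \<and> i \<in> \<Lambda> \<and> inv_into (Alg t) \<phi> (gen t' (f i)) - gen t i \<in> Kop" if "i \<in> I1 \<union> I2" for i
      using I\<Lambda>[OF that] f finv by blast
    show "norm (gen t' (f i) o\<^sub>L gen t' (f j)) \<le> (if fst c1 = fst c2 then \<bar>dot u' v'\<bar> else 0)"
      if "i \<in> I1" "j \<in> I2" for i j
      using norm_gen_gen[of t' "f i" "f j"]
      by (simp only: d1(2)[OF that(1), THEN conjunct1] d1(2)[OF that(1), THEN conjunct2]
          d2(2)[OF that(2), THEN conjunct1] d2(2)[OF that(2), THEN conjunct2])
  qed (use d1(1) d2(1) in auto)
  then have same: "fst c1 = fst c2"
    using uv01 by (auto split: if_splits)
  have "\<bar>dot u' v'\<bar> \<le> \<bar>dot u v\<bar>"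
  proof (rule angle_le[OF \<phi> unc12 inj, of "\<lambda>\<kappa>. \<kappa>"])
    show "i \<in> \<Lambda> \<and> f i \<in> \<Lambda> \<and> \<phi> (gen t i) - gen t' (f i) \<in> Kop" if "i \<in> I1 \<union> I2" for i
      using I\<Lambda>[OF that] f by blast
    show "norm (gen t i o\<^sub>L gen t j) \<le> \<bar>dot u v\<bar>" if "i \<in> I1" "j \<in> I2" for i j
      using norm_gen_gen[of t i j]
      by (simp only: d1(1)[OF that(1), THEN conjunct1] d1(1)[OF that(1), THEN conjunct2]
          d2(1)[OF that(2), THEN conjunct1] d2(1)[OF that(2), THEN conjunct2] refl if_True)
  qed (use d1(2) d2(2) same in auto)
  with le same have eq: "\<bar>dot u' v'\<bar> = dot u v"
    using uv01 by simp
  have "snd c1 \<noteq> snd c2"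
  proof
    assume "snd c1 = snd c2"
    then have "dot u' v' = 1"
      using same by (simp add: u'_def v'_def dot_dirv)
    then show False
      using eq uv01 by simp
  qed
  then have "dot u' v' = inverse (sqrt (1 + (t' (fst c1))\<^sup>2))"
    using same by (cases "snd c1") (auto simp: u'_def v'_def dot_dirv
        dot_commute[of "dirv x False" "dirv x True" for x])
  then have "inverse (sqrt (1 + (t' (fst c1))\<^sup>2)) = inverse (sqrt (1 + (t m)\<^sup>2))"
    using eq uv by simp
  then have "(t' (fst c1))\<^sup>2 = (t m)\<^sup>2"
    by simp
  then have "t m = t' (fst c1)"
    using pos[of m] pos(2)[of "fst c1"] by (simp add: power2_eq_iff_nonneg less_imp_le)
  then show ?thesis ..
qed

section \<open>Non-separability\<close>

text \<open>Uncountably many generators have mutual distance at least \<open>1\<close>.\<close>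

lemma not_separable_Alg: "\<not> separable_space (top_of_set (Alg t))"
proof
  assume "separable_space (top_of_set (Alg t))"
  then obtain U where U: "countable U" "U \<subseteq> Alg t" "Alg t \<subseteq> closure U"
    by (auto simp: separable_space_def closure_of_subtopology Int_absorb1)
  have in\<Lambda>: "(s, 0) \<in> \<Lambda>" if "s \<in> J1" for s
    using that by (simp add: \<Lambda>_def)
  define q where "q s = (SOME u. u \<in> U \<and> dist u (gen t (s, 0)) < 1 / 2)" for s
  have q: "q s \<in> U \<and> dist (q s) (gen t (s, 0)) < 1 / 2" if "s \<in> J1" for s
  proof -
    have "gen t (s, 0) \<in> closure U"
      using U(3) gen_in_Alg[OF in\<Lambda>[OF that]] by blast
    then have "\<exists>u. u \<in> U \<and> dist u (gen t (s, 0)) < 1 / 2"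
      unfolding closure_approachable Bex_def by (elim allE[of _ "1 / 2"]) simp
    then show ?thesis
      unfolding q_def by (rule someI_ex)
  qed
  obtain u where "uncountable {s \<in> J1. q s = u}"
    by (rule uncountable_fiber[OF unc(1) _ U(1), of q]) (use q in auto)
  then have inf_u: "infinite {s \<in> J1. q s = u}"
    using countable_finite by blast
  then obtain s where s: "s \<in> J1" "q s = u"
    using infinite_imp_nonempty by blast
  have "infinite ({s \<in> J1. q s = u} - {s})"
    using inf_u by simp
  then obtain s' where s': "s' \<in> J1" "q s' = u" "s' \<noteq> s"
    using infinite_imp_nonempty[of "{s \<in> J1. q s = u} - {s}"] by blast
  have "infinite (A s - A s')"
  proof -
    have "A s - A s' = A s - (A s \<inter> A s')"
      by blast
    then show ?thesis
      using Diff_infinite_finite[of "A s \<inter> A s'" "A s"] inf[of s] almost_disjoint[of s s'] s s' by simp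
  qed
  then obtain k where k: "k \<in> A s" "k \<notin> A s'"
    using infinite_imp_nonempty by blast
  have "blinfun_apply (gen t (s, 0) - gen t (s', 0)) (w t (s, 0) k) = w t (s, 0) k"
    using k gen_w[of k "(s, 0)" t] by (simp add: minus_blinfun.rep_eq) (simp add: gen_def w_def blk_bvec)
  then have "1 \<le> norm (gen t (s, 0) - gen t (s', 0))"
    using norm_blinfun[of "gen t (s, 0) - gen t (s', 0)" "w t (s, 0) k"] by (simp add: norm_w)
  moreover have "dist (gen t (s, 0)) (gen t (s', 0)) < 1"
    using q[OF s(1)] q[OF s'(1)] s(2) s'(2) dist_triangle_half_r[of u "gen t (s, 0)" 1 "gen t (s', 0)"] by simp
  ultimately show False
    by (simp add: dist_norm)
qed

section \<open>Completely bounded distance\<close>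

definition ratio :: "(nat \<Rightarrow> real) \<Rightarrow> (nat \<Rightarrow> real) \<Rightarrow> (nat \<Rightarrow> nat) \<Rightarrow> nat \<Rightarrow> bool \<Rightarrow> real" where
  "ratio t t' \<sigma> m i = (if i then t' m / t (\<sigma> m) else 1)"

text \<open>Rescaling the second coordinate by \<open>t' (\<tau> m) / t m\<close> fixes \<open>(1, 0)\<close> and takes \<open>(1, t m)\<close> to
  \<open>(1, t' (\<tau> m))\<close>. The image of a generator is therefore a multiple of a generator.\<close>

lemma resc_Alg:
  assumes l: "\<And>m i. \<bar>ratio t t' \<sigma> m i\<bar> \<le> B" and \<sigma>: "\<And>m. \<sigma> (\<tau> m) = m" "\<And>m. \<tau> (\<sigma> m) = m"
    and pos: "\<And>m. t m > 0" "\<And>m. t' m > 0" and x: "x \<in> Alg t"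
  shows "(resc (ratio t t' \<sigma>) \<sigma> o\<^sub>L x) o\<^sub>L resc (\<lambda>m. ratio t t' \<sigma> (\<tau> m)) \<tau> \<in> Alg t'"
proof -
  let ?L = "resc (ratio t t' \<sigma>) \<sigma>" and ?R = "resc (\<lambda>m. ratio t t' \<sigma> (\<tau> m)) \<tau>"
  have adj: "is_adjoint ?L ?R"
    by (rule is_adjoint_resc[OF l \<sigma>])
  have cl: "clinear_op ?L"
    by (rule is_adjoint_clinear[OF adj])
  show ?thesis
    unfolding Alg_def
  proof (rule closed_span_map[where T = "\<lambda>x. (?L o\<^sub>L x) o\<^sub>L ?R"])
    show "x \<in> closed_span (gens t)"
      using x by (simp add: Alg_def)
    show "bounded_linear (\<lambda>x. (?L o\<^sub>L x) o\<^sub>L ?R)"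
      by (rule bounded_linear_compose[OF
          bounded_bilinear.bounded_linear_left[OF bounded_bilinear_blinfun_compose]
          bounded_bilinear.bounded_linear_right[OF bounded_bilinear_blinfun_compose]])
    show "(?L o\<^sub>L scale_op c x) o\<^sub>L ?R = scale_op c ((?L o\<^sub>L x) o\<^sub>L ?R)" for c x
      by (simp add: blinfun_compose_scale_op_right[OF cl] blinfun_compose_scale_op_left)
    show "(?L o\<^sub>L g) o\<^sub>L ?R \<in> closed_span (gens t')" if "g \<in> gens t" for g
    proof (cases "g \<in> munits")
      case True
      then obtain p q where g: "g = rank1 (ket (pt p)) (ket (pt q))"
        unfolding munits_def by blast
      have "(?L o\<^sub>L g) o\<^sub>L ?R = rank1 (blinfun_apply ?L (ket (pt p))) (blinfun_apply ?L (ket (pt q)))"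
        by (simp add: g compose_rank1[OF cl] rank1_compose[OF is_adjoint_sym[OF adj]])
      also have "\<dots> \<in> Kop"
        by (cases p; cases q) (simp add: resc_ket[OF l \<sigma>] rank1_linear Kop_simps Kop_unit)
      finally show ?thesis
        using Kop_subset_Alg by (auto simp: Alg_def)
    next
      case False
      then obtain \<kappa> where \<kappa>: "\<kappa> \<in> \<Lambda>" "g = gen t \<kappa>"
        using \<open>g \<in> gens t\<close> by (auto simp: gens_def)
      define \<mu> where "\<mu> = (fst \<kappa>, \<tau> (snd \<kappa>))"
      have \<mu>: "\<mu> \<in> \<Lambda>"
        using \<kappa>(1) by (auto simp: \<mu>_def \<Lambda>_def)
      have "\<exists>c. (\<lambda>i. ratio t t' \<sigma> (\<tau> (snd \<kappa>)) i * dir t \<kappa> i) = (\<lambda>i. c * dir t' \<mu> i)"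
      proof (cases "fst \<kappa> \<in> J1")
        case True
        then show ?thesis
          by (intro exI[of _ 1]) (auto simp: fun_eq_iff dir_def dirv_def \<mu>_def ratio_def)
      next
        case False
        let ?s = "\<lambda>x. sqrt (1 + x\<^sup>2) :: real"
        have s: "?s x \<noteq> 0" for x
          by (smt (verit) real_sqrt_eq_zero_cancel_iff zero_le_power2)
        show ?thesis
          using False pos(1)[of "snd \<kappa>"] s
          by (intro exI[of _ "?s (t' (\<tau> (snd \<kappa>))) / ?s (t (snd \<kappa>))"])
             (auto simp: fun_eq_iff dir_def dirv_def \<mu>_def ratio_def \<sigma> field_simps)
      qed
      then obtain c where c: "(\<lambda>i. ratio t t' \<sigma> (\<tau> (snd \<kappa>)) i * dir t \<kappa> i) = (\<lambda>i. c * dir t' \<mu> i)"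
        by blast
      have "(?L o\<^sub>L g) o\<^sub>L ?R = blk (A (fst \<kappa>)) (\<tau> (snd \<kappa>)) (\<lambda>i. c * dir t' \<mu> i) (\<lambda>i. c * dir t' \<mu> i)"
        unfolding \<kappa>(2) gen_def resc_blk[where l = "ratio t t' \<sigma>" and \<sigma> = \<sigma> and \<tau> = \<tau>, OF l \<sigma>] c ..
      also have "\<dots> = scale_op (of_real c) (scale_op (of_real c) (gen t' \<mu>))"
        by (simp add: blk_scale gen_def \<mu>_def)
      also have "\<dots> \<in> Alg t'"
        by (intro AlgD(4) gen_in_Alg \<mu>)
      finally show ?thesis
        by (simp add: Alg_def)
    qed
  qed
qed

lemma resc_inverse:
  assumes l: "\<And>m i. \<bar>l m i\<bar> \<le> B" "\<And>m i. \<bar>l' m i\<bar> \<le> B'"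
    and \<sigma>: "\<And>m. \<sigma> (\<tau> m) = m" "\<And>m. \<tau> (\<sigma> m) = m" and ll': "\<And>m i. l' m i * l (\<tau> m) i = 1"
    and x: "x \<in> Alg t"
  shows "(resc l' \<tau> o\<^sub>L ((resc l \<sigma> o\<^sub>L x) o\<^sub>L resc (\<lambda>m. l (\<tau> m)) \<tau>)) o\<^sub>L resc (\<lambda>m. l' (\<sigma> m)) \<sigma> = x"
proof (rule blinfun_eqI)
  fix \<xi>
  let ?L = "resc l \<sigma>" and ?R = "resc (\<lambda>m. l (\<tau> m)) \<tau>"
  let ?L' = "resc l' \<tau>" and ?R' = "resc (\<lambda>m. l' (\<sigma> m)) \<sigma>"
  have adj: "is_adjoint ?L ?R" "is_adjoint ?L' ?R'"
    by (rule is_adjoint_resc[OF l(1) \<sigma>], rule is_adjoint_resc[OF l(2) \<sigma>(2,1)])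
  have LL: "blinfun_apply ?L' (blinfun_apply ?L (blinfun_apply a z)) = blinfun_apply a z" if "a \<in> Alg t" for a z
    by (rule resc_resc[where l = l and l' = l' and \<sigma> = \<sigma> and \<tau> = \<tau>, OF l \<sigma> ll']) (rule Alg_not_pt[OF that])
  obtain y where y: "y \<in> Alg t" "is_adjoint x y"
    using AlgD(7)[OF x] by blast
  have "cinner (blinfun_apply x (blinfun_apply ?R (blinfun_apply ?R' \<xi>)) - blinfun_apply x \<xi>) \<zeta> = 0" for \<zeta>
  proof -
    have "cinner (blinfun_apply x (blinfun_apply ?R (blinfun_apply ?R' \<xi>))) \<zeta>
        = cinner \<xi> (blinfun_apply ?L' (blinfun_apply ?L (blinfun_apply y \<zeta>)))"
      using adj[THEN is_adjoint_sym] y(2) by (simp add: is_adjoint_def)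
    then show ?thesis
      using y(2) by (simp add: LL[OF y(1)] cinner_diff_left is_adjoint_def)
  qed
  then have "blinfun_apply x (blinfun_apply ?R (blinfun_apply ?R' \<xi>)) = blinfun_apply x \<xi>"
    using cinner_eq_0_imp eq_iff_diff_eq_0 by blast
  then show "blinfun_apply ((?L' o\<^sub>L ((?L o\<^sub>L x) o\<^sub>L ?R)) o\<^sub>L ?R') \<xi> = blinfun_apply x \<xi>"
    using LL[OF x] by simp
qed

text \<open>There are four factors \<open>B\<close>, one for each of the rescaling operator, its inverse and their adjoints.\<close>

lemma d_cb_Alg_le:
  assumes \<sigma>: "\<And>m. \<sigma> (\<tau> m) = m" "\<And>m. \<tau> (\<sigma> m) = m" and pos: "\<And>m. t m > 0" "\<And>m. t' m > 0"
    and B: "B \<ge> 1" "\<And>m. t' m \<le> B * t (\<sigma> m)" "\<And>m. t m \<le> B * t' (\<tau> m)"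
  shows "d_cb (Alg t) (Alg t') \<le> ennreal (B ^ 4)"
proof -
  let ?l = "ratio t t' \<sigma>" and ?l' = "ratio t' t \<tau>"
  have l: "\<bar>?l m i\<bar> \<le> B" "\<bar>?l' m i\<bar> \<le> B" for m i
    using B pos by (auto simp: ratio_def pos_divide_le_eq abs_of_pos)
  have ll: "?l' m i * ?l (\<tau> m) i = 1" "?l m i * ?l' (\<sigma> m) i = 1" for m i
    using pos[of m] pos(1)[of "\<sigma> m"] pos(2)[of "\<tau> m"] by (auto simp: ratio_def \<sigma>)
  let ?L = "resc ?l \<sigma>" and ?R = "resc (\<lambda>m. ?l (\<tau> m)) \<tau>"
  let ?L' = "resc ?l' \<tau>" and ?R' = "resc (\<lambda>m. ?l' (\<sigma> m)) \<sigma>"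
  have adj: "is_adjoint ?L ?R" "is_adjoint ?L' ?R'"
    by (rule is_adjoint_resc[OF l(1) \<sigma>], rule is_adjoint_resc[OF l(2) \<sigma>(2,1)])
  have inj: "inj \<sigma>" "inj \<tau>"
    by (metis injI \<sigma>(2)) (metis injI \<sigma>(1))
  have n: "norm ?L \<le> B" "norm ?L' \<le> B"
    by (rule ell2_nth_resc(3)[OF l(1) inj(1)], rule ell2_nth_resc(3)[OF l(2) inj(2)])
  then have n': "norm ?R \<le> B" "norm ?R' \<le> B"
    using norm_adjoint[OF adj(1)] norm_adjoint[OF adj(2)] by auto
  have "d_cb (Alg t) (Alg t') \<le> ennreal (norm ?L * norm ?R * (norm ?L' * norm ?R'))"
  proof (rule d_cb_conjugate_le)
    show "(?L o\<^sub>L x) o\<^sub>L ?R \<in> Alg t'" if "x \<in> Alg t" for x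
      by (rule resc_Alg[OF l(1) \<sigma> pos that])
    show "(?L' o\<^sub>L y) o\<^sub>L ?R' \<in> Alg t" if "y \<in> Alg t'" for y
      by (rule resc_Alg[OF l(2) \<sigma>(2,1) pos(2,1) that])
    show "(?L' o\<^sub>L ((?L o\<^sub>L x) o\<^sub>L ?R)) o\<^sub>L ?R' = x" if "x \<in> Alg t" for x
      by (rule resc_inverse[where l = ?l and l' = ?l' and \<sigma> = \<sigma> and \<tau> = \<tau>, OF l \<sigma> ll(1) that])
    show "(?L o\<^sub>L ((?L' o\<^sub>L y) o\<^sub>L ?R')) o\<^sub>L ?R = y" if "y \<in> Alg t'" for y
      by (rule resc_inverse[where l = ?l' and l' = ?l and \<sigma> = \<tau> and \<tau> = \<sigma>, OF l(2,1) \<sigma>(2,1) ll(2) that])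
    show "clinear_op ?L"
      by (rule is_adjoint_clinear[OF adj(1)])
  qed
  also have "\<dots> \<le> ennreal (B * B * (B * B))"
    using n n' B(1) by (intro ennreal_leI mult_mono) auto
  also have "B * B * (B * B) = B ^ 4"
    by (simp add: power4_eq_xxxx)
  finally show ?thesis .
qed

lemma d_cb_Alg_ge_1: "1 \<le> d_cb (Alg t) (Alg t')"
proof (rule d_cb_ge_1)
  show "operator_space (Alg t)" "operator_space (Alg t')"
    using cstar_Alg by (auto simp: cstar_algebra_def)
  show "rank1 (ket (pt undefined)) (ket (pt undefined)) \<in> Alg t"
    using Kop_unit Kop_subset_Alg by blast
  have "ket (pt undefined) \<noteq> 0"
    using ell2_nth_ket[of "pt undefined" "pt undefined"] by auto
  then show "rank1 (ket (pt undefined)) (ket (pt undefined)) \<noteq> 0"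
    by (simp add: rank1_self_eq_0_iff)
qed

end

section \<open>Two sequences of parameters\<close>

text \<open>Both sequences consist of the values \<open>1 + 1 / (n + 1)\<close>, and \<open>seqC\<close> has the limit \<open>1\<close> as an
  additional value at the index \<open>0\<close>. As in Hilbert's hotel, \<open>shift N\<close> matches the two sequences up to
  a factor \<open>seqD N\<close>: the value \<open>1\<close> of \<open>seqC\<close> takes the place \<open>N\<close>, the first \<open>N\<close> values of
  \<open>seqD\<close> are matched exactly, and the later ones are all between \<open>1\<close> and \<open>seqD N\<close>.\<close>

definition seqD :: "nat \<Rightarrow> real" where "seqD n = 1 + 1 / (real n + 1)"

definition seqC :: "nat \<Rightarrow> real" where "seqC n = (case n of 0 \<Rightarrow> 1 | Suc k \<Rightarrow> seqD k)"

definition shift :: "nat \<Rightarrow> nat \<Rightarrow> nat" where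
  "shift N m = (if m < N then m + 1 else if m = N then 0 else m)"

definition unshift :: "nat \<Rightarrow> nat \<Rightarrow> nat" where
  "unshift N m = (if m = 0 then N else if m \<le> N then m - 1 else m)"

lemma seqD_antimono: "m \<le> n \<Longrightarrow> seqD n \<le> seqD m"
  by (simp add: seqD_def frac_le)

lemma seqD_gt_1: "seqD n > 1"
  by (simp add: seqD_def)

lemma (in luzin) d_cb_seq: "d_cb (Alg seqC) (Alg seqD) = 1"
proof (rule antisym)
  have "d_cb (Alg seqC) (Alg seqD) \<le> ennreal (seqD N ^ 4)" for N
  proof (rule d_cb_Alg_le[of "shift N" "unshift N"])
    show "shift N (unshift N m) = m" "unshift N (shift N m) = m" for m
      by (auto simp: shift_def unshift_def)
    show pos: "seqC m > 0" "seqD m > 0" for m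
      using seqD_gt_1 less_trans[OF zero_less_one] by (auto simp: seqC_def split: nat.split)
    show N1: "seqD N \<ge> 1"
      using seqD_gt_1[of N] by simp
    have le: "x \<le> seqD N * y" if "x \<le> y" "y > 0" for x y
      using that(1) mult_right_mono[OF N1 less_imp_le[OF that(2)]] by simp
    show "seqD m \<le> seqD N * seqC (shift N m)" for m
    proof -
      consider "m < N" | "m = N" | k where "m = Suc k" "N < m"
        by (metis linorder_neqE_nat not0_implies_Suc not_less_zero)
      then show ?thesis
        using seqD_antimono[of "m - 1" m] seqD_gt_1 less_trans[OF zero_less_one]
        by cases (auto simp: shift_def seqC_def intro!: le)
    qed
    show "seqC m \<le> seqD N * seqD (unshift N m)" for m
    proof -
      consider "m = 0" | k where "m = Suc k" "m \<le> N" | k where "m = Suc k" "N \<le> k"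
        by (metis not0_implies_Suc not_less_eq_eq)
      then show ?thesis
      proof cases
        case 1
        have "1 * 1 \<le> seqD N * seqD N"
          using N1 by (intro mult_mono) auto
        then show ?thesis
          by (simp add: 1 seqC_def unshift_def)
      next
        case (2 k)
        then show ?thesis
          using le[OF order_refl pos(2)[of k]] by (simp add: seqC_def unshift_def)
      next
        case (3 k)
        have "seqD k * 1 \<le> seqD N * seqD m"
          using 3 N1 seqD_gt_1[of m] seqD_antimono[of N k] by (intro mult_mono) auto
        then show ?thesis
          using 3 by (simp add: seqC_def unshift_def)
      qed
    qed
  qed
  moreover have "(\<lambda>N. ennreal (seqD N ^ 4)) \<longlonglongrightarrow> ennreal (1 ^ 4)"
  proof (intro tendsto_ennrealI tendsto_power)
    have "(\<lambda>n. 1 + 1 / (real n + 1)) \<longlonglongrightarrow> 1 + 0"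
      by (intro tendsto_add tendsto_const) (use LIMSEQ_inverse_real_of_nat in \<open>simp add: inverse_eq_divide add.commute\<close>)
    then show "seqD \<longlonglongrightarrow> 1"
      by (simp add: seqD_def[abs_def])
  qed
  ultimately show "d_cb (Alg seqC) (Alg seqD) \<le> 1"
    using LIMSEQ_le_const[of "\<lambda>N. ennreal (seqD N ^ 4)" "ennreal (1 ^ 4)"] by auto
  show "1 \<le> d_cb (Alg seqC) (Alg seqD)"
    by (rule d_cb_Alg_ge_1)
qed

lemma (in luzin) not_isomorphic_seq: "\<not> star_isomorphic (Alg seqC) (Alg seqD)"
proof
  assume iso: "star_isomorphic (Alg seqC) (Alg seqD)"
  have "seqC m > 0" "seqD m > 0" for m
    using seqD_gt_1 less_trans[OF zero_less_one] by (auto simp: seqC_def split: nat.split)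
  from star_isomorphic_params[OF iso this, of 0] obtain m' where "seqC 0 = seqD m'"
    by blast
  then show False
    using seqD_gt_1[of m'] by (simp add: seqC_def)
qed

lemma luzin_exists: "\<exists>(J1 :: nat set set) J2 A. luzin J1 J2 A"
proof (rule luzin_family_exists)
  fix J :: "nat set set" and A :: "nat set \<Rightarrow> nat set"
  assume J: "uncountable J" "\<And>s. s \<in> J \<Longrightarrow> infinite (A s)"
    "\<And>s s'. s \<in> J \<Longrightarrow> s' \<in> J \<Longrightarrow> s \<noteq> s' \<Longrightarrow> finite (A s \<inter> A s')"
    "\<And>X Y n. X \<subseteq> J \<Longrightarrow> Y \<subseteq> J \<Longrightarrow> uncountable X \<Longrightarrow> uncountable Y \<Longrightarrow>
       \<exists>x\<in>X. \<exists>y\<in>Y. \<exists>k\<ge>n. k \<in> A x \<inter> A y"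
  obtain J1 J2 where J12: "J = J1 \<union> J2" "J1 \<inter> J2 = {}" "uncountable J1" "uncountable J2"
    by (rule uncountable_split[OF J(1)])
  have "luzin J1 J2 A"
    unfolding luzin_def J12(1)[symmetric] using J12(2-4) J(2-4) by (intro conjI allI impI)
  then show ?thesis
    by blast
qed

theorem corollary3p9:
  shows "\<exists>(C :: (real ell2 \<Rightarrow>\<^sub>L real ell2) set) (D :: (real ell2 \<Rightarrow>\<^sub>L real ell2) set).
    cstar_algebra C \<and> cstar_algebra D \<and>
    \<not> separable_space (top_of_set C) \<and> \<not> separable_space (top_of_set D) \<and>
    \<not> star_isomorphic C D \<and>
    d_cb C D = 1"
proof -
  obtain J1 J2 :: "nat set set" and A where "luzin J1 J2 A"
    using luzin_exists by blast
  then interpret luzin J1 J2 A .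
  show ?thesis
    using cstar_Alg[of seqC] cstar_Alg[of seqD] not_separable_Alg[of seqC] not_separable_Alg[of seqD]
      not_isomorphic_seq d_cb_seq by blast
qed

end
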